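(* Let $(Q^{\mathbb C},\varphi)$ be a Toda pair which provides a primitive harmonic map $\psi:\tilde\Sigma\to G/T$. Let $\nabla$ be the connection and $\rho$ the real involution induced on $Q^{\mathbb C}(\mathfrak m^{\mathbb C})$ by the reduction of structure group $Q\subset Q^{\mathbb C}$. Then the Higgs bundle $(E,\Phi)$ for the projection $f=\pi\circ\psi:\tilde\Sigma\to G/H$ is such that $E\simeq Q^{\mathbb C}(\mathfrak m^{\mathbb C})$ as a smooth bundle, but equipped with the holomorphic structure $\nabla''+\rho\varphi_{\mathfrak k}$ (where $\rho\varphi_{\mathfrak k}$ acts by the adjoint action), and $\Phi=\varphi_{\mathfrak m}$.
   Context: Lie algebra data. $\mathfrak g^{\mathbb C}$ is a complex simple Lie algebra and $\tau$ is the Coxeter automorphism of an affine Dynkin diagram, as follows. Let $\nu$ be a Dynkin diagram symmetry of order $n\in\{1,2,3\}$, also viewed as the order $n$ automorphism of $\mathfrak g^{\mathbb C}$ permuting Chevalley generators, with $e^{2\pi ij/n}$-eigenspaces $\mathfrak g^\nu_j$; $\mathfrak t^{\mathbb C}$ is a Cartan subalgebra of the simple algebra $\mathfrak g^\nu_0$; for $(\alpha,j)\in(\mathfrak t^{\mathbb C})^*\times\mathbb Z_n$, $\mathfrak g^{(\alpha,j)}=\{\xi\in\mathfrak g^\nu_j:[h,\xi]=\alpha(h)\xi\ \forall h\in\mathfrak t^{\mathbb C}\}$ and $\bar R$ is the set of pairs with $\mathfrak g^{(\alpha,j)}\neq 0$; $\alpha_1,\dots,\alpha_r$ are simple roots of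 $\mathfrak g_0^\nu$, $\bar\alpha_j=(\alpha_j,0)$ for $j\ge1$, and $\bar\alpha_0=(\alpha_0,0)$ ($n=1$) or $(\alpha_0,1)$ ($n\ne1$) is the element of $\bar R$ with $\bar\alpha_0-\bar\alpha_j\notin\bar R$ for all $j\ne0$; $m_0=1,m_1,\dots,m_r$ are positive integers with $\sum m_j\alpha_j=0$. With $m=n\sum_jm_j$, $\tau$ is the order $m$ automorphism fixing $\mathfrak t^{\mathbb C}$ pointwise and acting by $e^{\pm2\pi i/m}$ on $\mathfrak g^{\pm\bar\alpha_j}$, $j\in I=\{0,\dots,r\}$; its $e^{2\pi i/m}$-eigenspace is $\mathfrak g_1=\bigoplus_{j\in I}\mathfrak g^{\bar\alpha_j}$. $\kappa$ is the real involution of a $\tau$-invariant compact real form $\mathfrak u$. $\sigma$ is a complex linear involution compatible with $\tau$ (commuting with $\tau$, fixing $\mathfrak t^{\mathbb C}$ pointwise), $\rho=\sigma\kappa=\kappa\sigma$, and $\mathfrak g=\mathfrak h\oplus\mathfrak m$ is the Cartan decomposition of the real form $\mathfrak g$ fixed by $\rho$. $G$ is the corresponding real Lie group with trivial centre, $H$ its maximal compact subgroup with Lie algebra $\mathfrak h$, $T<H$ the torus with Lie algebra $\mathfrak t=\mathfrak t^{\mathbb C}\cap\mathfrak u$, $\pi:G/T\to G/H$ the projection. $\mathfrak p$ is the Killing-orthogonal complement of $\mathfrak t$ in $\mathfrak g$ and $\mathfrak k^{\mathbb C}=\mathfrak p^{\mathbb C}\cap\mathfrak h^{\mathbb C}$,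 so $\mathfrak p^{\mathbb C}=\mathfrak k^{\mathbb C}\oplus\mathfrak m^{\mathbb C}$ is $\mathrm{Ad}_{T^{\mathbb C}}$-invariant. Toda pairs and primitive maps. $\Sigma$ is a compact Riemann surface with universal cover $\tilde\Sigma$ and canonical bundle $K_\Sigma$. A Toda pair is a holomorphic principal $T^{\mathbb C}$-bundle $Q^{\mathbb C}$ with a holomorphic section $\varphi$ of $Q^{\mathbb C}(\mathfrak g_1)\otimes K_\Sigma$, where $Q^{\mathbb C}(V)$ denotes an associated bundle; $\varphi=\varphi_{\mathfrak k}+\varphi_{\mathfrak m}$ is its decomposition according to $Q^{\mathbb C}(\mathfrak p^{\mathbb C})=Q^{\mathbb C}(\mathfrak k^{\mathbb C})\oplus Q^{\mathbb C}(\mathfrak m^{\mathbb C})$. It provides a primitive harmonic map when there is a reduction $Q\subset Q^{\mathbb C}$ to a $T$-bundle with Chern connection $\nabla$ satisfying $F^\nabla+[\varphi\wedge\rho\varphi]=0$ (the geometric Toda equations); then $\nabla+\varphi+\rho\varphi$ is a flat $G$-connection and there is a map $\psi:\tilde\Sigma\to G/T$, equivariant for its holonomy $\pi_1\Sigma\to G$, with $Q=\psi^{-1}G/\pi_1\Sigma$, $\nabla$ induced from the canonical connection of $G\to G/T$, and $\psi^*\beta_1=\varphi+\rho\varphi$, where $\beta_1$ is the Maurer–Cartan form $T(G/T)\to G\times_T\mathfrak p$. The map $\psi$ is $\tau$-primitive ($\partial\psi$ has values in $G\times_T\mathfrak g_1$), and $\psi$, $f=\pi\circ\psi$ are harmonic.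 Higgs bundle of $f$. Let $P=f^{-1}G/\pi_1\Sigma$ (a principal $H$-bundle), $P^{\mathbb C}$ its complexification, $D$ the connection induced by the $\mathfrak h$-component of the left Maurer–Cartan form of $G$, and $\beta_2:T(G/H)\to G\times_H\mathfrak m$ the Maurer–Cartan form of $G/H$. The $G$-Higgs bundle of the equivariant harmonic map $f$ is $(E,\Phi)$ with $E=P^{\mathbb C}(\mathfrak m^{\mathbb C})$ with holomorphic structure $D''$ and $\Phi=(f^*\beta_2)^{(1,0)}\in H^0(E\otimes K_\Sigma)$. For a connection, $''$ denotes its $(0,1)$-part. *)

theory Defs
  imports "HOL-Analysis.Analysis"
begin

section \<open>Complex Lie algebras\<close>

text \<open>
  A complex Lie algebra of finite dimension is carried by the whole of \<open>complex^'n\<close>, with complex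
  scalar multiplication \<open>*s\<close>. Linear groups are sets of matrices with product \<open>**\<close>.
\<close>

type_synonym 'n cvec = "complex^'n"
type_synonym 'n cmat = "complex^'n^'n"

definition lie_bracket :: "('n::finite cvec \<Rightarrow> 'n cvec \<Rightarrow> 'n cvec) \<Rightarrow> bool" where
  "lie_bracket br \<longleftrightarrow>
     (\<forall>x. Vector_Spaces.linear (*s) (*s) (br x)) \<and>
     (\<forall>y. Vector_Spaces.linear (*s) (*s) (\<lambda>x. br x y)) \<and>
     (\<forall>x. br x x = 0) \<and>
     (\<forall>x y z. br x (br y z) + br y (br z x) + br z (br x y) = 0)"

definition simple_lie :: "('n::finite cvec \<Rightarrow> 'n cvec \<Rightarrow> 'n cvec) \<Rightarrow> bool" where
  "simple_lie br \<longleftrightarrow> lie_bracket br \<and> (\<exists>x y. br x y \<noteq> 0) \<and>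
     (\<forall>I. vec.subspace I \<and> (\<forall>x\<in>I. \<forall>y. br y x \<in> I) \<longrightarrow> I = {0} \<or> I = UNIV)"

definition subalgebra :: "('n::finite cvec \<Rightarrow> 'n cvec \<Rightarrow> 'n cvec) \<Rightarrow> 'n cvec set \<Rightarrow> bool" where
  "subalgebra br S \<longleftrightarrow> vec.subspace S \<and> (\<forall>x\<in>S. \<forall>y\<in>S. br x y \<in> S)"

primrec lower_central ::
  "('n::finite cvec \<Rightarrow> 'n cvec \<Rightarrow> 'n cvec) \<Rightarrow> 'n cvec set \<Rightarrow> nat \<Rightarrow> 'n cvec set" where
  "lower_central br S 0 = S"
| "lower_central br S (Suc k) = vec.span {br x y | x y. x \<in> S \<and> y \<in> lower_central br S k}"

text \<open>Nilpotent and self-normalising in \<open>g\<close>.\<close>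

definition cartan_subalgebra ::
  "('n::finite cvec \<Rightarrow> 'n cvec \<Rightarrow> 'n cvec) \<Rightarrow> 'n cvec set \<Rightarrow> 'n cvec set \<Rightarrow> bool" where
  "cartan_subalgebra br g S \<longleftrightarrow> subalgebra br S \<and> S \<subseteq> g \<and>
     (\<exists>k. lower_central br S k = {0}) \<and>
     (\<forall>x\<in>g. (\<forall>y\<in>S. br x y \<in> S) \<longrightarrow> x \<in> S)"

definition lie_aut :: "('n::finite cvec \<Rightarrow> 'n cvec \<Rightarrow> 'n cvec) \<Rightarrow> ('n cvec \<Rightarrow> 'n cvec) \<Rightarrow> bool" where
  "lie_aut br f \<longleftrightarrow> Vector_Spaces.linear (*s) (*s) f \<and> bij f \<and> (\<forall>x y. f (br x y) = br (f x) (f y))"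

definition has_order :: "('v \<Rightarrow> 'v) \<Rightarrow> nat \<Rightarrow> bool" where
  "has_order f n \<longleftrightarrow> 0 < n \<and> f ^^ n = id \<and> (\<forall>k. 0 < k \<and> k < n \<longrightarrow> f ^^ k \<noteq> id)"

text \<open>Chevalley generators \<open>e i, f i, h i\<close> with Cartan matrix \<open>a\<close>, indexed by \<open>i < l\<close>.\<close>

definition chevalley_generators ::
  "('n::finite cvec \<Rightarrow> 'n cvec \<Rightarrow> 'n cvec) \<Rightarrow> nat \<Rightarrow> (nat \<Rightarrow> 'n cvec) \<Rightarrow> (nat \<Rightarrow> 'n cvec) \<Rightarrow>
   (nat \<Rightarrow> 'n cvec) \<Rightarrow> (nat \<Rightarrow> nat \<Rightarrow> int) \<Rightarrow> bool" where
  "chevalley_generators br l e f h a \<longleftrightarrow>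
     inj_on h {..<l} \<and> vec.independent (h ` {..<l}) \<and>
     cartan_subalgebra br UNIV (vec.span (h ` {..<l})) \<and>
     (\<forall>i<l. a i i = 2) \<and>
     (\<forall>i<l. \<forall>j<l. br (h i) (h j) = 0 \<and>
        br (h i) (e j) = of_int (a i j) *s e j \<and>
        br (h i) (f j) = - (of_int (a i j) *s f j) \<and>
        br (e i) (f j) = (if i = j then h i else 0)) \<and>
     (\<forall>S. subalgebra br S \<and> (\<forall>i<l. e i \<in> S \<and> f i \<in> S) \<longrightarrow> S = UNIV)"

definition diagram_automorphism ::
  "('n::finite cvec \<Rightarrow> 'n cvec \<Rightarrow> 'n cvec) \<Rightarrow> ('n cvec \<Rightarrow> 'n cvec) \<Rightarrow> nat \<Rightarrow> bool" where
  "diagram_automorphism br \<nu> n \<longleftrightarrow> lie_aut br \<nu> \<and> has_order \<nu> n \<and>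
     (\<exists>l e f h a \<pi>. chevalley_generators br l e f h a \<and> bij_betw \<pi> {..<l} {..<l} \<and>
        (\<forall>i<l. \<forall>j<l. a (\<pi> i) (\<pi> j) = a i j) \<and>
        (\<forall>i<l. \<nu> (e i) = e (\<pi> i) \<and> \<nu> (f i) = f (\<pi> i) \<and> \<nu> (h i) = h (\<pi> i)))"

section \<open>Coxeter automorphisms of affine diagrams and the real form\<close>

text \<open>
  \<open>sroot 1, \<dots>, sroot rk\<close> are the simple roots of the fixed algebra of \<open>nu\<close>, \<open>sroot 0\<close> is the
  functional part of the affine root, and \<open>mark j\<close> are the integers with
  \<open>\<Sum>j. mark j * sroot j = 0\<close>.
\<close>

record 'n::finite toda_algebra =
  br :: "'n cvec \<Rightarrow> 'n cvec \<Rightarrow> 'n cvec"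
  nu :: "'n cvec \<Rightarrow> 'n cvec"
  nuord :: nat
  tC :: "'n cvec set"
  rk :: nat
  sroot :: "nat \<Rightarrow> 'n cvec \<Rightarrow> complex"
  mark :: "nat \<Rightarrow> nat"
  tau :: "'n cvec \<Rightarrow> 'n cvec"
  kappa :: "'n cvec \<Rightarrow> 'n cvec"
  sigma :: "'n cvec \<Rightarrow> 'n cvec"

definition nu_eigenspace :: "'n::finite toda_algebra \<Rightarrow> nat \<Rightarrow> 'n cvec set" where
  "nu_eigenspace L j = {\<xi>. nu L \<xi> = cis (2 * pi * real j / real (nuord L)) *s \<xi>}"

text \<open>
  Linear functionals on the subspace \<open>tC L\<close> are represented by functions that are \<open>undefined\<close>
  outside it, so that equality of functionals is equality of functions.
\<close>

definition dual_t :: "'n::finite toda_algebra \<Rightarrow> ('n cvec \<Rightarrow> complex) set" where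
  "dual_t L = {\<alpha> \<in> extensional (tC L). \<forall>x\<in>tC L. \<forall>y\<in>tC L. \<forall>c.
      \<alpha> (x + y) = \<alpha> x + \<alpha> y \<and> \<alpha> (c *s x) = c * \<alpha> x}"

definition root_space :: "'n::finite toda_algebra \<Rightarrow> ('n cvec \<Rightarrow> complex) \<Rightarrow> nat \<Rightarrow> 'n cvec set" where
  "root_space L \<alpha> j = {\<xi> \<in> nu_eigenspace L j. \<forall>h\<in>tC L. br L h \<xi> = \<alpha> h *s \<xi>}"

definition Rbar :: "'n::finite toda_algebra \<Rightarrow> (('n cvec \<Rightarrow> complex) \<times> nat) set" where
  "Rbar L = {(\<alpha>, j). \<alpha> \<in> dual_t L \<and> j < nuord L \<and> root_space L \<alpha> j \<noteq> {0}}"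

definition simple_roots :: "'n::finite toda_algebra \<Rightarrow> bool" where
  "simple_roots L \<longleftrightarrow>
    (let roots = {\<alpha>. (\<alpha>, 0) \<in> Rbar L \<and> (\<exists>h\<in>tC L. \<alpha> h \<noteq> 0)} in
     vec.dim (tC L) = rk L \<and>
     (\<forall>j\<in>{1..rk L}. sroot L j \<in> roots) \<and>
     (\<forall>c :: nat \<Rightarrow> complex. (\<forall>h\<in>tC L. (\<Sum>j=1..rk L. c j * sroot L j h) = 0) \<longrightarrow>
        (\<forall>j\<in>{1..rk L}. c j = 0)) \<and>
     (\<forall>\<alpha>\<in>roots. \<exists>k :: nat \<Rightarrow> nat.
        (\<forall>h\<in>tC L. \<alpha> h = (\<Sum>j=1..rk L. of_nat (k j) * sroot L j h)) \<or>
        (\<forall>h\<in>tC L. \<alpha> h = - (\<Sum>j=1..rk L. of_nat (k j) * sroot L j h))))"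

text \<open>The \<open>Z_n\<close>-component of the \<open>j\<close>-th affine simple root.\<close>

definition degr :: "'n::finite toda_algebra \<Rightarrow> nat \<Rightarrow> nat" where
  "degr L j = (if j = 0 \<and> nuord L \<noteq> 1 then 1 else 0)"

definition affine_root :: "'n::finite toda_algebra \<Rightarrow> bool" where
  "affine_root L \<longleftrightarrow> (sroot L 0, degr L 0) \<in> Rbar L \<and>
     (\<forall>j\<in>{1..rk L}. (restrict (\<lambda>h. sroot L 0 h - sroot L j h) (tC L), degr L 0) \<notin> Rbar L)"

definition coxeter_number :: "'n::finite toda_algebra \<Rightarrow> nat" where
  "coxeter_number L = nuord L * (\<Sum>j\<le>rk L. mark L j)"

definition killing :: "'n::finite toda_algebra \<Rightarrow> 'n cvec \<Rightarrow> 'n cvec \<Rightarrow> complex" where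
  "killing L x y = trace (matrix (br L x) ** matrix (br L y))"

definition real_involution :: "'n::finite toda_algebra \<Rightarrow> ('n cvec \<Rightarrow> 'n cvec) \<Rightarrow> bool" where
  "real_involution L \<kappa> \<longleftrightarrow>
     (\<forall>x y. \<kappa> (x + y) = \<kappa> x + \<kappa> y) \<and> (\<forall>c x. \<kappa> (c *s x) = cnj c *s \<kappa> x) \<and>
     (\<forall>x y. \<kappa> (br L x y) = br L (\<kappa> x) (\<kappa> y)) \<and> \<kappa> \<circ> \<kappa> = id"

definition compact_form :: "'n::finite toda_algebra \<Rightarrow> 'n cvec set" where
  "compact_form L = {\<xi>. kappa L \<xi> = \<xi>}"

text \<open>On a real form the Killing form is real valued; the form is compact when it is negative definite.\<close>

definition toda_data :: "'n::finite toda_algebra \<Rightarrow> bool" where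
  "toda_data L \<longleftrightarrow>
     simple_lie (br L) \<and>
     nuord L \<in> {1, 2, 3} \<and> diagram_automorphism (br L) (nu L) (nuord L) \<and>
     cartan_subalgebra (br L) (nu_eigenspace L 0) (tC L) \<and>
     simple_roots L \<and> affine_root L \<and>
     mark L 0 = 1 \<and> (\<forall>j\<in>{1..rk L}. 0 < mark L j) \<and>
     (\<forall>h\<in>tC L. (\<Sum>j\<le>rk L. of_nat (mark L j) * sroot L j h) = 0) \<and>
     lie_aut (br L) (tau L) \<and> has_order (tau L) (coxeter_number L) \<and>
     (\<forall>h\<in>tC L. tau L h = h) \<and>
     (\<forall>j\<le>rk L. \<forall>\<xi>\<in>root_space L (sroot L j) (degr L j).
        tau L \<xi> = cis (2 * pi / real (coxeter_number L)) *s \<xi>) \<and>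
     (\<forall>j\<le>rk L. \<forall>\<xi>\<in>root_space L (\<lambda>h. - sroot L j h) ((nuord L - degr L j) mod nuord L).
        tau L \<xi> = cis (- 2 * pi / real (coxeter_number L)) *s \<xi>) \<and>
     real_involution L (kappa L) \<and> tau L ` compact_form L = compact_form L \<and>
     (\<forall>\<xi>\<in>compact_form L. \<xi> \<noteq> 0 \<longrightarrow> Re (killing L \<xi> \<xi>) < 0) \<and>
     lie_aut (br L) (sigma L) \<and> sigma L \<circ> sigma L = id \<and>
     sigma L \<circ> tau L = tau L \<circ> sigma L \<and> (\<forall>h\<in>tC L. sigma L h = h) \<and>
     sigma L \<circ> kappa L = kappa L \<circ> sigma L"

definition g1 :: "'n::finite toda_algebra \<Rightarrow> 'n cvec set" where
  "g1 L = {\<xi>. tau L \<xi> = cis (2 * pi / real (coxeter_number L)) *s \<xi>}"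

definition rho :: "'n::finite toda_algebra \<Rightarrow> 'n cvec \<Rightarrow> 'n cvec" where
  "rho L = sigma L \<circ> kappa L"

definition real_g :: "'n::finite toda_algebra \<Rightarrow> 'n cvec set" where
  "real_g L = {\<xi>. rho L \<xi> = \<xi>}"

definition real_h :: "'n::finite toda_algebra \<Rightarrow> 'n cvec set" where
  "real_h L = {\<xi> \<in> real_g L. sigma L \<xi> = \<xi>}"

definition real_m :: "'n::finite toda_algebra \<Rightarrow> 'n cvec set" where
  "real_m L = {\<xi> \<in> real_g L. sigma L \<xi> = - \<xi>}"

definition real_t :: "'n::finite toda_algebra \<Rightarrow> 'n cvec set" where
  "real_t L = tC L \<inter> compact_form L"

definition real_p :: "'n::finite toda_algebra \<Rightarrow> 'n cvec set" where
  "real_p L = {\<xi> \<in> real_g L. \<forall>\<eta>\<in>real_t L. killing L \<xi> \<eta> = 0}"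

definition complexify :: "'n::finite cvec set \<Rightarrow> 'n cvec set" where
  "complexify S = {x + \<i> *s y | x y. x \<in> S \<and> y \<in> S}"

definition hC :: "'n::finite toda_algebra \<Rightarrow> 'n cvec set" where "hC L = complexify (real_h L)"
definition mC :: "'n::finite toda_algebra \<Rightarrow> 'n cvec set" where "mC L = complexify (real_m L)"
definition pC :: "'n::finite toda_algebra \<Rightarrow> 'n cvec set" where "pC L = complexify (real_p L)"
definition kC :: "'n::finite toda_algebra \<Rightarrow> 'n cvec set" where "kC L = pC L \<inter> hC L"

text \<open>The \<open>U\<close>-component of a vector of \<open>U \<oplus> V\<close>.\<close>

definition component :: "'n::finite cvec set \<Rightarrow> 'n cvec set \<Rightarrow> 'n cvec \<Rightarrow> 'n cvec" where
  "component U V \<xi> = (THE \<eta>. \<eta> \<in> U \<and> \<xi> - \<eta> \<in> V)"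

section \<open>Groups\<close>

text \<open>
  The connected Lie group with trivial centre and Lie algebra \<open>g\<close> is its own adjoint group, so it is
  realised inside the complex linear automorphisms of the complexified Lie algebra: it is generated
  by \<open>exp (ad \<xi>)\<close>. In this realisation \<open>Ad g \<xi> = g *v \<xi>\<close>, and \<open>\<xi>\<close> corresponds to the
  tangent matrix \<open>ad \<xi>\<close>.

  The exponential is defined by its series because the ring structure of the class instances on
  \<open>complex^'n^'n\<close> is the componentwise one.
\<close>

definition ad :: "'n::finite toda_algebra \<Rightarrow> 'n cvec \<Rightarrow> 'n cmat" where
  "ad L \<xi> = matrix (br L \<xi>)"

definition mexp :: "'n::finite cmat \<Rightarrow> 'n cmat" where
  "mexp M = (\<Sum>k. (1 / fact k) *\<^sub>R (((**) M ^^ k) (mat 1)))"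

inductive_set generated_group :: "'n::finite cmat set \<Rightarrow> 'n cmat set" for S where
  one: "mat 1 \<in> generated_group S"
| mult: "a \<in> generated_group S \<Longrightarrow> b \<in> S \<Longrightarrow> a ** b \<in> generated_group S"
| quot: "a \<in> generated_group S \<Longrightarrow> b \<in> S \<Longrightarrow> a ** matrix_inv b \<in> generated_group S"

definition analytic_group :: "'n::finite toda_algebra \<Rightarrow> 'n cvec set \<Rightarrow> 'n cmat set" where
  "analytic_group L S = generated_group ((\<lambda>\<xi>. mexp (ad L \<xi>)) ` S)"

definition GG :: "'n::finite toda_algebra \<Rightarrow> 'n cmat set" where "GG L = analytic_group L (real_g L)"
definition TT :: "'n::finite toda_algebra \<Rightarrow> 'n cmat set" where "TT L = analytic_group L (real_t L)"
definition TC :: "'n::finite toda_algebra \<Rightarrow> 'n cmat set" where "TC L = analytic_group L (tC L)"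

definition matrix_group :: "'n::finite cmat set \<Rightarrow> bool" where
  "matrix_group K \<longleftrightarrow> mat 1 \<in> K \<and>
     (\<forall>a\<in>K. invertible a \<and> matrix_inv a \<in> K) \<and> (\<forall>a\<in>K. \<forall>b\<in>K. a ** b \<in> K)"

definition maximal_compact :: "'n::finite toda_algebra \<Rightarrow> 'n cmat set \<Rightarrow> bool" where
  "maximal_compact L H \<longleftrightarrow> matrix_group H \<and> H \<subseteq> GG L \<and> compact H \<and>
     (\<forall>K. matrix_group K \<and> K \<subseteq> GG L \<and> compact K \<and> H \<subseteq> K \<longrightarrow> K = H) \<and>
     {\<xi> \<in> real_g L. \<forall>t::real. mexp (ad L (t *\<^sub>R \<xi>)) \<in> H} = real_h L"

definition HC :: "'n::finite toda_algebra \<Rightarrow> 'n cmat set \<Rightarrow> 'n cmat set" where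
  "HC L H = generated_group (H \<union> analytic_group L (hC L))"

section \<open>Riemann surfaces and differential forms\<close>

type_synonym 's chart = "'s set \<times> ('s \<Rightarrow> complex)"
type_synonym 's atlas = "'s chart set"

definition riemann_surface :: "'s::t2_space atlas \<Rightarrow> bool" where
  "riemann_surface A \<longleftrightarrow> connected (UNIV :: 's set) \<and> (\<Union>c\<in>A. fst c) = UNIV \<and>
     (\<forall>(V, z)\<in>A. open V \<and> open (z ` V) \<and> homeomorphism V (z ` V) z (inv_into V z)) \<and>
     (\<forall>(V, z)\<in>A. \<forall>(V', z')\<in>A. (z' \<circ> inv_into V z) holomorphic_on z ` (V \<inter> V'))"

primrec Ck_on :: "nat \<Rightarrow> complex set \<Rightarrow> (complex \<Rightarrow> 'b::real_normed_vector) \<Rightarrow> bool" where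
  "Ck_on 0 S f \<longleftrightarrow> continuous_on S f"
| "Ck_on (Suc k) S f \<longleftrightarrow> (\<exists>fx fy.
     (\<forall>w\<in>S. (f has_derivative (\<lambda>h. Re h *\<^sub>R fx w + Im h *\<^sub>R fy w)) (at w)) \<and>
     Ck_on k S fx \<and> Ck_on k S fy)"

text \<open>Below, \<open>U\<close> is an open set of the surface and \<open>f\<close> matters on \<open>U\<close> only.\<close>

definition smooth_fun :: "'s atlas \<Rightarrow> 's set \<Rightarrow> ('s \<Rightarrow> 'b::real_normed_vector) \<Rightarrow> bool" where
  "smooth_fun A U f \<longleftrightarrow> (\<forall>(V, z)\<in>A. \<forall>k. Ck_on k (z ` (U \<inter> V)) (f \<circ> inv_into V z))"

definition holo_fun :: "'s atlas \<Rightarrow> 's set \<Rightarrow> ('s \<Rightarrow> complex) \<Rightarrow> bool" where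
  "holo_fun A U f \<longleftrightarrow> (\<forall>(V, z)\<in>A. (f \<circ> inv_into V z) holomorphic_on z ` (U \<inter> V))"

definition holo_mat :: "'s atlas \<Rightarrow> 's set \<Rightarrow> ('s \<Rightarrow> 'n::finite cmat) \<Rightarrow> bool" where
  "holo_mat A U f \<longleftrightarrow> (\<forall>i j. holo_fun A U (\<lambda>x. f x $ i $ j))"

text \<open>
  Tangent vectors at \<open>x\<close> are described by their component \<open>v :: complex\<close> in a chart \<open>c\<close> around
  \<open>x\<close>. A 1-form is a function of \<open>c\<close>, \<open>x\<close> and \<open>v\<close> (only meaningful for \<open>c \<in> A\<close>,
  \<open>x \<in> fst c\<close>) that is compatible with changes of chart; its values may lie in a
  vector space or in the fibres of a vector bundle.
\<close>

type_synonym ('s, 'v) form = "'s chart \<Rightarrow> 's \<Rightarrow> complex \<Rightarrow> 'v"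

definition chart_compatible :: "'s atlas \<Rightarrow> 's set \<Rightarrow> ('s, 'v) form \<Rightarrow> bool" where
  "chart_compatible A U \<alpha> \<longleftrightarrow> (\<forall>(V, z)\<in>A. \<forall>(V', z')\<in>A. \<forall>x\<in>U \<inter> V \<inter> V'. \<forall>v.
     \<alpha> (V', z') x (deriv (z' \<circ> inv_into V z) (z x) * v) = \<alpha> (V, z) x v)"

definition dchart :: "'s chart \<Rightarrow> ('s \<Rightarrow> 'b::real_normed_vector) \<Rightarrow> 's \<Rightarrow> complex \<Rightarrow> 'b" where
  "dchart c f x v = frechet_derivative (f \<circ> inv_into (fst c) (snd c)) (at (snd c x)) v"

text \<open>\<open>(d\<alpha>)(v, w)\<close> for the constant vector fields \<open>v, w\<close> of the chart.\<close>

definition ext_deriv :: "('s, 'b::real_normed_vector) form \<Rightarrow> 's chart \<Rightarrow> 's \<Rightarrow> complex \<Rightarrow> complex \<Rightarrow> 'b" where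
  "ext_deriv \<alpha> c x v w = dchart c (\<lambda>y. \<alpha> c y w) x v - dchart c (\<lambda>y. \<alpha> c y v) x w"

definition universal_cover :: "('c::t2_space \<Rightarrow> 's::t2_space) \<Rightarrow> bool" where
  "universal_cover p \<longleftrightarrow> covering_space UNIV p UNIV \<and> simply_connected (UNIV :: 'c set)"

text \<open>The fundamental group of the base acts on the universal cover as the deck group.\<close>

definition deck :: "('c::t2_space \<Rightarrow> 's) \<Rightarrow> ('c \<Rightarrow> 'c) set" where
  "deck p = {\<gamma>. homeomorphism UNIV UNIV \<gamma> (inv \<gamma>) \<and> p \<circ> \<gamma> = p}"

definition lift_atlas :: "'s atlas \<Rightarrow> ('c::t2_space \<Rightarrow> 's) \<Rightarrow> 'c atlas" where
  "lift_atlas A p = {(W, z \<circ> p) | W z. open W \<and> inj_on p W \<and> (\<exists>V. (V, z) \<in> A \<and> p ` W \<subseteq> V)}"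

section \<open>Principal bundles and associated bundles\<close>

text \<open>
  A principal bundle is given by its total space, projection, right action of its (linear)
  structure group, and a set of local sections \<open>(U, s)\<close> serving as a bundle atlas: the
  transition functions between them are smooth (or holomorphic).
\<close>

record ('q, 's, 'n::finite) pbundle =
  pspace :: "'q set"
  pproj :: "'q \<Rightarrow> 's"
  pact :: "'q \<Rightarrow> 'n cmat \<Rightarrow> 'q"
  pgroup :: "'n cmat set"
  psecs :: "('s set \<times> ('s \<Rightarrow> 'q)) set"

definition pdiff :: "('q, 's, 'n::finite) pbundle \<Rightarrow> 'q \<Rightarrow> 'q \<Rightarrow> 'n cmat" where
  "pdiff B q q' = (THE a. a \<in> pgroup B \<and> q' = pact B q a)"

definition local_section :: "('q, 's::topological_space, 'n::finite) pbundle \<Rightarrow> 's set \<Rightarrow> ('s \<Rightarrow> 'q) \<Rightarrow> bool" where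
  "local_section B U s \<longleftrightarrow> open U \<and> (\<forall>x\<in>U. s x \<in> pspace B \<and> pproj B (s x) = x)"

definition principal_bundle_with ::
  "('s set \<Rightarrow> ('s \<Rightarrow> 'n cmat) \<Rightarrow> bool) \<Rightarrow> ('q, 's::topological_space, 'n::finite) pbundle \<Rightarrow> bool" where
  "principal_bundle_with R B \<longleftrightarrow> matrix_group (pgroup B) \<and>
     (\<forall>q\<in>pspace B. pact B q (mat 1) = q) \<and>
     (\<forall>q\<in>pspace B. \<forall>a\<in>pgroup B. pact B q a \<in> pspace B \<and> pproj B (pact B q a) = pproj B q) \<and>
     (\<forall>q\<in>pspace B. \<forall>a\<in>pgroup B. \<forall>b\<in>pgroup B. pact B (pact B q a) b = pact B q (a ** b)) \<and>
     (\<forall>q\<in>pspace B. \<forall>q'\<in>pspace B. pproj B q = pproj B q' \<longrightarrow> (\<exists>!a. a \<in> pgroup B \<and> q' = pact B q a)) \<and>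
     (\<forall>(U, s)\<in>psecs B. local_section B U s) \<and>
     (\<Union>(U, s)\<in>psecs B. U) = UNIV \<and>
     (\<forall>(U, s)\<in>psecs B. \<forall>(U', s')\<in>psecs B. R (U \<inter> U') (\<lambda>x. pdiff B (s x) (s' x)))"

definition smooth_section ::
  "'s atlas \<Rightarrow> ('q, 's::topological_space, 'n::finite) pbundle \<Rightarrow> 's set \<Rightarrow> ('s \<Rightarrow> 'q) \<Rightarrow> bool" where
  "smooth_section A B U s \<longleftrightarrow> local_section B U s \<and>
     (\<forall>(U', s')\<in>psecs B. smooth_fun A (U \<inter> U') (\<lambda>x. pdiff B (s' x) (s x)))"

definition bundle_iso ::
  "'s atlas \<Rightarrow> ('q, 's::topological_space, 'n::finite) pbundle \<Rightarrow> ('r, 's, 'n) pbundle \<Rightarrow> ('q \<Rightarrow> 'r) \<Rightarrow> bool" where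
  "bundle_iso A B B' \<iota> \<longleftrightarrow> pgroup B = pgroup B' \<and> bij_betw \<iota> (pspace B) (pspace B') \<and>
     (\<forall>q\<in>pspace B. pproj B' (\<iota> q) = pproj B q \<and> (\<forall>a\<in>pgroup B. \<iota> (pact B q a) = pact B' (\<iota> q) a)) \<and>
     (\<forall>U s. local_section B U s \<longrightarrow> (smooth_section A B U s \<longleftrightarrow> smooth_section A B' U (\<iota> \<circ> s)))"

text \<open>
  The element \<open>[q, v]\<close> of an associated bundle is the set of all pairs \<open>(q a, a\<^sup>-\<^sup>1 v)\<close>; the
  structure group always acts on the Lie algebra by \<open>Ad\<close>.
\<close>

type_synonym ('q, 'n) belem = "('q \<times> 'n cvec) set"

definition belem :: "('q, 's, 'n::finite) pbundle \<Rightarrow> 'q \<Rightarrow> 'n cvec \<Rightarrow> ('q, 'n) belem" where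
  "belem B q v = {(pact B q a, matrix_inv a *v v) | a. a \<in> pgroup B}"

definition assoc :: "('q, 's, 'n::finite) pbundle \<Rightarrow> 'n cvec set \<Rightarrow> ('q, 'n) belem set" where
  "assoc B W = {belem B q v | q v. q \<in> pspace B \<and> v \<in> W}"

definition bproj :: "('q, 's, 'n::finite) pbundle \<Rightarrow> ('q, 'n) belem \<Rightarrow> 's" where
  "bproj B e = pproj B (fst (SOME y. y \<in> e))"

definition coord :: "'q \<Rightarrow> ('q, 'n::finite) belem \<Rightarrow> 'n cvec" where
  "coord q e = (THE v. (q, v) \<in> e)"

text \<open>Fibrewise operations; \<open>bmap\<close> is meant for maps commuting with the structure group.\<close>

definition badd :: "('q, 'n::finite) belem \<Rightarrow> ('q, 'n) belem \<Rightarrow> ('q, 'n) belem" where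
  "badd e e' = {(q, v + w) | q v w. (q, v) \<in> e \<and> (q, w) \<in> e'}"

definition bmap :: "('n::finite cvec \<Rightarrow> 'n cvec) \<Rightarrow> ('q, 'n) belem \<Rightarrow> ('q, 'n) belem" where
  "bmap f e = {(q, f v) | q v. (q, v) \<in> e}"

definition bscale :: "complex \<Rightarrow> ('q, 'n::finite) belem \<Rightarrow> ('q, 'n) belem" where
  "bscale c = bmap (\<lambda>v. c *s v)"

definition bbracket :: "'n::finite toda_algebra \<Rightarrow> ('q, 'n) belem \<Rightarrow> ('q, 'n) belem \<Rightarrow> ('q, 'n) belem" where
  "bbracket L e e' = {(q, br L v w) | q v w. (q, v) \<in> e \<and> (q, w) \<in> e'}"

definition part10 :: "('s, ('q, 'n::finite) belem) form \<Rightarrow> ('s, ('q, 'n) belem) form" where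
  "part10 \<alpha> c x v = bscale (1/2) (badd (\<alpha> c x v) (bscale (- \<i>) (\<alpha> c x (\<i> * v))))"

definition part01 :: "('s, ('q, 'n::finite) belem) form \<Rightarrow> ('s, ('q, 'n) belem) form" where
  "part01 \<alpha> c x v = bscale (1/2) (badd (\<alpha> c x v) (bscale \<i> (\<alpha> c x (\<i> * v))))"

definition smooth_vsection ::
  "'s atlas \<Rightarrow> ('q, 's::topological_space, 'n::finite) pbundle \<Rightarrow> 'n cvec set \<Rightarrow> 's set \<Rightarrow>
   ('s \<Rightarrow> ('q, 'n) belem) \<Rightarrow> bool" where
  "smooth_vsection A B W U \<xi> \<longleftrightarrow> open U \<and> (\<forall>x\<in>U. \<xi> x \<in> assoc B W \<and> bproj B (\<xi> x) = x) \<and>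
     (\<forall>(U', s)\<in>psecs B. smooth_fun A (U \<inter> U') (\<lambda>x. coord (s x) (\<xi> x)))"

definition vbundle_iso ::
  "'s atlas \<Rightarrow> 'n cvec set \<Rightarrow> ('q, 's::topological_space, 'n::finite) pbundle \<Rightarrow> ('r, 's, 'n) pbundle \<Rightarrow>
   (('q, 'n) belem \<Rightarrow> ('r, 'n) belem) \<Rightarrow> bool" where
  "vbundle_iso A W B B' \<theta> \<longleftrightarrow> bij_betw \<theta> (assoc B W) (assoc B' W) \<and>
     (\<forall>e\<in>assoc B W. bproj B' (\<theta> e) = bproj B e \<and> (\<forall>c. \<theta> (bscale c e) = bscale c (\<theta> e))) \<and>
     (\<forall>e\<in>assoc B W. \<forall>e'\<in>assoc B W. bproj B e = bproj B e' \<longrightarrow> \<theta> (badd e e') = badd (\<theta> e) (\<theta> e')) \<and>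
     (\<forall>U \<xi>. open U \<and> (\<forall>x\<in>U. \<xi> x \<in> assoc B W \<and> bproj B (\<xi> x) = x) \<longrightarrow>
        (smooth_vsection A B W U \<xi> \<longleftrightarrow> smooth_vsection A B' W U (\<theta> \<circ> \<xi>)))"

section \<open>Connections\<close>

text \<open>\<open>F\<^sup>-\<^sup>1 dF\<close> for a function \<open>F\<close> into one of the groups, as a form with values in the Lie algebra.\<close>

definition mcform :: "'n::finite toda_algebra \<Rightarrow> ('s \<Rightarrow> 'n cmat) \<Rightarrow> ('s, 'n cvec) form" where
  "mcform L F c x v = (THE \<xi>. ad L \<xi> = matrix_inv (F x) ** dchart c F x v)"

text \<open>
  A connection is given by its local connection forms: \<open>N s\<close> is the pull-back along the smooth
  local section \<open>s\<close> of the connection form on the total space. \<open>W\<close> is the Lie algebra of the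
  structure group.
\<close>

type_synonym ('q, 's, 'n) connection = "('s \<Rightarrow> 'q) \<Rightarrow> ('s, 'n cvec) form"

definition is_connection ::
  "'n::finite toda_algebra \<Rightarrow> 's atlas \<Rightarrow> 'n cvec set \<Rightarrow> ('q, 's::topological_space, 'n) pbundle \<Rightarrow>
   ('q, 's, 'n) connection \<Rightarrow> bool" where
  "is_connection L A W B N \<longleftrightarrow>
     (\<forall>U s. smooth_section A B U s \<longrightarrow> chart_compatible A U (N s) \<and>
        (\<forall>c\<in>A. \<forall>v. smooth_fun A (U \<inter> fst c) (\<lambda>x. N s c x v)) \<and>
        (\<forall>c\<in>A. \<forall>x\<in>U \<inter> fst c. linear (N s c x) \<and> range (N s c x) \<subseteq> W)) \<and>
     (\<forall>U s U' s'. smooth_section A B U s \<and> smooth_section A B U' s' \<longrightarrow>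
        (let a = (\<lambda>x. pdiff B (s x) (s' x)) in
         \<forall>c\<in>A. \<forall>x\<in>U \<inter> U' \<inter> fst c. \<forall>v.
           N s' c x v = matrix_inv (a x) *v N s c x v + mcform L a c x v))"

text \<open>The induced covariant derivative on the bundles associated by \<open>Ad\<close>.\<close>

definition covd ::
  "'n::finite toda_algebra \<Rightarrow> 's atlas \<Rightarrow> ('q, 's::topological_space, 'n) pbundle \<Rightarrow>
   ('q, 's, 'n) connection \<Rightarrow> ('s \<Rightarrow> ('q, 'n) belem) \<Rightarrow> ('s, ('q, 'n) belem) form" where
  "covd L A B N \<xi> c x v = (THE e. \<exists>U s. smooth_section A B U s \<and> x \<in> U \<and>
     e = belem B (s x) (dchart c (\<lambda>y. coord (s y) (\<xi> y)) x v + br L (N s c x v) (coord (s x) (\<xi> x))))"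

definition extend_elem :: "('q, 's, 'n::finite) pbundle \<Rightarrow> 'q \<Rightarrow> 'n cmat \<Rightarrow> ('q \<times> 'n cmat) set" where
  "extend_elem B q k = {(pact B q a, matrix_inv a ** k) | a. a \<in> pgroup B}"

text \<open>Extension of the structure group to \<open>K\<close>, with the elements \<open>[q, k]\<close> of \<open>extend_elem\<close>.\<close>

definition extend_bundle ::
  "('q, 's, 'n::finite) pbundle \<Rightarrow> 'n cmat set \<Rightarrow> (('q \<times> 'n cmat) set, 's, 'n) pbundle" where
  "extend_bundle B K =
    \<lparr> pspace = {extend_elem B q k | q k. q \<in> pspace B \<and> k \<in> K},
      pproj = (\<lambda>e. pproj B (fst (SOME y. y \<in> e))),
      pact = (\<lambda>e b. (\<lambda>(q, k). (q, k ** b)) ` e),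
      pgroup = K,
      psecs = {(U, \<lambda>x. extend_elem B (s x) (mat 1)) | U s. (U, s) \<in> psecs B} \<rparr>"

definition extend_connection ::
  "'n::finite toda_algebra \<Rightarrow> ('q, 's, 'n) pbundle \<Rightarrow> 'n cmat set \<Rightarrow> ('q, 's, 'n) connection \<Rightarrow>
   (('q \<times> 'n cmat) set, 's, 'n) connection" where
  "extend_connection L B K N s c x v = (THE \<xi>. \<exists>U s0. (U, s0) \<in> psecs B \<and> x \<in> U \<and>
     (let a = (\<lambda>y. pdiff (extend_bundle B K) (extend_elem B (s0 y) (mat 1)) (s y)) in
      \<xi> = matrix_inv (a x) *v N s0 c x v + mcform L a c x v))"

text \<open>The inclusion \<open>[q, v] \<mapsto> [[q, 1], v]\<close> of associated bundles.\<close>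

definition extend_belem ::
  "('q, 's, 'n::finite) pbundle \<Rightarrow> 'n cmat set \<Rightarrow> ('q, 'n) belem \<Rightarrow> (('q \<times> 'n cmat) set, 'n) belem" where
  "extend_belem B K e =
     (THE e'. \<exists>q v. (q, v) \<in> e \<and> e' = belem (extend_bundle B K) (extend_elem B q (mat 1)) v)"

section \<open>Toda pairs and the Toda equations\<close>

text \<open>The local sections in \<open>psecs QC\<close> are an atlas of holomorphic trivialisations.\<close>

definition toda_pair ::
  "'n::finite toda_algebra \<Rightarrow> 's::t2_space atlas \<Rightarrow> ('q, 's, 'n) pbundle \<Rightarrow> ('s, ('q, 'n) belem) form \<Rightarrow> bool" where
  "toda_pair L A QC \<phi> \<longleftrightarrow> principal_bundle_with (holo_mat A) QC \<and> pgroup QC = TC L \<and>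
     chart_compatible A UNIV \<phi> \<and>
     (\<forall>c\<in>A. \<forall>x\<in>fst c. \<forall>v. \<phi> c x v \<in> assoc QC (g1 L) \<and> bproj QC (\<phi> c x v) = x \<and>
        \<phi> c x v = bscale v (\<phi> c x 1)) \<and>
     (\<forall>c\<in>A. \<forall>(U, s)\<in>psecs QC. \<forall>i. holo_fun A (U \<inter> fst c) (\<lambda>x. coord (s x) (\<phi> c x 1) $ i))"

definition phi_k :: "'n::finite toda_algebra \<Rightarrow> ('s, ('q, 'n) belem) form \<Rightarrow> ('s, ('q, 'n) belem) form" where
  "phi_k L \<phi> c x v = bmap (component (kC L) (mC L)) (\<phi> c x v)"

definition phi_m :: "'n::finite toda_algebra \<Rightarrow> ('s, ('q, 'n) belem) form \<Rightarrow> ('s, ('q, 'n) belem) form" where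
  "phi_m L \<phi> c x v = bmap (component (mC L) (kC L)) (\<phi> c x v)"

text \<open>The restriction of \<open>QC\<close> to a subset \<open>Q\<close> with structure group \<open>K\<close>.\<close>

definition sub_bundle ::
  "'s atlas \<Rightarrow> ('q, 's::topological_space, 'n::finite) pbundle \<Rightarrow> 'n cmat set \<Rightarrow> 'q set \<Rightarrow> ('q, 's, 'n) pbundle" where
  "sub_bundle A QC K Q = QC \<lparr> pspace := Q, pgroup := K,
     psecs := {(U, s). smooth_section A QC U s \<and> s ` U \<subseteq> Q} \<rparr>"

definition reduction ::
  "'n::finite toda_algebra \<Rightarrow> 's atlas \<Rightarrow> ('q, 's::topological_space, 'n) pbundle \<Rightarrow> 'q set \<Rightarrow> bool" where
  "reduction L A QC Q \<longleftrightarrow> Q \<subseteq> pspace QC \<and> principal_bundle_with (smooth_fun A) (sub_bundle A QC (TT L) Q)"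

text \<open>The real involution \<open>[q, v] \<mapsto> [q, \<rho> v]\<close> for \<open>q \<in> Q\<close>.\<close>

definition brho ::
  "'n::finite toda_algebra \<Rightarrow> ('q, 's, 'n) pbundle \<Rightarrow> 'q set \<Rightarrow> ('q, 'n) belem \<Rightarrow> ('q, 'n) belem" where
  "brho L QC Q e = {(pact QC q a, matrix_inv a *v rho L v) | q v a. (q, v) \<in> e \<and> q \<in> Q \<and> a \<in> pgroup QC}"

definition chern_connection ::
  "'n::finite toda_algebra \<Rightarrow> 's atlas \<Rightarrow> ('q, 's::topological_space, 'n) pbundle \<Rightarrow> 'q set \<Rightarrow>
   ('q, 's, 'n) connection \<Rightarrow> bool" where
  "chern_connection L A QC Q N \<longleftrightarrow> is_connection L A (tC L) QC N \<and>
     (\<forall>(U, s)\<in>psecs QC. \<forall>c\<in>A. \<forall>x\<in>U \<inter> fst c. \<forall>v. N s c x (\<i> * v) = \<i> *s N s c x v) \<and>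
     (\<forall>(U, s)\<in>psecs (sub_bundle A QC (TT L) Q). \<forall>c\<in>A. \<forall>x\<in>U \<inter> fst c. range (N s c x) \<subseteq> real_t L)"

text \<open>
  \<open>F + [\<phi> \<and> \<rho>\<phi>] = 0\<close> in local sections of \<open>Q\<close>, where
  \<open>[\<alpha> \<and> \<beta>](v, w) = [\<alpha>(v), \<beta>(w)] - [\<alpha>(w), \<beta>(v)]\<close>; the curvature form is \<open>dN\<close> since the
  structure group is abelian.
\<close>

definition toda_equations ::
  "'n::finite toda_algebra \<Rightarrow> 's atlas \<Rightarrow> ('q, 's::topological_space, 'n) pbundle \<Rightarrow> ('s, ('q, 'n) belem) form \<Rightarrow>
   'q set \<Rightarrow> ('q, 's, 'n) connection \<Rightarrow> bool" where
  "toda_equations L A QC \<phi> Q N \<longleftrightarrow>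
     (\<forall>(U, s)\<in>psecs (sub_bundle A QC (TT L) Q). \<forall>c\<in>A. \<forall>x\<in>U \<inter> fst c. \<forall>v w.
        ext_deriv (N s) c x v w
        + (br L (coord (s x) (\<phi> c x v)) (coord (s x) (brho L QC Q (\<phi> c x w)))
           - br L (coord (s x) (\<phi> c x w)) (coord (s x) (brho L QC Q (\<phi> c x v)))) = 0)"

section \<open>Equivariant maps, the bundles they induce, and their Maurer-Cartan forms\<close>

text \<open>Points of \<open>G/K\<close> are left cosets, as sets of matrices.\<close>

definition lcoset :: "'n::finite cmat \<Rightarrow> 'n cmat set \<Rightarrow> 'n cmat set" where
  "lcoset g K = (\<lambda>k. g ** k) ` K"

definition coset_proj :: "'n::finite cmat set \<Rightarrow> 'n cmat set \<Rightarrow> 'n cmat set" where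
  "coset_proj K C = {g ** k | g k. g \<in> C \<and> k \<in> K}"

text \<open>Smooth maps into \<open>G/K\<close> are those with smooth local lifts to \<open>G\<close>.\<close>

definition smooth_coset_map ::
  "'c::topological_space atlas \<Rightarrow> 'n::finite cmat set \<Rightarrow> 'n cmat set \<Rightarrow> ('c \<Rightarrow> 'n cmat set) \<Rightarrow> bool" where
  "smooth_coset_map A G K \<psi> \<longleftrightarrow> (\<forall>x. \<exists>W F. open W \<and> x \<in> W \<and> smooth_fun A W F \<and>
     (\<forall>y\<in>W. F y \<in> G \<and> \<psi> y = lcoset (F y) K))"

definition representation :: "('c::t2_space \<Rightarrow> 's) \<Rightarrow> 'n::finite cmat set \<Rightarrow> (('c \<Rightarrow> 'c) \<Rightarrow> 'n cmat) \<Rightarrow> bool" where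
  "representation p G \<mu> \<longleftrightarrow> (\<forall>\<gamma>\<in>deck p. \<mu> \<gamma> \<in> G) \<and> (\<forall>\<gamma>\<in>deck p. \<forall>\<delta>\<in>deck p. \<mu> (\<gamma> \<circ> \<delta>) = \<mu> \<gamma> ** \<mu> \<delta>)"

definition equivariant ::
  "('c::t2_space \<Rightarrow> 's) \<Rightarrow> (('c \<Rightarrow> 'c) \<Rightarrow> 'n::finite cmat) \<Rightarrow> ('c \<Rightarrow> 'n cmat set) \<Rightarrow> bool" where
  "equivariant p \<mu> \<psi> \<longleftrightarrow> (\<forall>\<gamma>\<in>deck p. \<forall>x. \<psi> (\<gamma> x) = (\<lambda>g. \<mu> \<gamma> ** g) ` \<psi> x)"

text \<open>
  \<open>pull_bundle\<close> is \<open>\<psi>\<^sup>-\<^sup>1 G / \<pi>\<^sub>1\<close>: its points are orbits of pairs \<open>(x, g)\<close> with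
  \<open>g \<in> \<psi> x\<close>. A local section \<open>s\<close> is the same thing as the equivariant lift
  \<open>lift_frame p s\<close> of \<open>\<psi>\<close> to \<open>G\<close>.
\<close>

definition deck_orbit ::
  "('c::t2_space \<Rightarrow> 's) \<Rightarrow> (('c \<Rightarrow> 'c) \<Rightarrow> 'n::finite cmat) \<Rightarrow> 'c \<Rightarrow> 'n cmat \<Rightarrow> ('c \<times> 'n cmat) set" where
  "deck_orbit p \<mu> x g = {(\<gamma> x, \<mu> \<gamma> ** g) | \<gamma>. \<gamma> \<in> deck p}"

definition lift_frame :: "('c \<Rightarrow> 's) \<Rightarrow> ('s \<Rightarrow> ('c \<times> 'n::finite cmat) set) \<Rightarrow> 'c \<Rightarrow> 'n cmat" where
  "lift_frame p s x = (THE g. (x, g) \<in> s (p x))"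

definition pull_bundle ::
  "'s atlas \<Rightarrow> ('c::t2_space \<Rightarrow> 's::t2_space) \<Rightarrow> (('c \<Rightarrow> 'c) \<Rightarrow> 'n::finite cmat) \<Rightarrow> 'n cmat set \<Rightarrow>
   ('c \<Rightarrow> 'n cmat set) \<Rightarrow> (('c \<times> 'n cmat) set, 's, 'n) pbundle" where
  "pull_bundle A p \<mu> K \<psi> =
    (let S = {deck_orbit p \<mu> x g | x g. g \<in> \<psi> x}; pr = (\<lambda>e. p (fst (SOME y. y \<in> e))) in
     \<lparr> pspace = S, pproj = pr,
       pact = (\<lambda>e b. (\<lambda>(x, g). (x, g ** b)) ` e),
       pgroup = K,
       psecs = {(U, s). open U \<and> (\<forall>x\<in>U. s x \<in> S \<and> pr (s x) = x) \<and>
                        smooth_fun (lift_atlas A p) (p -` U) (lift_frame p s)} \<rparr>)"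

text \<open>
  For a form on the cover that is invariant under the deck group, its descent to the base: the value
  is computed at any point \<open>x\<close> over \<open>u\<close> and in any sheet \<open>W\<close> around \<open>x\<close>.
\<close>

definition descend :: "('c::t2_space \<Rightarrow> 's) \<Rightarrow> ('c, 'v) form \<Rightarrow> ('s, 'v) form" where
  "descend p \<alpha> c u v = (THE \<xi>. \<exists>W x. open W \<and> inj_on p W \<and> p ` W \<subseteq> fst c \<and> x \<in> W \<and> p x = u \<and>
     \<xi> = \<alpha> (W, snd c \<circ> p) x v)"

text \<open>The \<open>pr\<close>-component of the left Maurer-Cartan form of \<open>G\<close>, pulled back along local sections.\<close>

definition mc_component ::
  "'n::finite toda_algebra \<Rightarrow> ('c::t2_space \<Rightarrow> 's) \<Rightarrow> ('n cvec \<Rightarrow> 'n cvec) \<Rightarrow>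
   (('c \<times> 'n cmat) set, 's, 'n) connection" where
  "mc_component L p pr s = descend p (\<lambda>c x v. pr (mcform L (lift_frame p s) c x v))"

text \<open>
  The pull-back of the Maurer-Cartan form \<open>T(G/K) \<rightarrow> G \<times>\<^sub>K W\<close>,
  \<open>d(F K)(v) \<mapsto> [F, pr (F\<^sup>-\<^sup>1 dF(v))]\<close>, where \<open>pr\<close> projects the Lie algebra onto \<open>W\<close>
  and \<open>B\<close> is the pull-back bundle of the map.
\<close>

definition mc_pullback ::
  "'n::finite toda_algebra \<Rightarrow> ('c::t2_space \<Rightarrow> 's) \<Rightarrow> (('c \<times> 'n cmat) set, 's, 'n) pbundle \<Rightarrow>
   ('n cvec \<Rightarrow> 'n cvec) \<Rightarrow> ('s, (('c \<times> 'n cmat) set, 'n) belem) form" where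
  "mc_pullback L p B pr c u v = (THE e. \<exists>U s. (U, s) \<in> psecs B \<and> u \<in> U \<and>
     e = belem B (s u) (mc_component L p pr s c u v))"

text \<open>
  \<open>\<mu>\<close> is the holonomy of the flat \<open>G\<close>-connection \<open>\<nabla> + \<phi> + \<rho>\<phi>\<close> on the extension of \<open>Q\<close> to
  \<open>G\<close>: pulled back to the cover this bundle has a parallel trivialisation, given by
  \<open>F x q \<in> G\<close> for \<open>q\<close> in the fibre of \<open>Q\<close> over \<open>p x\<close>, on which the deck group acts by \<open>\<mu>\<close>.
\<close>

definition is_holonomy ::
  "'n::finite toda_algebra \<Rightarrow> 's::t2_space atlas \<Rightarrow> ('c::t2_space \<Rightarrow> 's) \<Rightarrow> ('q, 's, 'n) pbundle \<Rightarrow>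
   ('s, ('q, 'n) belem) form \<Rightarrow> 'q set \<Rightarrow> ('q, 's, 'n) connection \<Rightarrow> (('c \<Rightarrow> 'c) \<Rightarrow> 'n cmat) \<Rightarrow> bool" where
  "is_holonomy L A p QC \<phi> Q N \<mu> \<longleftrightarrow> representation p (GG L) \<mu> \<and>
     (\<exists>F. (\<forall>x. \<forall>q\<in>Q. pproj QC q = p x \<longrightarrow> F x q \<in> GG L \<and>
             (\<forall>a\<in>TT L. F x (pact QC q a) = F x q ** a) \<and> (\<forall>\<gamma>\<in>deck p. F (\<gamma> x) q = \<mu> \<gamma> ** F x q)) \<and>
          (\<forall>(U, s)\<in>psecs (sub_bundle A QC (TT L) Q).
             smooth_fun (lift_atlas A p) (p -` U) (\<lambda>x. F x (s (p x))) \<and>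
             (\<forall>c\<in>A. \<forall>u\<in>U \<inter> fst c. \<forall>v.
                descend p (mcform L (\<lambda>x. F x (s (p x)))) c u v
                = N s c u v + coord (s u) (badd (\<phi> c u v) (brho L QC Q (\<phi> c u v))))))"

text \<open>
  \<open>\<psi>\<close> is a primitive harmonic map provided by the Toda pair, through the reduction \<open>Q\<close> with Chern
  connection \<open>N\<close>: \<open>Q\<close> is identified with \<open>\<psi>\<^sup>-\<^sup>1 G / \<pi>\<^sub>1\<close> by \<open>\<iota>\<close>, which takes \<open>N\<close> to the canonical
  connection (the \<open>t\<close>-component of the Maurer-Cartan form) and \<open>\<phi> + \<rho>\<phi>\<close> to the pull-back of the
  Maurer-Cartan form of \<open>G/T\<close>.
\<close>

definition provides_primitive_map ::
  "'n::finite toda_algebra \<Rightarrow> 's::t2_space atlas \<Rightarrow> ('c::t2_space \<Rightarrow> 's) \<Rightarrow> ('q, 's, 'n) pbundle \<Rightarrow>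
   ('s, ('q, 'n) belem) form \<Rightarrow> 'q set \<Rightarrow> ('q, 's, 'n) connection \<Rightarrow> (('c \<Rightarrow> 'c) \<Rightarrow> 'n cmat) \<Rightarrow>
   ('c \<Rightarrow> 'n cmat set) \<Rightarrow> bool" where
  "provides_primitive_map L A p QC \<phi> Q N \<mu> \<psi> \<longleftrightarrow>
     reduction L A QC Q \<and> chern_connection L A QC Q N \<and> toda_equations L A QC \<phi> Q N \<and>
     is_holonomy L A p QC \<phi> Q N \<mu> \<and>
     smooth_coset_map (lift_atlas A p) (GG L) (TT L) \<psi> \<and> equivariant p \<mu> \<psi> \<and>
     (\<exists>\<iota>. bundle_iso A (sub_bundle A QC (TT L) Q) (pull_bundle A p \<mu> (TT L) \<psi>) \<iota> \<and>
        (\<forall>(U, s)\<in>psecs (sub_bundle A QC (TT L) Q). \<forall>c\<in>A. \<forall>u\<in>U \<inter> fst c. \<forall>v.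
           N s c u v = mc_component L p (component (real_t L) (real_p L)) (\<iota> \<circ> s) c u v) \<and>
        (\<forall>c\<in>A. \<forall>u\<in>fst c. \<forall>v.
           mc_pullback L p (pull_bundle A p \<mu> (TT L) \<psi>) (component (real_p L) (real_t L)) c u v
           = {(\<iota> q, w) | q w. q \<in> Q \<and> (q, w) \<in> badd (\<phi> c u v) (brho L QC Q (\<phi> c u v))}))"

section \<open>The Higgs bundle of an equivariant map into \<open>G/H\<close>\<close>

definition PP ::
  "'s::t2_space atlas \<Rightarrow> ('c::t2_space \<Rightarrow> 's) \<Rightarrow> (('c \<Rightarrow> 'c) \<Rightarrow> 'n::finite cmat) \<Rightarrow> 'n cmat set \<Rightarrow>
   ('c \<Rightarrow> 'n cmat set) \<Rightarrow> (('c \<times> 'n cmat) set, 's, 'n) pbundle" where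
  "PP A p \<mu> H f = pull_bundle A p \<mu> H f"

definition PC ::
  "'n::finite toda_algebra \<Rightarrow> 's::t2_space atlas \<Rightarrow> ('c::t2_space \<Rightarrow> 's) \<Rightarrow> (('c \<Rightarrow> 'c) \<Rightarrow> 'n cmat) \<Rightarrow> 'n cmat set \<Rightarrow>
   ('c \<Rightarrow> 'n cmat set) \<Rightarrow> ((('c \<times> 'n cmat) set \<times> 'n cmat) set, 's, 'n) pbundle" where
  "PC L A p \<mu> H f = extend_bundle (PP A p \<mu> H f) (HC L H)"

definition DD ::
  "'n::finite toda_algebra \<Rightarrow> 's::t2_space atlas \<Rightarrow> ('c::t2_space \<Rightarrow> 's) \<Rightarrow> (('c \<Rightarrow> 'c) \<Rightarrow> 'n cmat) \<Rightarrow> 'n cmat set \<Rightarrow>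
   ('c \<Rightarrow> 'n cmat set) \<Rightarrow> ((('c \<times> 'n cmat) set \<times> 'n cmat) set, 's, 'n) connection" where
  "DD L A p \<mu> H f = extend_connection L (PP A p \<mu> H f) (HC L H) (mc_component L p (component (real_h L) (real_m L)))"

text \<open>The underlying smooth bundle of \<open>E\<close> is \<open>assoc (PC L A p \<mu> H f) (mC L)\<close>; its holomorphic
  structure is given by the operator \<open>D''\<close> on smooth local sections.\<close>

definition higgs_dbar ::
  "'n::finite toda_algebra \<Rightarrow> 's::t2_space atlas \<Rightarrow> ('c::t2_space \<Rightarrow> 's) \<Rightarrow> (('c \<Rightarrow> 'c) \<Rightarrow> 'n cmat) \<Rightarrow> 'n cmat set \<Rightarrow>
   ('c \<Rightarrow> 'n cmat set) \<Rightarrow> ('s \<Rightarrow> ((('c \<times> 'n cmat) set \<times> 'n cmat) set, 'n) belem) \<Rightarrow>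
   ('s, ((('c \<times> 'n cmat) set \<times> 'n cmat) set, 'n) belem) form" where
  "higgs_dbar L A p \<mu> H f \<xi> = part01 (covd L A (PC L A p \<mu> H f) (DD L A p \<mu> H f) \<xi>)"

definition higgs_field ::
  "'n::finite toda_algebra \<Rightarrow> 's::t2_space atlas \<Rightarrow> ('c::t2_space \<Rightarrow> 's) \<Rightarrow> (('c \<Rightarrow> 'c) \<Rightarrow> 'n cmat) \<Rightarrow> 'n cmat set \<Rightarrow>
   ('c \<Rightarrow> 'n cmat set) \<Rightarrow> ('s, ((('c \<times> 'n cmat) set \<times> 'n cmat) set, 'n) belem) form" where
  "higgs_field L A p \<mu> H f =
     part10 (\<lambda>c u v. extend_belem (PP A p \<mu> H f) (HC L H)
        (mc_pullback L p (PP A p \<mu> H f) (component (real_m L) (real_h L)) c u v))"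

end

theory Submission
  imports Defs
begin

text \<open>
  In a local section of \<open>Q\<close>, regarded through \<open>\<iota>\<close> as an equivariant lift of \<open>\<psi>\<close> to \<open>G\<close>, the
  Maurer-Cartan form is \<open>\<nabla> + \<phi> + \<rho>\<phi>\<close>. The same lift is a local section of \<open>P\<close>, because
  \<open>T \<subseteq> H\<close>, and \<open>\<theta>\<close> identifies the two trivialisations it induces. As \<open>\<nabla>\<close> is \<open>\<tt>\<close>-valued
  and \<open>\<sigma>\<close> separates \<open>\<hh>\<close> from \<open>\<mm>\<close>, the connection \<open>D\<close> is \<open>\<nabla> + \<phi>\<^sub>k + \<rho>\<phi>\<^sub>k\<close> and the
  pull-back of \<open>\<beta>\<^sub>2\<close> is \<open>\<phi>\<^sub>m + \<rho>\<phi>\<^sub>m\<close>. Since \<open>\<phi>\<close> is complex linear and \<open>\<rho>\<phi>\<close> antilinear in the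
  tangent vector, the \<open>(0,1)\<close>- and \<open>(1,0)\<close>-parts are as claimed.

  Everything else is gauge covariance. It rests on two facts about the Killing form, which is
  nondegenerate because of the compact real form: derivations are inner, so \<open>F\<^sup>-\<^sup>1 dF\<close> is of the form
  \<open>ad \<xi>\<close> for every automorphism-valued \<open>F\<close>, and \<open>H\<close> commutes with \<open>\<sigma>\<close>, since \<open>\<mm>\<close> is the Killing
  complement of the \<open>H\<close>-invariant \<open>\<hh>\<close>.
\<close>

text \<open>Many objects are definite descriptions over choices: a local section, a sheet of the
  cover, a Lie algebra element with given \<open>ad\<close>. A computation in one frame counts only
  once all other choices are known to give the same value; this is why covariance is proved for all
  smooth sections of the extended bundle, although the comparison itself takes place in frames
  coming from \<open>Q\<close>. In those frames \<rho> acts coordinatewise, whereas the holomorphic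
  atlas sections of \<open>QC\<close> need not lie in \<open>Q\<close>. The splitting of \<phi> is
  computable for another reason: \<open>g1\<close> is the eigenspace of \<tau> for e^(2 pi i/m),
  which differs from 1 because m is at least 2, and \<tau> fixes the Cartan subalgebra. Invariance
  of the Killing form makes \<open>g1\<close> orthogonal to the torus, so the components along
  \<open>kC\<close> and \<open>mC\<close> are (1 + \<sigma>)/2 and (1 - \<sigma>)/2. Logarithmic
  derivatives are placed in the right subalgebra without any theorem on closed subgroups: a frame
  commuting with an involution has a derivative fixed by it, and for the torus the Cartan subalgebra
  is self-normalising.\<close>

section \<open>Matrix products and inverses over the complex numbers\<close>

lemma bounded_bilinear_matrix_mult:
  "bounded_bilinear ((**) :: complex^'n::finite^'n \<Rightarrow> complex^'n^'n \<Rightarrow> complex^'n^'n)"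
  unfolding bilinear_conv_bounded_bilinear [symmetric] bilinear_def
  by (auto intro!: linearI simp: matrix_matrix_mult_def vec_eq_iff scaleR_sum_right
      sum.distrib algebra_simps)

lemma bounded_bilinear_matrix_vector_mult:
  "bounded_bilinear ((*v) :: complex^'n::finite^'n \<Rightarrow> complex^'n \<Rightarrow> complex^'n)"
  unfolding bilinear_conv_bounded_bilinear [symmetric] bilinear_def
  by (auto intro!: linearI simp: matrix_vector_mult_def vec_eq_iff scaleR_sum_right
      sum.distrib algebra_simps)

text \<open>Since the instance product on \<open>complex^'n^'n\<close> is componentwise, the matrix
  product enters analysis as a bounded bilinear map; its series and product rules are taken from
  this interpretation and the next.\<close>

interpretation mm: bounded_bilinear "(**) :: complex^'n::finite^'n \<Rightarrow> complex^'n^'n \<Rightarrow> complex^'n^'n"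
  by (rule bounded_bilinear_matrix_mult)

interpretation mv: bounded_bilinear "(*v) :: complex^'n::finite^'n \<Rightarrow> complex^'n \<Rightarrow> complex^'n"
  by (rule bounded_bilinear_matrix_vector_mult)

lemma scaleR_eq_smult: "r *\<^sub>R (v :: complex^'n::finite) = complex_of_real r *s v"
  by (simp add: vec_eq_iff) (simp add: scaleR_conv_of_real)

lemma matrix_eqI_mv: "(\<And>x. (A :: complex^'n::finite^'n) *v x = B *v x) \<Longrightarrow> A = B"
  by (simp add: matrix_eq)

lemma matrix_inv_mult:
  assumes "invertible (A :: complex^'n::finite^'n)"
  shows "A ** matrix_inv A = mat 1" "matrix_inv A ** A = mat 1"
  using assms unfolding invertible_def matrix_inv_def by (metis (mono_tags, lifting) someI_ex)+

lemma matrix_inv_unique: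
  assumes "(A :: complex^'n::finite^'n) ** B = mat 1"
  shows "matrix_inv A = B" "invertible A"
proof -
  have "B ** A = mat 1" using assms by (simp add: matrix_left_right_inverse)
  then show i: "invertible A" using assms invertible_def by blast
  have "matrix_inv A = matrix_inv A ** (A ** B)" by (simp add: assms)
  also have "\<dots> = B" by (simp add: matrix_mul_assoc matrix_inv_mult[OF i])
  finally show "matrix_inv A = B" .
qed

lemma matrix_inv_cancel_mv [simp]:
  assumes "invertible (A :: complex^'n::finite^'n)"
  shows "A *v (matrix_inv A *v x) = x" "matrix_inv A *v (A *v x) = x"
  by (simp_all add: matrix_vector_mul_assoc matrix_inv_mult[OF assms])

lemma matrix_inv_matrix_mult:
  assumes "invertible (A :: complex^'n::finite^'n)" "invertible (B :: complex^'n^'n)"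
  shows "matrix_inv (A ** B) = matrix_inv B ** matrix_inv A" "invertible (A ** B)"
proof -
  have "(A ** B) ** (matrix_inv B ** matrix_inv A) = A ** (B ** matrix_inv B) ** matrix_inv A"
    by (simp only: matrix_mul_assoc)
  also have "\<dots> = mat 1" by (simp add: matrix_inv_mult(1)[OF assms(1)] matrix_inv_mult(1)[OF assms(2)])
  finally have e: "(A ** B) ** (matrix_inv B ** matrix_inv A) = mat 1" .
  show "matrix_inv (A ** B) = matrix_inv B ** matrix_inv A" "invertible (A ** B)"
    using matrix_inv_unique[OF e] by auto
qed

lemma matrix_inv_mat_1 [simp]: "matrix_inv (mat 1 :: complex^'n::finite^'n) = mat 1"
  by (rule matrix_inv_unique) simp

lemma matrix_inv_inv [simp]:
  assumes "invertible (A :: complex^'n::finite^'n)"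
  shows "matrix_inv (matrix_inv A) = A" "invertible (matrix_inv A)"
  using matrix_inv_unique[OF matrix_inv_mult(2)[OF assms]] by auto

section \<open>The matrix exponential\<close>

text \<open>The term M^k / k! of the series of \<open>mexp\<close>. With the factorial included, the
  recursion (k+1) m_(k+1) = M m_k can replace binomial coefficients in the products of series
  below.\<close>

definition mpow :: "'n::finite cmat \<Rightarrow> nat \<Rightarrow> 'n cmat" where
  "mpow M k = (1 / fact k) *\<^sub>R (((**) M ^^ k) (mat 1))"

lemma mpow_Suc: "(1 + real k) *\<^sub>R mpow M (Suc k) = M ** mpow M k"
  by (simp add: mpow_def mm.scaleR_right divide_simps)

lemma mpow_commute: "M ** mpow M k = mpow M k ** M"
proof -
  have "M ** ((**) M ^^ k) (mat 1) = ((**) M ^^ k) (mat 1) ** M"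
    by (induction k) (simp_all add: matrix_mul_assoc)
  then show ?thesis by (simp add: mpow_def mm.scaleR_right mm.scaleR_left)
qed

text \<open>The norm is used as submultiplicative only up to a constant \<open>K\<close>; M^k is
  bounded by N (|M| K)^k, with N the norm of the unit matrix, and the series is dominated by an
  exponential one.\<close>

lemma summable_norm_mpow:
  fixes M :: "'n::finite cmat"
  shows "summable (\<lambda>k. norm (mpow M k))"
proof -
  obtain K where K: "K \<ge> 0" "\<And>(A :: 'n cmat) (B :: 'n cmat). norm (A ** B) \<le> norm A * norm B * K"
    using bounded_bilinear.nonneg_bounded[OF bounded_bilinear_matrix_mult[where 'n='n]] by blast
  define N :: real where "N = norm (mat 1 :: 'n cmat)"
  have b: "norm (((**) M ^^ k) (mat 1)) \<le> N * (norm M * K) ^ k" for k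
  proof (induction k)
    case (Suc k)
    have "norm (((**) M ^^ Suc k) (mat 1)) \<le> norm M * norm (((**) M ^^ k) (mat 1)) * K"
      using K(2) by simp
    also have "\<dots> \<le> norm M * (N * (norm M * K) ^ k) * K"
      using Suc K(1) by (intro mult_right_mono mult_left_mono) auto
    finally show ?case by (simp add: algebra_simps)
  qed (simp add: N_def)
  show ?thesis
  proof (rule summable_comparison_test')
    show "summable (\<lambda>k. N * ((norm M * K) ^ k /\<^sub>R fact k))"
      by (intro summable_mult summable_exp_generic)
    show "norm (norm (mpow M k)) \<le> N * ((norm M * K) ^ k /\<^sub>R fact k)" for k
      using b[of k] by (simp add: mpow_def divide_simps)
  qed
qed

lemma mexp_sums: "mpow M sums mexp M"
  using summable_norm_cancel[OF summable_norm_mpow, of M] unfolding mexp_def mpow_def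
  by (simp add: summable_sums)

lemma mexp_mv_sums: "(\<lambda>k. mpow M k *v v) sums (mexp M *v v)"
  by (rule bounded_linear.sums[OF mv.bounded_linear_left mexp_sums])

lemma mpow_mv_intertwine:
  assumes "linear f" "\<And>v. f (M *v v) = M' *v f v"
  shows "f (mpow M k *v v) = mpow M' k *v f v"
proof -
  have "f (((**) M ^^ k) (mat 1) *v v) = ((**) M' ^^ k) (mat 1) *v f v"
    by (induction k) (simp_all add: assms matrix_vector_mul_assoc[symmetric])
  then show ?thesis
    by (simp add: mpow_def mv.scaleR_left linear_scale[OF assms(1)])
qed

text \<open>Only real linearity of \<open>f\<close> is asked for, so that the antilinear \<rho> and
  the complex linear automorphisms are covered alike.\<close>

lemma mexp_mv_intertwine:
  fixes f :: "'n::finite cvec \<Rightarrow> 'm::finite cvec"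
  assumes "linear f" "\<And>v. f (M *v v) = M' *v f v"
  shows "f (mexp M *v v) = mexp M' *v f v"
proof -
  have "(\<lambda>k. f (mpow M k *v v)) sums f (mexp M *v v)"
    by (rule bounded_linear.sums[OF assms(1)[unfolded linear_conv_bounded_linear] mexp_mv_sums])
  then have "(\<lambda>k. mpow M' k *v f v) sums f (mexp M *v v)"
    by (simp add: mpow_mv_intertwine[OF assms])
  then show ?thesis using mexp_mv_sums sums_unique2 by blast
qed

text \<open>The partial sums stay in \<open>S\<close>, and a subspace of a finite-dimensional space
  is closed.\<close>

lemma mexp_mv_subspace:
  assumes S: "subspace S" and "\<And>v. v \<in> S \<Longrightarrow> M *v v \<in> S" "v \<in> S"
  shows "mexp M *v v \<in> S"
proof -
  have "((**) M ^^ k) (mat 1) *v v \<in> S" for k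
    by (induction k) (simp_all add: assms matrix_vector_mul_assoc[symmetric])
  then have "mpow M k *v v \<in> S" for k
    by (simp add: mpow_def mv.scaleR_left subspace_scale[OF S])
  then have "(\<Sum>k<n. mpow M k *v v) \<in> S" for n by (intro subspace_sum S)
  then show ?thesis
    by (rule closed_sequentially[OF closed_subspace[OF S] _ mexp_mv_sums[unfolded sums_def]])
qed

text \<open>Expanding both arguments in orthonormal bases reduces the claim to the Cauchy product of
  finitely many pairs of real series.\<close>

lemma bounded_bilinear_Cauchy_product_sums:
  fixes B :: "'a::euclidean_space \<Rightarrow> 'b::euclidean_space \<Rightarrow> 'c::real_normed_vector"
  assumes B: "bounded_bilinear B"
    and a: "summable (\<lambda>k. norm (a k))" and b: "summable (\<lambda>k. norm (b k))"
  shows "(\<lambda>k. \<Sum>i\<le>k. B (a i) (b (k - i))) sums B (suminf a) (suminf b)"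
proof -
  interpret bounded_bilinear B by (rule B)
  have expand: "B x y = (\<Sum>u\<in>Basis. \<Sum>w\<in>Basis. ((x \<bullet> u) * (y \<bullet> w)) *\<^sub>R B u w)" for x y
  proof -
    have "B x y = B (\<Sum>u\<in>Basis. (x \<bullet> u) *\<^sub>R u) (\<Sum>w\<in>Basis. (y \<bullet> w) *\<^sub>R w)"
      by (simp add: euclidean_representation)
    also have "\<dots> = (\<Sum>u\<in>Basis. \<Sum>w\<in>Basis. ((x \<bullet> u) * (y \<bullet> w)) *\<^sub>R B u w)"
      by (simp add: sum_left sum_right scaleR_left scaleR_right)
        (simp add: scaleR_sum_right mult.commute, rule sum.swap)
    finally show ?thesis .
  qed
  have sa: "summable a" and sb: "summable b" using a b summable_norm_cancel by auto
  have na: "summable (\<lambda>k. norm (a k \<bullet> u))" if "u \<in> Basis" for u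
    by (rule summable_comparison_test'[OF a]) (simp add: Basis_le_norm that)
  have nb: "summable (\<lambda>k. norm (b k \<bullet> u))" if "u \<in> Basis" for u
    by (rule summable_comparison_test'[OF b]) (simp add: Basis_le_norm that)
  have inn: "(\<Sum>k. a k \<bullet> u) = suminf a \<bullet> u" "(\<Sum>k. b k \<bullet> w) = suminf b \<bullet> w" for u w
    using bounded_linear.suminf[OF bounded_linear_inner_left sa]
      bounded_linear.suminf[OF bounded_linear_inner_left sb] by auto
  have "(\<lambda>k. \<Sum>u\<in>Basis. \<Sum>w\<in>Basis. (\<Sum>i\<le>k. (a i \<bullet> u) * (b (k - i) \<bullet> w)) *\<^sub>R B u w) sums
        (\<Sum>u\<in>Basis. \<Sum>w\<in>Basis. ((suminf a \<bullet> u) * (suminf b \<bullet> w)) *\<^sub>R B u w)"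
    using Cauchy_product_sums[OF na nb] by (intro sums_sum sums_scaleR_left) (simp add: inn)
  moreover have "(\<Sum>u\<in>Basis. \<Sum>w\<in>Basis. (\<Sum>i\<le>k. (a i \<bullet> u) * (b (k - i) \<bullet> w)) *\<^sub>R B u w)
      = (\<Sum>i\<le>k. B (a i) (b (k - i)))" for k
  proof -
    have "(\<Sum>i\<le>k. B (a i) (b (k - i))) =
      (\<Sum>i\<le>k. \<Sum>u\<in>Basis. \<Sum>w\<in>Basis. ((a i \<bullet> u) * (b (k - i) \<bullet> w)) *\<^sub>R B u w)"
      by (subst expand) simp
    also have "\<dots> = (\<Sum>u\<in>Basis. \<Sum>w\<in>Basis. \<Sum>i\<le>k. ((a i \<bullet> u) * (b (k - i) \<bullet> w)) *\<^sub>R B u w)"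
      by (subst sum.swap, rule sum.cong[OF refl], rule sum.swap)
    finally show ?thesis by (simp add: scaleR_left.sum scaleR_sum_left)
  qed
  ultimately show ?thesis by (simp add: expand[of "suminf a" "suminf b"])
qed

text \<open>The Leibniz rule on coefficients of power series: k + 1 is split as i + (k + 1 - i), the
  index i = 0 drops out of the first sum and i = k + 1 out of the second.\<close>

lemma bilinear_Cauchy_Suc:
  assumes B: "bounded_bilinear B"
  shows "(1 + real k) *\<^sub>R (\<Sum>i\<le>Suc k. B (a i) (b (Suc k - i))) =
    (\<Sum>i\<le>k. B ((1 + real i) *\<^sub>R a (Suc i)) (b (k - i)) + B (a i) ((1 + real (k - i)) *\<^sub>R b (Suc (k - i))))"
proof -
  interpret bounded_bilinear B by (rule B)
  have "(1 + real k) *\<^sub>R (\<Sum>i\<le>Suc k. B (a i) (b (Suc k - i))) =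
    (\<Sum>i\<le>Suc k. real i *\<^sub>R B (a i) (b (Suc k - i))) + (\<Sum>i\<le>Suc k. real (Suc k - i) *\<^sub>R B (a i) (b (Suc k - i)))"
    by (simp only: scaleR_sum_right sum.distrib[symmetric] scaleR_add_left[symmetric])
       (intro sum.cong refl, auto simp: of_nat_diff)
  also have "(\<Sum>i\<le>Suc k. real i *\<^sub>R B (a i) (b (Suc k - i))) =
     (\<Sum>i\<le>k. B ((1 + real i) *\<^sub>R a (Suc i)) (b (k - i)))"
    by (subst sum.atMost_Suc_shift) (simp add: scaleR_left)
  also have "(\<Sum>i\<le>Suc k. real (Suc k - i) *\<^sub>R B (a i) (b (Suc k - i))) =
     (\<Sum>i\<le>k. B (a i) ((1 + real (k - i)) *\<^sub>R b (Suc (k - i))))"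
    by (simp add: scaleR_right Suc_diff_le cong: sum.cong_simp) (simp add: of_nat_diff add_diff_eq)
  finally show ?thesis by (simp add: sum.distrib)
qed

text \<open>The formal counterpart of differentiating exp(tM) exp(-tM): as M commutes with its
  powers, the coefficients of the product series satisfy (k+1) c_(k+1) = 0, and only c_0 = 1 is
  left.\<close>

lemma mexp_minus: "mexp M ** mexp (- M) = mat 1"
proof -
  define c where "c k = (\<Sum>i\<le>k. mpow M i ** mpow (- M) (k - i))" for k
  have s: "c sums (mexp M ** mexp (- M))"
    using bounded_bilinear_Cauchy_product_sums[OF bounded_bilinear_matrix_mult
        summable_norm_mpow[of M] summable_norm_mpow[of "- M"]]
    unfolding c_def mexp_sums[THEN sums_unique] .
  have neg: "- M ** mpow (-M) j = - (M ** mpow (-M) j)" for j by (simp add: mm.minus_left)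
  have "(1 + real k) *\<^sub>R c (Suc k) = 0" for k
    unfolding c_def bilinear_Cauchy_Suc[OF bounded_bilinear_matrix_mult] mpow_Suc mpow_commute[of M]
    by (simp add: matrix_mul_assoc[symmetric] neg mm.minus_right)
  moreover have "1 + real k \<noteq> 0" for k by linarith
  ultimately have z: "c (Suc k) = 0" for k by (meson scaleR_eq_0_iff)
  have c0: "c 0 = mat 1" by (simp add: c_def mpow_def)
  have "c sums (\<Sum>k\<in>{0}. c k)"
  proof (rule sums_finite)
    fix k assume "k \<notin> {0::nat}"
    then show "c k = 0" using z[of "k - 1"] by simp
  qed simp
  then show ?thesis using s sums_unique2[of c] c0 by simp
qed

lemma invertible_mexp: "invertible (mexp M)" "matrix_inv (mexp M) = mexp (- M)"
  using matrix_inv_unique[OF mexp_minus] by auto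

text \<open>The exponential of a derivation is multiplicative because the coefficients of both sides
  start with B x y and obey the same recursion (k+1) c_(k+1) = M c_k; for the right-hand side this
  is the Leibniz rule.\<close>

lemma mexp_derivation:
  fixes B :: "'n::finite cvec \<Rightarrow> 'n cvec \<Rightarrow> 'n cvec"
  assumes B: "bounded_bilinear B" and M: "\<And>x y. M *v B x y = B (M *v x) y + B x (M *v y)"
  shows "mexp M *v B x y = B (mexp M *v x) (mexp M *v y)"
proof -
  interpret bounded_bilinear B by (rule B)
  have sn: "summable (\<lambda>k. norm (mpow M k *v z))" for z
  proof -
    obtain K where K: "K \<ge> 0" "\<And>(A :: 'n cmat) v. norm (A *v v) \<le> norm A * norm v * K"
      using bounded_bilinear.nonneg_bounded[OF bounded_bilinear_matrix_vector_mult[where 'n='n]] by blast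
    show ?thesis
      by (rule summable_comparison_test'[where g = "\<lambda>k. norm (mpow M k) * (norm z * K)"])
        (use K in \<open>auto intro!: summable_mult2 summable_norm_mpow simp: mult.assoc\<close>)
  qed
  define c where "c k = (\<Sum>i\<le>k. B (mpow M i *v x) (mpow M (k - i) *v y))" for k
  have s: "c sums B (mexp M *v x) (mexp M *v y)"
    using bounded_bilinear_Cauchy_product_sums[OF B sn[of x] sn[of y]]
    unfolding c_def mexp_mv_sums[THEN sums_unique] .
  have "c k = mpow M k *v B x y" for k
  proof (induction k)
    case 0 show ?case by (simp add: c_def mpow_def)
  next
    case (Suc k)
    have st: "(1 + real i) *\<^sub>R (mpow M (Suc i) *v z) = M *v (mpow M i *v z)" for i z
      by (simp only: mv.scaleR_left[symmetric] mpow_Suc matrix_vector_mul_assoc)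
    have "(1 + real k) *\<^sub>R c (Suc k) = M *v c k"
      unfolding c_def bilinear_Cauchy_Suc[OF B, of k "\<lambda>i. mpow M i *v x" "\<lambda>i. mpow M i *v y"] st
      by (simp add: M[symmetric] mv.sum_right)
    also have "\<dots> = (1 + real k) *\<^sub>R (mpow M (Suc k) *v B x y)"
      by (simp add: Suc st)
    finally have "(1 + real k) *\<^sub>R c (Suc k) = (1 + real k) *\<^sub>R (mpow M (Suc k) *v B x y)" .
    moreover have "1 + real k \<noteq> 0" by linarith
    ultimately show ?case by (meson scaleR_cancel_left)
  qed
  then have "c = (\<lambda>k. mpow M k *v B x y)" by auto
  then have "c sums (mexp M *v B x y)" using mexp_mv_sums by metis
  then show ?thesis using s sums_unique2 by blast
qed

section \<open>Groups of matrices\<close>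

lemma matrix_groupD:
  assumes "matrix_group K"
  shows "mat 1 \<in> K" "a \<in> K \<Longrightarrow> invertible a" "a \<in> K \<Longrightarrow> matrix_inv a \<in> K"
    "a \<in> K \<Longrightarrow> b \<in> K \<Longrightarrow> a ** b \<in> K"
  using assms unfolding matrix_group_def by auto

lemma generated_group_subset:
  assumes K: "matrix_group K" and S: "S \<subseteq> K"
  shows "generated_group S \<subseteq> K"
proof
  fix a assume "a \<in> generated_group S"
  then show "a \<in> K"
    by induction (use matrix_groupD[OF K] S in blast)+
qed

lemma generator_in_generated_group: "a \<in> S \<Longrightarrow> a \<in> generated_group S"
  using generated_group.mult[OF generated_group.one] by simp

text \<open>The inductive rules multiply by a generator or its inverse on the right only. Closure
  under products is an induction on the second factor, and it is needed to write the inverse of a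
  product with the factors reversed.\<close>

lemma matrix_group_generated_group:
  assumes "\<And>a. a \<in> S \<Longrightarrow> invertible a"
  shows "matrix_group (generated_group S)"
proof -
  have mult: "a ** b \<in> generated_group S" if "a \<in> generated_group S" "b \<in> generated_group S" for a b
    using that(2) by induction (auto simp: that(1) matrix_mul_assoc intro: generated_group.intros)
  have "invertible a \<and> matrix_inv a \<in> generated_group S" if "a \<in> generated_group S" for a
    using that
  proof induction
    case one then show ?case using matrix_inv_unique(2)[of "mat 1" "mat 1"] by (simp add: generated_group.one)
  next
    case (mult a b)
    have "mat 1 ** matrix_inv b \<in> generated_group S" by (intro generated_group.quot generated_group.one mult)
    then show ?case using mult assms \<open>\<And>b a. a \<in> _ \<Longrightarrow> b \<in> _ \<Longrightarrow> a ** b \<in> _\<close> by (simp add: matrix_inv_matrix_mult)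
  next
    case (quot a b)
    then show ?case using assms \<open>\<And>b a. a \<in> _ \<Longrightarrow> b \<in> _ \<Longrightarrow> a ** b \<in> _\<close>
      by (simp add: matrix_inv_matrix_mult generator_in_generated_group)
  qed
  then show ?thesis unfolding matrix_group_def by (auto intro: mult generated_group.one)
qed

text \<open>Together with \<open>stabilizer\<close> and \<open>lie_aut_group\<close> this turns
  properties of the groups \<open>GG\<close>, \<open>TC\<close> and \<open>HC\<close> into
  inclusions of matrix groups, which need to be checked on generators only.\<close>

definition commuting_group :: "('n::finite cvec \<Rightarrow> 'n cvec) \<Rightarrow> 'n cmat set" where
  "commuting_group f = {a. invertible a \<and> (\<forall>x. f (a *v x) = a *v f x)}"

text \<open>Demanding equality instead of inclusion makes closure under inverses immediate.\<close>

definition stabilizer :: "'n::finite cvec set \<Rightarrow> 'n cmat set" where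
  "stabilizer V = {a. invertible a \<and> (\<lambda>x. a *v x) ` V = V}"

lemma matrix_group_commuting_group: "matrix_group (commuting_group f)"
  unfolding matrix_group_def
proof (intro conjI ballI)
  show "mat 1 \<in> commuting_group f"
    using matrix_inv_unique(2)[of "mat 1" "mat 1"] by (simp add: commuting_group_def)
next
  fix a assume "a \<in> commuting_group f"
  then have i: "invertible a" and c: "\<And>x. f (a *v x) = a *v f x" by (auto simp: commuting_group_def)
  then show "invertible a" by blast
  have "f (matrix_inv a *v x) = matrix_inv a *v f x" for x
    by (metis i c matrix_inv_cancel_mv)
  then show "matrix_inv a \<in> commuting_group f" using i by (simp add: commuting_group_def)
next
  fix a b assume "a \<in> commuting_group f" "b \<in> commuting_group f"
  then show "a ** b \<in> commuting_group f"
    by (simp add: commuting_group_def matrix_inv_matrix_mult matrix_vector_mul_assoc[symmetric])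
qed

lemma matrix_group_stabilizer: "matrix_group (stabilizer V)"
  unfolding matrix_group_def
proof (intro conjI ballI)
  show "mat 1 \<in> stabilizer V"
    using matrix_inv_unique(2)[of "mat 1" "mat 1"] by (simp add: stabilizer_def)
next
  fix a assume "a \<in> stabilizer V"
  then have i: "invertible a" and c: "(\<lambda>x. a *v x) ` V = V" by (auto simp: stabilizer_def)
  then show "invertible a" by blast
  have "(\<lambda>x. matrix_inv a *v x) ` V = V" by (subst (1) c[symmetric]) (simp add: i image_image)
  then show "matrix_inv a \<in> stabilizer V" using i by (simp add: stabilizer_def)
next
  fix a b assume "a \<in> stabilizer V" "b \<in> stabilizer V"
  moreover have "(\<lambda>x. (a ** b) *v x) ` V = (\<lambda>x. a *v x) ` (\<lambda>x. b *v x) ` V"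
    by (simp add: image_image matrix_vector_mul_assoc)
  ultimately show "a ** b \<in> stabilizer V"
    by (simp add: stabilizer_def matrix_inv_matrix_mult)
qed

lemma mexp_in_commuting_group:
  assumes "linear f" "\<And>v. f (M *v v) = M *v f v"
  shows "mexp M \<in> commuting_group f"
  using mexp_mv_intertwine[OF assms] invertible_mexp(1) by (simp add: commuting_group_def)

lemma mexp_in_stabilizer:
  assumes S: "subspace S" and M: "\<And>v. v \<in> S \<Longrightarrow> M *v v \<in> S"
  shows "mexp M \<in> stabilizer S"
proof -
  have "mexp M *v v \<in> S" if "v \<in> S" for v using mexp_mv_subspace[OF S M that] .
  moreover have "v \<in> (\<lambda>x. mexp M *v x) ` S" if "v \<in> S" for v
  proof
    show "mexp (- M) *v v \<in> S"
      using mexp_mv_subspace[OF S _ that, of "- M"] M by (simp add: mv.minus_left subspace_neg[OF S])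
    show "v = mexp M *v (mexp (- M) *v v)" by (simp add: matrix_vector_mul_assoc mexp_minus)
  qed
  ultimately show ?thesis using invertible_mexp(1) by (auto simp: stabilizer_def)
qed

text \<open>Multiplication by \<open>a\<close> intertwines the two exponents. For
  \<open>M = ad L x\<close> and an automorphism \<open>a\<close> this is the Ad-equivariance of the
  exponential, from which the invariance of \<open>real_h L\<close> under \<open>H\<close>
  follows.\<close>

lemma mexp_conj:
  fixes a M :: "'n::finite cmat"
  assumes "invertible a"
  shows "mexp (a ** M ** matrix_inv a) = a ** mexp M ** matrix_inv a"
proof (rule matrix_eqI_mv)
  fix x
  have "a *v (mexp M *v v) = mexp (a ** M ** matrix_inv a) *v (a *v v)" for v
    by (rule mexp_mv_intertwine)
       (auto simp: matrix_vector_mul_assoc[symmetric] matrix_inv_cancel_mv[OF assms]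
         intro: mv.bounded_linear_right bounded_linear.linear)
  from this[of "matrix_inv a *v x"] show "mexp (a ** M ** matrix_inv a) *v x = (a ** mexp M ** matrix_inv a) *v x"
    using assms by (simp add: matrix_vector_mul_assoc[symmetric])
qed

section \<open>Orthogonal projection and components\<close>

lemma component_eqI:
  assumes "subspace U" "subspace V" "U \<inter> V \<subseteq> {0}" "\<eta> \<in> U" "\<xi> - \<eta> \<in> V"
  shows "component U V \<xi> = \<eta>"
  unfolding component_def
proof (rule the_equality)
  fix \<zeta> assume z: "\<zeta> \<in> U \<and> \<xi> - \<zeta> \<in> V"
  have "\<zeta> - \<eta> \<in> U" using z assms by (simp add: subspace_diff)
  moreover have "\<zeta> - \<eta> = (\<xi> - \<eta>) - (\<xi> - \<zeta>)" by simp
  then have "\<zeta> - \<eta> \<in> V" using z assms by (metis subspace_diff)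
  ultimately show "\<zeta> = \<eta>" using assms(3) by auto
qed (use assms in auto)

text \<open>The map \<open>F\<close> records the values of B x on an orthonormal basis of V.
  Definiteness makes it injective on V, hence onto V by dimension. It is used to project onto the
  torus with respect to the Killing form.\<close>

lemma positive_definite_representation:
  fixes B :: "'a::euclidean_space \<Rightarrow> 'a \<Rightarrow> real"
  assumes V: "subspace V" and B: "bilinear B" and pos: "\<And>x. x \<in> V \<Longrightarrow> x \<noteq> 0 \<Longrightarrow> B x x > 0"
    and l: "linear l"
  obtains x where "x \<in> V" "\<And>y. y \<in> V \<Longrightarrow> B x y = l y"
proof -
  obtain E where E: "E \<subseteq> V" "pairwise orthogonal E" "\<And>x. x \<in> E \<Longrightarrow> norm x = 1"
      "independent E" "card E = dim V" "span E = V"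
    using orthonormal_basis_subspace[OF V] by metis
  have fin: "finite E" using E(4) independent_imp_finite by blast
  have lr: "linear (B x)" and ll: "linear (\<lambda>x. B x y)" for x y using B by (auto simp: bilinear_def)
  have coef: "c b0 = c' b0" if "(\<Sum>b\<in>E. c b *\<^sub>R b) = (\<Sum>b\<in>E. c' b *\<^sub>R b)" "b0 \<in> E"
    for c c' b0
  proof -
    have "(\<Sum>b\<in>E. (c b - c' b) *\<^sub>R b) = 0" using that(1) by (simp add: scaleR_diff_left sum_subtractf)
    then have "c b0 - c' b0 = 0"
      using E(4)[unfolded independent_explicit, THEN conjunct2, rule_format, of "\<lambda>b. c b - c' b"] that(2)
      by blast
    then show ?thesis using that by simp
  qed
  define F where "F x = (\<Sum>b\<in>E. B x b *\<^sub>R b)" for x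
  have linF: "linear F"
    unfolding F_def
    by (intro linearI) (simp_all add: linear_add[OF ll] linear_scale[OF ll] scaleR_add_left sum.distrib scaleR_sum_right)
  have on_V: "B x y = l' y" if "\<And>b. b \<in> E \<Longrightarrow> B x b = l' b" "linear l'" "y \<in> V" for x y l'
  proof -
    have "y \<in> span E" using E(6) that(3) by simp
    then show ?thesis using linear_eq_on_span[OF lr that(2), of E x] that(1) by blast
  qed
  have "inj_on F V"
  proof (rule inj_onI)
    fix x y assume xy: "x \<in> V" "y \<in> V" "F x = F y"
    have "B x b = B y b" if "b \<in> E" for b
      using coef[of "B x" "B y" b] xy(3) that unfolding F_def by blast
    then have "B (x - y) b = 0" if "b \<in> E" for b using that by (simp add: linear_diff[OF ll])
    moreover have "linear (\<lambda>_ :: 'a. 0 :: real)" by (rule module_hom_zero)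
    moreover have "x - y \<in> V" using xy V by (simp add: subspace_diff)
    ultimately have "B (x - y) (x - y) = 0" using on_V[where x = "x - y" and y = "x - y" and l' = "\<lambda>_. 0"] by simp
    then show "x = y" using pos[of "x - y"] xy V by (metis eq_iff_diff_eq_0 less_irrefl subspace_diff)
  qed
  moreover have "F ` V \<subseteq> V"
    unfolding F_def using E(1) V by (auto intro!: subspace_sum subspace_scale)
  ultimately have "F ` V = V"
    by (metis V dim_image_eq linF linear_subspace_image order_refl span_eq_iff subspace_dim_equal)
  moreover have "(\<Sum>b\<in>E. l b *\<^sub>R b) \<in> V" using E(1) V by (auto intro!: subspace_sum subspace_scale)
  ultimately obtain x where x: "x \<in> V" "F x = (\<Sum>b\<in>E. l b *\<^sub>R b)" by (metis imageE)
  have "B x b = l b" if "b \<in> E" for b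
    using coef[of "B x" l b] x(2) that unfolding F_def by blast
  then show ?thesis using that[OF x(1)] on_V l by blast
qed

section \<open>Killing form and derivations\<close>

text \<open>The general gauge calculus below is carried out for this group; the structure groups of
  all bundles involved are contained in it.\<close>

definition lie_aut_group :: "'n::finite toda_algebra \<Rightarrow> 'n cmat set" where
  "lie_aut_group L = {a. invertible a \<and> (\<forall>x y. a *v br L x y = br L (a *v x) (a *v y))}"

text \<open>Conjugation with respect to the standard basis, unrelated to the real forms of the Lie
  algebra. Composed with an antilinear involution it gives a complex linear map, to which traces
  apply.\<close>

definition conj_mat :: "'n::finite cmat \<Rightarrow> 'n cmat" where
  "conj_mat M = (\<chi> i j. cnj (M $ i $ j))"

definition conj_vec :: "'n::finite cvec \<Rightarrow> 'n cvec" where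
  "conj_vec v = (\<chi> i. cnj (v $ i))"

lemma conj_vec_mv: "conj_vec (M *v v) = conj_mat M *v conj_vec v"
  by (simp add: conj_vec_def conj_mat_def matrix_vector_mult_def vec_eq_iff)

lemma conj_vec_conj_vec: "conj_vec (conj_vec v) = v"
  by (simp add: conj_vec_def vec_eq_iff)

lemma trace_conj_mat: "trace (conj_mat M) = cnj (trace M)"
  by (simp add: trace_def conj_mat_def)

lemma linear_vec_iff:
  "Vector_Spaces.linear (*s) (*s) (f :: 'n::finite cvec \<Rightarrow> 'm::finite cvec) \<longleftrightarrow>
     (\<forall>x y. f (x + y) = f x + f y) \<and> (\<forall>c x. f (c *s x) = c *s f x)"
  unfolding Vector_Spaces.linear_iff_module_hom module_hom_iff
  by (auto simp: vec.module_axioms)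

locale complex_lie_algebra =
  fixes L :: "'n::finite toda_algebra"
  assumes lie: "lie_bracket (br L)"
begin

lemma br_add: "br L (x + y) z = br L x z + br L y z" "br L x (y + z) = br L x y + br L x z"
  and br_smult: "br L (c *s x) z = c *s br L x z" "br L x (c *s z) = c *s br L x z"
  using lie unfolding lie_bracket_def linear_vec_iff by auto

lemma bounded_bilinear_br: "bounded_bilinear (br L)"
  unfolding bilinear_conv_bounded_bilinear[symmetric] bilinear_def
  by (auto intro!: linearI simp: br_add br_smult scaleR_eq_smult)

sublocale br: bounded_bilinear "br L" by (rule bounded_bilinear_br)

lemma br_self: "br L x x = 0"
  using lie unfolding lie_bracket_def by auto

lemma br_antisym: "br L x y = - br L y x"
proof -
  have "br L (x + y) (x + y) = br L x y + br L y x" by (simp only: br_add) (simp add: br_self)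
  then show ?thesis by (simp add: br_self eq_neg_iff_add_eq_0)
qed

lemma jacobi: "br L x (br L y z) = br L (br L x y) z + br L y (br L x z)"
proof -
  have "br L x (br L y z) + br L y (br L z x) + br L z (br L x y) = 0"
    using lie unfolding lie_bracket_def by auto
  moreover have "br L y (br L z x) = - br L y (br L x z)"
    by (subst br_antisym[of z x]) (simp add: br.minus_right)
  moreover have "br L z (br L x y) = - br L (br L x y) z" by (rule br_antisym)
  ultimately show ?thesis by (simp add: algebra_simps)
qed

lemma ad_mv: "ad L x *v y = br L x y"
  unfolding ad_def using lie by (intro matrix_works) (auto simp: lie_bracket_def)

lemma ad_add: "ad L (x + y) = ad L x + ad L y"
  and ad_diff: "ad L (x - y) = ad L x - ad L y"
  and ad_br: "ad L (br L x y) = ad L x ** ad L y - ad L y ** ad L x"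
  by (rule matrix_eqI_mv; simp add: ad_mv mv.add_left mv.diff_left br_add br.diff_left
      matrix_vector_mul_assoc[symmetric] jacobi[of x y])+

lemma killing_ad: "killing L x y = trace (ad L x ** ad L y)"
  by (simp add: killing_def ad_def)

lemma killing_sym: "killing L x y = killing L y x"
  unfolding killing_ad by (rule trace_mul_sym)

lemma killing_add: "killing L (x + y) z = killing L x z + killing L y z"
    "killing L z (x + y) = killing L z x + killing L z y"
  by (simp_all add: killing_ad ad_add mm.add_left mm.add_right trace_add)

lemma killing_diff: "killing L (x - y) z = killing L x z - killing L y z"
    "killing L z (x - y) = killing L z x - killing L z y"
  by (simp_all add: killing_ad ad_diff mm.diff_left mm.diff_right trace_sub)

lemma ad_smult: "ad L (c *s x) = (\<chi> i j. c * ad L x $ i $ j)"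
  by (rule matrix_eqI_mv)
     (simp add: ad_mv br_smult, simp add: ad_mv[symmetric] matrix_vector_mult_def vec_eq_iff sum_distrib_left mult.assoc)

lemma trace_smult_mult: "trace ((\<chi> i j. c * A $ i $ j) ** B) = c * trace (A ** B :: complex^'n^'n)"
  by (simp add: trace_def matrix_matrix_mult_def sum_distrib_left mult.assoc)

lemma killing_smult: "killing L (c *s x) y = c * killing L x y" "killing L x (c *s y) = c * killing L x y"
proof -
  show 1: "killing L (c *s x) y = c * killing L x y" for x y
    by (simp add: killing_ad ad_smult trace_smult_mult)
  show "killing L x (c *s y) = c * killing L x y"
    by (metis 1 killing_sym)
qed

lemma killing_minus: "killing L (- x) y = - killing L x y"
  using killing_smult(1)[of "-1" x y] by (simp add: vector_sneg_minus1[symmetric])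

lemma killing_scaleR: "killing L (r *\<^sub>R x) y = of_real r * killing L x y" "killing L x (r *\<^sub>R y) = of_real r * killing L x y"
  by (simp_all add: scaleR_eq_smult killing_smult)

lemma lie_aut_group_invertible: "a \<in> lie_aut_group L \<Longrightarrow> invertible a"
  by (simp add: lie_aut_group_def)

lemma lie_aut_group_br: "a \<in> lie_aut_group L \<Longrightarrow> a *v br L x y = br L (a *v x) (a *v y)"
  by (simp add: lie_aut_group_def)

lemma matrix_group_lie_aut_group: "matrix_group (lie_aut_group L)"
  unfolding matrix_group_def
proof (intro conjI ballI)
  show "mat 1 \<in> lie_aut_group L"
    using matrix_inv_unique(2)[of "mat 1" "mat 1"] by (simp add: lie_aut_group_def)
next
  fix a assume "a \<in> lie_aut_group L"
  then have i: "invertible a" and c: "\<And>x y. a *v br L x y = br L (a *v x) (a *v y)" by (auto simp: lie_aut_group_def)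
  then show "invertible a" by blast
  have "matrix_inv a *v br L x y = br L (matrix_inv a *v x) (matrix_inv a *v y)" for x y
    using c[of "matrix_inv a *v x" "matrix_inv a *v y"] i by (metis matrix_inv_cancel_mv)
  then show "matrix_inv a \<in> lie_aut_group L" using i by (simp add: lie_aut_group_def)
next
  fix a b assume "a \<in> lie_aut_group L" "b \<in> lie_aut_group L"
  then show "a ** b \<in> lie_aut_group L"
    by (simp add: lie_aut_group_def matrix_inv_matrix_mult matrix_vector_mul_assoc[symmetric])
qed

lemma ad_conj:
  assumes "a \<in> lie_aut_group L"
  shows "a ** ad L x ** matrix_inv a = ad L (a *v x)"
  by (rule matrix_eqI_mv)
     (simp add: matrix_vector_mul_assoc[symmetric] ad_mv lie_aut_group_br[OF assms] lie_aut_group_invertible[OF assms])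

text \<open>An automorphism conjugates \<open>ad\<close>, and the trace is invariant under
  conjugation.\<close>

lemma killing_lie_aut:
  assumes "a \<in> lie_aut_group L"
  shows "killing L (a *v x) (a *v y) = killing L x y"
proof -
  have i: "invertible a" using assms by (rule lie_aut_group_invertible)
  have "ad L (a *v x) ** ad L (a *v y) = a ** ad L x ** (matrix_inv a ** a) ** ad L y ** matrix_inv a"
    by (simp only: ad_conj[OF assms, symmetric] matrix_mul_assoc)
  also have "\<dots> = a ** (ad L x ** ad L y ** matrix_inv a)"
    by (simp add: matrix_inv_mult(2)[OF i] matrix_mul_assoc)
  finally have "killing L (a *v x) (a *v y) = trace (ad L x ** ad L y ** matrix_inv a ** a)"
    by (simp only: killing_ad trace_mul_sym[of a])
  also have "\<dots> = killing L x y"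
    by (simp add: killing_ad matrix_mul_assoc[symmetric] matrix_inv_mult(2)[OF i])
  finally show ?thesis .
qed

lemma lie_aut_matrix:
  assumes "lie_aut (br L) f"
  shows "matrix f *v x = f x" "matrix f \<in> lie_aut_group L"
proof -
  have lin: "Vector_Spaces.linear (*s) (*s) f" and bij: "bij f" and hom: "\<And>x y. f (br L x y) = br L (f x) (f y)"
    using assms unfolding lie_aut_def by auto
  show w: "matrix f *v x = f x" for x by (rule matrix_works[OF lin])
  have "inj ((*v) (matrix f))" using bij_is_inj[OF bij] by (simp add: w inj_on_def)
  then have "invertible (matrix f)"
    by (meson inj_matrix_vector_mult invertible_left_inverse matrix_left_invertible_injective)
  then show "matrix f \<in> lie_aut_group L" by (simp add: lie_aut_group_def w hom)
qed

lemma killing_lie_aut_fun: "lie_aut (br L) f \<Longrightarrow> killing L (f x) (f y) = killing L x y"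
  using killing_lie_aut[OF lie_aut_matrix(2)] lie_aut_matrix(1) by metis

text \<open>The composite of \<kappa> with \<open>conj_vec\<close> is complex linear, with matrix
  \<open>C\<close>. Then ad(\<kappa> x) is the conjugate by \<open>C\<close> of the entrywise
  conjugate of ad x, and the trace changes by complex conjugation only.\<close>

lemma killing_real_involution:
  assumes "real_involution L \<kappa>"
  shows "killing L (\<kappa> x) (\<kappa> y) = cnj (killing L x y)"
proof -
  have add: "\<kappa> (x + y) = \<kappa> x + \<kappa> y" and sc: "\<kappa> (c *s x) = cnj c *s \<kappa> x"
    and hom: "\<kappa> (br L x y) = br L (\<kappa> x) (\<kappa> y)" and inv: "\<kappa> (\<kappa> x) = x" for x y c
    using assms unfolding real_involution_def by (auto simp: fun_eq_iff)
  define C where "C = matrix (\<kappa> \<circ> conj_vec)"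
  have conj_add: "conj_vec (x + y) = conj_vec x + conj_vec y" and conj_sc: "conj_vec (c *s x) = cnj c *s conj_vec x"
    for x y :: "'n cvec" and c by (simp_all add: conj_vec_def vec_eq_iff)
  have C: "C *v conj_vec x = \<kappa> x" for x
  proof -
    have "C *v conj_vec x = (\<kappa> \<circ> conj_vec) (conj_vec x)" unfolding C_def
      by (intro matrix_works) (simp add: linear_vec_iff add sc conj_add conj_sc)
    then show ?thesis by (simp add: conj_vec_conj_vec)
  qed
  \<comment> \<open>This is the involutivity of \<kappa>, written for the matrix
    \<open>C\<close>.\<close>
  have CC: "C ** conj_mat C = mat 1"
    by (rule matrix_eqI_mv) (metis C conj_vec_conj_vec conj_vec_mv inv matrix_vector_mul_assoc matrix_vector_mul_lid)
  have inverse: "matrix_inv C = conj_mat C" "invertible C" using matrix_inv_unique[OF CC] by auto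
  have *: "\<kappa> (M *v (\<kappa> x)) = (C ** (conj_mat M ** conj_mat C)) *v x" for M x
  proof -
    have "\<kappa> (M *v \<kappa> x) = C *v conj_vec (M *v (C *v conj_vec x))" by (simp add: C)
    also have "\<dots> = C *v (conj_mat M *v (conj_mat C *v x))" by (simp add: conj_vec_mv conj_vec_conj_vec)
    finally show ?thesis by (simp add: matrix_vector_mul_assoc matrix_mul_assoc)
  qed
  have "ad L (\<kappa> x) ** ad L (\<kappa> y) = C ** (conj_mat (ad L x ** ad L y) ** conj_mat C)"
    by (rule matrix_eqI_mv, subst *[symmetric])
       (simp add: matrix_vector_mul_assoc[symmetric] ad_mv hom inv)
  then have "killing L (\<kappa> x) (\<kappa> y) = trace (conj_mat (ad L x ** ad L y) ** (conj_mat C ** C))"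
    by (simp only: killing_ad trace_mul_sym[of C] matrix_mul_assoc[symmetric])
  also have "\<dots> = cnj (killing L x y)"
    using CC matrix_left_right_inverse[of C "conj_mat C"] by (simp add: killing_ad trace_conj_mat)
  finally show ?thesis .
qed

end

section \<open>Consequences of a nondegenerate Killing form\<close>

locale killing_lie_algebra = complex_lie_algebra L for L :: "'n::finite toda_algebra" +
  assumes killing_nondegenerate: "\<And>x. (\<And>y. killing L x y = 0) \<Longrightarrow> x = 0"
begin

lemma ad_eq_iff: "ad L x = ad L y \<longleftrightarrow> x = y"
proof
  assume "ad L x = ad L y"
  then have "killing L (x - y) z = 0" for z by (simp add: killing_diff) (simp add: killing_ad)
  then show "x = y" using killing_nondegenerate[of "x - y"] by simp
qed simp

text \<open>Nondegeneracy makes the map from vectors to functionals injective, hence surjective by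
  dimension; \<open>F\<close> expresses a functional by its values on the standard basis.\<close>

lemma killing_represents_trace: "\<exists>\<xi>. \<forall>x. killing L \<xi> x = trace (D ** ad L x)"
proof -
  define F where "F \<xi> = (\<chi> i. killing L \<xi> (axis i 1))" for \<xi>
  have sum_add: "f (\<Sum>i\<in>I. g i) = (\<Sum>i\<in>I. f (g i))" if "\<And>x y. f (x + y) = f x + f y" "f 0 = 0" "finite I"
    for f :: "'n cvec \<Rightarrow> complex" and g and I :: "'n set"
    using that(3) by induction (auto simp: that)
  have expand: "f x = (\<Sum>i\<in>UNIV. x $ i * f (axis i 1))"
    if "\<And>x y. f (x + y) = f x + f y" "\<And>c x. f (c *s x) = c * f x" for f :: "'n cvec \<Rightarrow> complex" and x
  proof -
    have "f x = f (\<Sum>i\<in>UNIV. x $ i *s axis i 1)" by (simp add: basis_expansion)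
    also have "\<dots> = (\<Sum>i\<in>UNIV. f (x $ i *s axis i 1))"
      by (rule sum_add) (use that(1) that(2)[of 0 0] in auto)
    finally show ?thesis by (simp add: that)
  qed
  have "Vector_Spaces.linear (*s) (*s) F"
    by (simp add: F_def linear_vec_iff killing_add killing_smult vec_eq_iff)
  moreover have "inj F"
  proof (rule injI)
    fix x y assume e: "F x = F y"
    have "killing L (x - y) z = 0" for z
      by (subst expand[of "killing L (x - y)"])
         (use e in \<open>simp_all add: killing_add killing_smult F_def vec_eq_iff killing_diff\<close>)
    then show "x = y" using killing_nondegenerate[of "x - y"] by simp
  qed
  ultimately have "surj F" using vec.linear_injective_imp_surjective by blast
  then obtain \<xi> where xi: "F \<xi> = (\<chi> i. trace (D ** ad L (axis i 1)))" by (metis surjD)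
  have "killing L \<xi> x = trace (D ** ad L x)" for x
  proof -
    have add: "trace (D ** ad L (x + y)) = trace (D ** ad L x) + trace (D ** ad L y)" for x y
      by (simp add: ad_add mm.add_right trace_add)
    have sc: "trace (D ** ad L (c *s x)) = c * trace (D ** ad L x)" for c x
      unfolding trace_mul_sym[of D] by (simp add: ad_smult trace_smult_mult)
    show ?thesis
      unfolding expand[of "killing L \<xi>", OF killing_add(2) killing_smult(2), of x]
        expand[of "\<lambda>x. trace (D ** ad L x)", OF add sc, of x]
      using xi by (simp add: F_def vec_eq_iff)
  qed
  then show ?thesis by blast
qed

text \<open>Choose \<xi> such that \<open>ad L \<xi>\<close> has the same trace pairings with all
  \<open>ad L x\<close> as D. The remainder E is a derivation with trace(E ad x) = 0, so killing(E
  x, y) = trace(E ad [x,y]) = 0, and nondegeneracy gives E = 0.\<close>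

lemma derivation_inner:
  assumes D: "\<And>x y. D *v br L x y = br L (D *v x) y + br L x (D *v y)"
  shows "\<exists>\<xi>. D = ad L \<xi>"
proof -
  obtain \<xi> where xi: "\<And>x. killing L \<xi> x = trace (D ** ad L x)" using killing_represents_trace by blast
  define E where "E = D - ad L \<xi>"
  have E: "E *v br L x y = br L (E *v x) y + br L x (E *v y)" for x y
    by (simp add: E_def mv.diff_left D ad_mv br.diff_left br.diff_right jacobi[of \<xi> x y])
  have adE: "ad L (E *v x) = E ** ad L x - ad L x ** E" for x
    by (rule matrix_eqI_mv) (simp add: ad_mv mv.diff_left matrix_vector_mul_assoc[symmetric] E)
  have tr0: "trace (E ** ad L x) = 0" for x
    using xi[of x] by (simp add: E_def mm.diff_left trace_sub killing_ad)
  have "killing L (E *v x) y = 0" for x y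
  proof -
    have "killing L (E *v x) y = trace (E ** (ad L x ** ad L y)) - trace (ad L x ** (E ** ad L y))"
      by (simp add: killing_ad adE mm.diff_left trace_sub matrix_mul_assoc)
    also have "trace (ad L x ** (E ** ad L y)) = trace (E ** (ad L y ** ad L x))"
      by (subst trace_mul_sym) (simp add: matrix_mul_assoc)
    also have "trace (E ** (ad L x ** ad L y)) - trace (E ** (ad L y ** ad L x)) = trace (E ** ad L (br L x y))"
      by (simp add: ad_br mm.diff_right trace_sub)
    finally show ?thesis by (simp add: tr0)
  qed
  then have "E *v x = 0" for x using killing_nondegenerate by blast
  then have "E = 0" by (intro matrix_eqI_mv) simp
  then show ?thesis by (auto simp: E_def)
qed

lemma mexp_ad_in_lie_aut_group: "mexp (ad L \<xi>) \<in> lie_aut_group L"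
  using mexp_derivation[OF bounded_bilinear_br, of "ad L \<xi>"] invertible_mexp(1)
  by (simp add: lie_aut_group_def ad_mv jacobi[symmetric])

text \<open>A property of the exponentials passes to the group they generate as soon as its bearers
  form a matrix group; the groups generated by exponentials are handled through this.\<close>

lemma analytic_group_subset:
  assumes "matrix_group K" "\<And>\<xi>. \<xi> \<in> S \<Longrightarrow> mexp (ad L \<xi>) \<in> K"
  shows "analytic_group L S \<subseteq> K"
  unfolding analytic_group_def using assms by (intro generated_group_subset) auto

lemma analytic_group_lie_aut: "analytic_group L S \<subseteq> lie_aut_group L"
  by (intro analytic_group_subset matrix_group_lie_aut_group mexp_ad_in_lie_aut_group)

lemma matrix_group_analytic_group: "matrix_group (analytic_group L S)"
  unfolding analytic_group_def by (rule matrix_group_generated_group) (auto simp: invertible_mexp)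

lemma mexp_ad_commutes:
  assumes "linear f" "\<And>x y. f (br L x y) = br L (f x) (f y)" "f \<xi> = \<xi>"
  shows "mexp (ad L \<xi>) \<in> commuting_group f"
  using assms by (intro mexp_in_commuting_group) (simp_all add: ad_mv)

end

section \<open>The real form and its decompositions\<close>

text \<open>The projections onto the eigenspaces of \<sigma>, defined on the whole complex algebra.
  On \<open>real_g L\<close> they are the components along \<open>real_h L\<close> and
  \<open>real_m L\<close>, on \<open>g1 L\<close> those along \<open>kC L\<close> and
  \<open>mC L\<close>; one pair of formulas thus serves both splittings.\<close>

definition even_part :: "'n::finite toda_algebra \<Rightarrow> 'n cvec \<Rightarrow> 'n cvec" where
  "even_part L x = (1/2) *\<^sub>R (x + sigma L x)"

definition odd_part :: "'n::finite toda_algebra \<Rightarrow> 'n cvec \<Rightarrow> 'n cvec" where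
  "odd_part L x = (1/2) *\<^sub>R (x - sigma L x)"

lemma even_part_add_odd_part: "even_part L x + odd_part L x = x"
  by (simp add: even_part_def odd_part_def scaleR_add_right[symmetric])

lemma half_double: "(1/2::real) *\<^sub>R (x + x) = (x :: 'a::real_vector)"
  by (simp add: scaleR_2[symmetric])

lemma fix_and_neg_imp_zero: "f x = x \<Longrightarrow> f x = - x \<Longrightarrow> x = (0 :: 'a::real_vector)"
  by (metis eq_neg_iff_add_eq_0 half_double scaleR_zero_right)

context complex_lie_algebra begin

context
  fixes \<kappa> assumes k: "real_involution L \<kappa>"
begin

text \<open>An arbitrary real involution is kept here because the results are applied both to
  \<open>kappa L\<close>, whose form is definite, and to \<open>rho L\<close>, which defines the
  real form \<open>real_g L\<close>.\<close>

lemma real_involution_add: "\<kappa> (x + y) = \<kappa> x + \<kappa> y"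
  and real_involution_smult: "\<kappa> (c *s x) = cnj c *s \<kappa> x"
  and real_involution_br: "\<kappa> (br L x y) = br L (\<kappa> x) (\<kappa> y)"
  and real_involution_involution: "\<kappa> (\<kappa> x) = x"
  using k unfolding real_involution_def by (auto simp: fun_eq_iff)

lemma linear_real_involution: "linear \<kappa>"
  by (rule linearI) (simp_all add: real_involution_add real_involution_smult scaleR_eq_smult)

text \<open>The explicit formulas for \<open>a\<close> and \<open>b\<close> belong to the conclusion
  because \<open>in_complexify\<close> must know that both are complex combinations of x and its
  image.\<close>

lemma real_involution_decomposition:
  obtains a b where "x = a + \<i> *s b" "\<kappa> a = a" "\<kappa> b = b" "a = (1/2) *\<^sub>R (x + \<kappa> x)" "b = (-\<i>/2) *s (x - \<kappa> x)"
proof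
  have "\<i> * (- \<i> / 2) = 1/2" by simp
  then have "\<i> *s ((-\<i>/2) *s (x - \<kappa> x)) = (1/2) *\<^sub>R (x - \<kappa> x)"
    by (simp only: vector_smult_assoc scaleR_eq_smult) simp
  then show "x = (1/2) *\<^sub>R (x + \<kappa> x) + \<i> *s ((-\<i>/2) *s (x - \<kappa> x))"
    by (simp add: scaleR_add_right[symmetric] half_double)
  show "\<kappa> ((1/2) *\<^sub>R (x + \<kappa> x)) = (1/2) *\<^sub>R (x + \<kappa> x)"
    by (simp add: linear_scale[OF linear_real_involution] real_involution_add real_involution_involution add.commute)
  have n: "\<kappa> (x - \<kappa> x) = - (x - \<kappa> x)"
    by (simp add: linear_diff[OF linear_real_involution] real_involution_involution)
  show "\<kappa> ((-\<i>/2) *s (x - \<kappa> x)) = (-\<i>/2) *s (x - \<kappa> x)"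
    unfolding real_involution_smult n by (simp add: vec_eq_iff algebra_simps)
qed auto

text \<open>Pairing x = a + i b with a - i b gives killing(a, a) + killing(b, b), a sum of two terms
  with nonpositive real part that vanishes only for a = b = 0.\<close>

lemma killing_nondegenerateI:
  assumes neg: "\<And>x. \<kappa> x = x \<Longrightarrow> x \<noteq> 0 \<Longrightarrow> Re (killing L x x) < 0"
    and z: "\<And>y. killing L x y = 0"
  shows "x = 0"
proof -
  obtain a b where x: "x = a + \<i> *s b" and a: "\<kappa> a = a" and b: "\<kappa> b = b"
    using real_involution_decomposition by metis
  have "killing L x (a - \<i> *s b) = killing L a a + killing L b b"
    by (simp add: x killing_add killing_diff killing_smult killing_sym[of b a] algebra_simps)
  then have "Re (killing L a a) + Re (killing L b b) = 0" using z by (metis plus_complex.sel(1) zero_complex.sel(1))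
  moreover have "Re (killing L c c) \<le> 0" if "\<kappa> c = c" for c
    using neg[OF that] z[of 0] killing_smult(1)[of 0 0 0] by (cases "c = 0") auto
  ultimately have "a = 0" "b = 0" using neg a b by (smt (verit))+
  then show ?thesis by (simp add: x)
qed

end

end

locale toda =
  fixes L :: "'n::finite toda_algebra"
  assumes data: "toda_data L"
begin

lemma kappa_real_involution: "real_involution L (kappa L)"
  and sigma_lie_aut: "lie_aut (br L) (sigma L)"
  and tau_lie_aut: "lie_aut (br L) (tau L)"
  and compact_negative: "\<And>x. kappa L x = x \<Longrightarrow> x \<noteq> 0 \<Longrightarrow> Re (killing L x x) < 0"
  using data unfolding toda_data_def compact_form_def by auto

lemma lie_bracket: "lie_bracket (br L)"
  using data unfolding toda_data_def simple_lie_def by blast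

sublocale killing_lie_algebra L
proof -
  interpret complex_lie_algebra L by unfold_locales (rule lie_bracket)
  show "killing_lie_algebra L"
    by unfold_locales (rule killing_nondegenerateI[OF kappa_real_involution compact_negative])
qed

lemma sigma_add: "sigma L (x + y) = sigma L x + sigma L y"
  and sigma_smult: "sigma L (c *s x) = c *s sigma L x"
  and sigma_br: "sigma L (br L x y) = br L (sigma L x) (sigma L y)"
  using sigma_lie_aut unfolding lie_aut_def linear_vec_iff by auto

lemma sigma_sigma: "sigma L (sigma L x) = x"
  and sigma_kappa: "sigma L (kappa L x) = kappa L (sigma L x)"
  and sigma_tC: "h \<in> tC L \<Longrightarrow> sigma L h = h"
  and tau_tC: "h \<in> tC L \<Longrightarrow> tau L h = h"
  using data unfolding toda_data_def by (auto simp: fun_eq_iff)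

lemma linear_sigma: "linear (sigma L)"
  by (rule linearI) (simp_all add: sigma_add sigma_smult scaleR_eq_smult)

lemma linear_lie_aut: "lie_aut (br L) f \<Longrightarrow> linear f"
  unfolding lie_aut_def linear_vec_iff by (auto intro!: linearI simp: scaleR_eq_smult)

lemma sigma_rho: "sigma L (rho L x) = rho L (sigma L x)"
  by (simp add: rho_def sigma_kappa)

lemma rho_real_involution: "real_involution L (rho L)"
  using sigma_sigma
  by (simp add: real_involution_def rho_def fun_eq_iff sigma_kappa sigma_add sigma_smult sigma_br
      real_involution_add[OF kappa_real_involution] real_involution_smult[OF kappa_real_involution]
      real_involution_br[OF kappa_real_involution] real_involution_involution[OF kappa_real_involution])

lemmas rho_add = real_involution_add[OF rho_real_involution]
  and rho_smult = real_involution_smult[OF rho_real_involution]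
  and rho_br = real_involution_br[OF rho_real_involution]
  and rho_rho = real_involution_involution[OF rho_real_involution]
  and linear_rho = linear_real_involution[OF rho_real_involution]

lemma subspace_fixed: "linear f \<Longrightarrow> subspace {x. f x = x}"
  by (auto simp: subspace_def linear_0 linear_add linear_scale)

lemma subspace_negated: "linear f \<Longrightarrow> subspace {x. f x = - x}"
  by (auto simp: subspace_def linear_0 linear_add linear_scale)

lemma subspace_real_g: "subspace (real_g L)"
  unfolding real_g_def by (rule subspace_fixed[OF linear_rho])

lemma subspace_real_h: "subspace (real_h L)"
  unfolding real_h_def using subspace_inter[OF subspace_real_g subspace_fixed[OF linear_sigma]]
  by (simp add: Int_def)

lemma subspace_real_m: "subspace (real_m L)"
  unfolding real_m_def using subspace_inter[OF subspace_real_g subspace_negated[OF linear_sigma]]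
  by (simp add: Int_def)

lemma real_hm_trivial: "real_h L \<inter> real_m L \<subseteq> {0}"
  unfolding real_h_def real_m_def using fix_and_neg_imp_zero by blast

text \<open>Where \<rho> = \<sigma>\<kappa> and \<sigma> are both trivial, so is \<kappa>. In this
  way the negative definiteness of the compact form becomes available on \<open>real_h L\<close> and
  \<open>real_t L\<close>.\<close>

lemma real_h_compact: "x \<in> real_h L \<Longrightarrow> kappa L x = x"
  unfolding real_h_def real_g_def rho_def by (auto simp: sigma_kappa)

lemma real_t_iff: "x \<in> real_t L \<longleftrightarrow> x \<in> tC L \<and> rho L x = x"
  unfolding real_t_def compact_form_def rho_def by (auto simp: sigma_kappa sigma_tC)

lemma real_t_subset_real_h: "real_t L \<subseteq> real_h L"
  unfolding real_h_def real_g_def by (auto simp: real_t_iff sigma_tC)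

lemma real_h_subset_real_g: "real_h L \<subseteq> real_g L"
  and real_m_subset_real_g: "real_m L \<subseteq> real_g L"
  unfolding real_h_def real_m_def by auto

lemma sigma_even_part: "sigma L (even_part L x) = even_part L x"
  and sigma_odd_part: "sigma L (odd_part L x) = - odd_part L x"
  unfolding even_part_def odd_part_def
  by (simp_all add: linear_scale[OF linear_sigma] sigma_add linear_diff[OF linear_sigma] sigma_sigma
      add.commute scaleR_minus_right[symmetric] del: scaleR_minus_right)

lemma even_part_fixed: "sigma L x = x \<Longrightarrow> even_part L x = x"
  and odd_part_fixed: "sigma L x = x \<Longrightarrow> odd_part L x = 0"
  by (simp_all add: even_part_def odd_part_def half_double)

lemma rho_even_part: "rho L (even_part L x) = even_part L (rho L x)"
  and rho_odd_part: "rho L (odd_part L x) = odd_part L (rho L x)"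
  unfolding even_part_def odd_part_def
  by (simp_all add: linear_scale[OF linear_rho] rho_add linear_diff[OF linear_rho] sigma_rho)

lemma even_part_add: "even_part L (x + y) = even_part L x + even_part L y"
  and odd_part_add: "odd_part L (x + y) = odd_part L x + odd_part L y"
  and even_part_smult: "even_part L (c *s x) = c *s even_part L x"
  and odd_part_smult: "odd_part L (c *s x) = c *s odd_part L x"
  unfolding even_part_def odd_part_def
  by (simp_all add: sigma_add sigma_smult scaleR_eq_smult vec_eq_iff algebra_simps)

lemma component_real_h: "\<omega> \<in> real_g L \<Longrightarrow> component (real_h L) (real_m L) \<omega> = even_part L \<omega>"
  and component_real_m: "\<omega> \<in> real_g L \<Longrightarrow> component (real_m L) (real_h L) \<omega> = odd_part L \<omega>"
proof -
  assume w: "\<omega> \<in> real_g L"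
  have e: "even_part L \<omega> \<in> real_h L" and o: "odd_part L \<omega> \<in> real_m L"
    using w by (auto simp: real_h_def real_m_def real_g_def sigma_even_part sigma_odd_part rho_even_part rho_odd_part)
  have "\<omega> - even_part L \<omega> = odd_part L \<omega>" "\<omega> - odd_part L \<omega> = even_part L \<omega>"
    using even_part_add_odd_part[of L \<omega>] by (simp_all add: algebra_simps)
  then show "component (real_h L) (real_m L) \<omega> = even_part L \<omega>"
       "component (real_m L) (real_h L) \<omega> = odd_part L \<omega>"
    using e o real_hm_trivial subspace_real_h subspace_real_m
    by (auto intro!: component_eqI)
qed

text \<open>Replaces sums a + i b by a condition on one vector. A condition that is complex linear
  and stable under \<rho> passes from x to its real and imaginary parts.\<close>

lemma in_complexify:
  assumes "\<And>a. rho L a = a \<Longrightarrow> P a \<longleftrightarrow> a \<in> S" "S \<subseteq> real_g L"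
    and "\<And>x y. P x \<Longrightarrow> P y \<Longrightarrow> P (x + y)" "\<And>c x. P x \<Longrightarrow> P (c *s x)" "\<And>x. P x \<Longrightarrow> P (rho L x)"
  shows "x \<in> complexify S \<longleftrightarrow> P x"
proof
  assume "x \<in> complexify S"
  then obtain a b where ab: "x = a + \<i> *s b" "a \<in> S" "b \<in> S" unfolding complexify_def by blast
  then have "P a" "P b" using assms(1,2) by (auto simp: real_g_def)
  then show "P x" using assms(3,4) ab by blast
next
  assume P: "P x"
  obtain a b where ab: "x = a + \<i> *s b" "rho L a = a" "rho L b = b"
      "a = (1/2) *\<^sub>R (x + rho L x)" "b = (-\<i>/2) *s (x - rho L x)"
    by (rule real_involution_decomposition[OF rho_real_involution, of x])
  have d: "x - rho L x = x + (-1) *s rho L x" by (simp add: vec_eq_iff)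
  have "P a" "P b" unfolding ab(4,5) scaleR_eq_smult d by (intro assms(3-5) P)+
  then have "a \<in> S" "b \<in> S" using assms(1)[OF ab(2)] assms(1)[OF ab(3)] by simp_all
  then show "x \<in> complexify S" unfolding complexify_def using ab(1) by blast
qed

lemma hC_iff: "x \<in> hC L \<longleftrightarrow> sigma L x = x"
  unfolding hC_def by (rule in_complexify)
    (auto simp: real_h_def real_g_def sigma_add sigma_smult sigma_rho)

lemma mC_iff: "x \<in> mC L \<longleftrightarrow> sigma L x = - x"
  unfolding mC_def by (rule in_complexify)
    (auto simp: real_m_def real_g_def sigma_add sigma_smult sigma_rho linear_neg[OF linear_rho])

lemma killing_real: "x \<in> real_g L \<Longrightarrow> y \<in> real_g L \<Longrightarrow> killing L x y = of_real (Re (killing L x y))"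
  using killing_real_involution[OF rho_real_involution, of x y] unfolding real_g_def
  by (simp add: complex_eq_iff)

text \<open>The \<rho>-stability required by \<open>in_complexify\<close> holds because \<rho>
  conjugates the Killing form and fixes each \<eta>.\<close>

lemma pC_iff: "x \<in> pC L \<longleftrightarrow> (\<forall>\<eta>\<in>real_t L. killing L x \<eta> = 0)"
  unfolding pC_def
proof (rule in_complexify)
  fix x assume *: "\<forall>\<eta>\<in>real_t L. killing L x \<eta> = 0"
  show "\<forall>\<eta>\<in>real_t L. killing L (rho L x) \<eta> = 0"
  proof
    fix \<eta> assume "\<eta> \<in> real_t L"
    then show "killing L (rho L x) \<eta> = 0"
      using killing_real_involution[OF rho_real_involution, of x \<eta>] * by (simp add: real_t_iff)
  qed
qed (auto simp: real_p_def real_g_def killing_add killing_smult)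

section \<open>The grading by \<tau> and the components of elements of \<open>g1\<close>\<close>

text \<open>In positive rank the marks of the nodes 0 and 1 already add up to 2. In rank 0 the
  Cartan subalgebra is zero; for n = 1 it would be self-normalising in the whole algebra, which
  forces the algebra to vanish, so n is at least 2. The bound is what separates the eigenvalue of
  \<tau> on \<open>g1 L\<close> from 1.\<close>

lemma coxeter_number_ge_2: "coxeter_number L \<ge> 2"
proof -
  have m0: "mark L 0 = 1" and mj: "\<And>j. j \<in> {1..rk L} \<Longrightarrow> mark L j > 0"
    and nu: "nuord L \<in> {1,2,3}" and ord: "has_order (nu L) (nuord L)"
    and cart: "cartan_subalgebra (br L) (nu_eigenspace L 0) (tC L)"
    and dim: "vec.dim (tC L) = rk L" and nonab: "\<exists>x y. br L x y \<noteq> 0"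
    using data unfolding toda_data_def simple_lie_def diagram_automorphism_def simple_roots_def Let_def by auto
  show ?thesis
  proof (cases "rk L = 0")
    case False
    have "(\<Sum>j\<in>{0,1}. mark L j) \<le> (\<Sum>j\<le>rk L. mark L j)"
      using False by (intro sum_mono2) auto
    then have "(\<Sum>j\<le>rk L. mark L j) \<ge> 2" using m0 mj[of 1] False by simp
    then show ?thesis unfolding coxeter_number_def using nu by auto
  next
    case True
    have "nuord L \<noteq> 1"
    proof
      assume n1: "nuord L = 1"
      then have "nu L = id" using ord by (simp add: has_order_def)
      then have U: "nu_eigenspace L 0 = UNIV" by (simp add: nu_eigenspace_def)
      have t: "tC L \<subseteq> {0}" using dim True by simp
      have "0 \<in> tC L"
        using cart unfolding cartan_subalgebra_def subalgebra_def by (auto intro: vec.subspace_0)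
      then have "x \<in> tC L" for x
        using cart t unfolding cartan_subalgebra_def U by (metis UNIV_I br.zero_right singletonD subsetD)
      then have "x = 0" for x using t by blast
      then show False using nonab by (metis br.zero_left)
    qed
    then show ?thesis unfolding coxeter_number_def using True m0 nu by auto
  qed
qed

lemma cis_coxeter_number: "cis (2 * pi / real (coxeter_number L)) \<noteq> 1"
proof
  assume e: "cis (2 * pi / real (coxeter_number L)) = 1"
  let ?m = "real (coxeter_number L)"
  have m: "?m \<ge> 2" using coxeter_number_ge_2 by linarith
  have "cos (2 * pi / ?m) = 1" using e by (metis cis.sel(1) one_complex.sel(1))
  then obtain k :: int where "2 * pi / ?m = real_of_int k * 2 * pi" using cos_one_2pi_int by blast
  then have "(2 * pi) * (1 / ?m) = (2 * pi) * real_of_int k" by (simp add: algebra_simps)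
  then have "1 / ?m = real_of_int k" by (subst (asm) mult_cancel_left) simp
  moreover have "0 < 1 / ?m" "1 / ?m < 1" using m by auto
  ultimately have "0 < real_of_int k" "real_of_int k < 1" by auto
  then have "0 < k" "k < 1" by simp_all
  then show False by linarith
qed

text \<open>Applying \<tau> to both arguments leaves the Killing form unchanged, yet multiplies the
  pairing of \<open>g1 L\<close> with the torus by a factor different from 1.\<close>

lemma g1_subset_pC: "g1 L \<subseteq> pC L"
proof
  fix x assume x: "x \<in> g1 L"
  have "killing L x \<eta> = 0" if "\<eta> \<in> real_t L" for \<eta>
  proof -
    have "killing L x \<eta> = killing L (tau L x) (tau L \<eta>)" by (rule killing_lie_aut_fun[OF tau_lie_aut, symmetric])
    also have "\<dots> = cis (2 * pi / real (coxeter_number L)) * killing L x \<eta>"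
      using x that by (simp add: g1_def tau_tC real_t_iff killing_smult)
    finally show ?thesis using cis_coxeter_number by simp
  qed
  then show "x \<in> pC L" by (simp add: pC_iff)
qed

text \<open>\<sigma> preserves the Killing form and fixes the torus, so the even part of x remains
  orthogonal to the torus and lies in \<open>kC L\<close>. Therefore \<open>phi_k\<close> and
  \<open>phi_m\<close> are governed by \<sigma> alone.\<close>

lemma component_g1:
  assumes "x \<in> g1 L"
  shows "component (kC L) (mC L) x = even_part L x" "component (mC L) (kC L) x = odd_part L x"
proof -
  have p: "killing L x \<eta> = 0" if "\<eta> \<in> real_t L" for \<eta> using assms g1_subset_pC that by (auto simp: pC_iff)
  have "killing L (sigma L x) \<eta> = 0" if "\<eta> \<in> real_t L" for \<eta>
    using killing_lie_aut_fun[OF sigma_lie_aut, of x \<eta>] p[OF that] that by (simp add: real_t_iff sigma_tC)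
  then have e: "even_part L x \<in> kC L"
    using p by (simp add: kC_def hC_iff sigma_even_part pC_iff)
      (simp add: even_part_def killing_add killing_scaleR)
  have o: "odd_part L x \<in> mC L" by (simp add: mC_iff sigma_odd_part)
  have d: "x - even_part L x = odd_part L x" "x - odd_part L x = even_part L x"
    using even_part_add_odd_part[of L x] by (simp_all add: algebra_simps)
  have "subspace {x. \<forall>\<eta>\<in>real_t L. killing L x \<eta> = 0}"
    by (auto simp: subspace_def killing_add killing_scaleR) (metis killing_smult(1) mult_zero_left vec.scale_zero_left)
  then have k: "subspace (kC L)"
    using subspace_inter[OF _ subspace_fixed[OF linear_sigma], of "{x. \<forall>\<eta>\<in>real_t L. killing L x \<eta> = 0}"]
    by (simp add: kC_def Int_def hC_iff pC_iff)
  have m: "subspace (mC L)" using subspace_negated[OF linear_sigma] by (simp add: mC_iff[abs_def, symmetric])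
  have "kC L \<inter> mC L \<subseteq> {0}"
    using fix_and_neg_imp_zero[of "sigma L"] by (auto simp: kC_def hC_iff mC_iff)
  then show "component (kC L) (mC L) x = even_part L x" "component (mC L) (kC L) x = odd_part L x"
    using e o d k m by (auto intro!: component_eqI)
qed

lemma vec_subspace_tC: "vec.subspace (tC L)" and br_tC: "x \<in> tC L \<Longrightarrow> y \<in> tC L \<Longrightarrow> br L x y \<in> tC L"
  and nu_tC: "x \<in> tC L \<Longrightarrow> nu L x = x"
  and tC_normalizer: "nu L x = x \<Longrightarrow> (\<And>y. y \<in> tC L \<Longrightarrow> br L x y \<in> tC L) \<Longrightarrow> x \<in> tC L"
  and nu_lie_aut: "lie_aut (br L) (nu L)"
  using data unfolding toda_data_def cartan_subalgebra_def subalgebra_def nu_eigenspace_def diagram_automorphism_def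
  by auto

lemma subspace_tC: "subspace (tC L)"
  using vec_subspace_tC by (auto simp: subspace_def vec.subspace_def scaleR_eq_smult)

lemma subspace_real_t: "subspace (real_t L)"
  using subspace_inter[OF subspace_tC subspace_fixed[OF linear_rho]]
  by (simp add: Int_def real_t_iff[abs_def, symmetric])

lemma subspace_real_p: "subspace (real_p L)"
  using subspace_real_g unfolding real_p_def subspace_def
  by (auto simp: killing_add killing_scaleR) (metis killing_smult(1) mult_zero_left vec.scale_zero_left)

lemma real_tp_trivial: "real_t L \<inter> real_p L \<subseteq> {0}"
proof
  fix x assume x: "x \<in> real_t L \<inter> real_p L"
  then have "killing L x x = 0" by (auto simp: real_p_def)
  then show "x \<in> {0}"
    using x compact_negative[of x] real_h_compact[of x] real_t_subset_real_h by auto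
qed

text \<open>The Killing form may be indefinite on \<open>real_g L\<close>, but it is negative
  definite on the torus, so the functional killing(\<omega>, _) is represented there by some \<eta>.
  Signs are reversed to obtain a positive form, and passing to real parts loses nothing on
  \<open>real_g L\<close>.\<close>

lemma real_tp_decomposition:
  assumes w: "\<omega> \<in> real_g L"
  obtains \<eta> where "\<eta> \<in> real_t L" "\<omega> - \<eta> \<in> real_p L"
proof -
  have tg: "real_t L \<subseteq> real_g L" using real_t_subset_real_h real_h_subset_real_g by blast
  obtain \<eta> where eta: "\<eta> \<in> real_t L" and *: "\<And>y. y \<in> real_t L \<Longrightarrow> - Re (killing L \<eta> y) = - Re (killing L \<omega> y)"
  proof (rule positive_definite_representation[OF subspace_real_t, of "\<lambda>x y. - Re (killing L x y)" "\<lambda>y. - Re (killing L \<omega> y)"])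
    show "bilinear (\<lambda>x y. - Re (killing L x y))" "linear (\<lambda>y. - Re (killing L \<omega> y))"
      by (auto simp: bilinear_def killing_add killing_scaleR intro!: linearI)
    show "0 < - Re (killing L x x)" if "x \<in> real_t L" "x \<noteq> 0" for x
      using compact_negative[of x] real_h_compact[of x] real_t_subset_real_h that by auto
  qed blast
  have "\<omega> - \<eta> \<in> real_g L" using w eta tg subspace_diff[OF subspace_real_g] by blast
  moreover have "killing L (\<omega> - \<eta>) y = 0" if "y \<in> real_t L" for y
    using killing_real[OF calculation, of y] tg that *[OF that] by (auto simp: killing_diff)
  ultimately show ?thesis using that eta by (auto simp: real_p_def)
qed

lemma component_real_t:
  assumes "\<eta> \<in> real_t L" "\<omega> - \<eta> \<in> real_p L"
  shows "component (real_t L) (real_p L) \<omega> = \<eta>" "component (real_p L) (real_t L) \<omega> = \<omega> - \<eta>"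
  using assms real_tp_trivial subspace_real_t subspace_real_p by (auto intro!: component_eqI)

section \<open>The groups of the construction\<close>

lemma matrix_group_GG: "matrix_group (GG L)" and matrix_group_TT: "matrix_group (TT L)"
  and matrix_group_TC: "matrix_group (TC L)"
  unfolding GG_def TT_def TC_def by (rule matrix_group_analytic_group)+

lemma GG_lie_aut: "GG L \<subseteq> lie_aut_group L" and TC_lie_aut: "TC L \<subseteq> lie_aut_group L"
  unfolding GG_def TC_def by (rule analytic_group_lie_aut)+

lemma GG_rho: "GG L \<subseteq> commuting_group (rho L)"
  unfolding GG_def
  by (intro analytic_group_subset matrix_group_commuting_group mexp_ad_commutes linear_rho rho_br)
     (simp add: real_g_def)

text \<open>An automorphism fixing \<open>h\<close> commutes with \<open>ad L h\<close>, hence with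
  its exponential. Applied to \<sigma>, \<tau> and the diagram automorphism.\<close>

lemma TC_commutes:
  assumes "lie_aut (br L) f" "\<And>h. h \<in> tC L \<Longrightarrow> f h = h"
  shows "TC L \<subseteq> commuting_group f"
  unfolding TC_def
  by (intro analytic_group_subset matrix_group_commuting_group mexp_ad_commutes linear_lie_aut)
     (use assms in \<open>auto simp: lie_aut_def\<close>)

lemma TC_stabilizes_tC: "TC L \<subseteq> stabilizer (tC L)"
  unfolding TC_def
  by (intro analytic_group_subset matrix_group_stabilizer mexp_in_stabilizer subspace_tC) (simp add: ad_mv br_tC)

lemma TT_subset_TC: "TT L \<subseteq> TC L"
  unfolding TT_def
  by (rule analytic_group_subset[OF matrix_group_TC])
     (auto simp: TC_def analytic_group_def real_t_def intro: generator_in_generated_group)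

lemma commuting_groupD: "a \<in> commuting_group f \<Longrightarrow> f (a *v x) = a *v f x"
  by (simp add: commuting_group_def)

lemma TT_real_t:
  assumes b: "b \<in> TT L" and G: "TT L \<subseteq> GG L"
  shows "x \<in> real_t L \<Longrightarrow> b *v x \<in> real_t L"
  using TC_stabilizes_tC TT_subset_TC b GG_rho G commuting_groupD[of b "rho L" x]
  by (auto simp: real_t_iff stabilizer_def subset_iff image_iff)

end

section \<open>The maximal compact subgroup and its action on the Cartan decomposition\<close>

locale toda_compact = toda L for L :: "'n::finite toda_algebra" +
  fixes H :: "'n cmat set"
  assumes maximal: "maximal_compact L H"
begin

lemma matrix_group_H: "matrix_group H" and H_subset_GG: "H \<subseteq> GG L"
  and real_h_exp: "x \<in> real_h L \<longleftrightarrow> x \<in> real_g L \<and> (\<forall>t::real. mexp (ad L (t *\<^sub>R x)) \<in> H)"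
  using maximal unfolding maximal_compact_def by auto

lemma TT_subset_H: "TT L \<subseteq> H"
  unfolding TT_def
proof (rule analytic_group_subset[OF matrix_group_H])
  fix \<xi> assume "\<xi> \<in> real_t L"
  then show "mexp (ad L \<xi>) \<in> H" using real_t_subset_real_h real_h_exp[of \<xi>] by (metis scaleR_one subsetD)
qed

lemma TT_subset_GG: "TT L \<subseteq> GG L" using TT_subset_H H_subset_GG by blast

lemma GG_real_g: "a \<in> GG L \<Longrightarrow> x \<in> real_g L \<Longrightarrow> a *v x \<in> real_g L"
  using GG_rho commuting_groupD[of a "rho L" x] by (auto simp: real_g_def)

text \<open>\<open>H\<close> is not given by generators, only its one-parameter subgroups are known.
  Conjugation by \<open>a\<close> carries the subgroup of x to that of a x and keeps it inside
  \<open>H\<close>.\<close>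

lemma H_real_h:
  assumes a: "a \<in> H" and x: "x \<in> real_h L"
  shows "a *v x \<in> real_h L"
proof -
  have A: "a \<in> lie_aut_group L" using a H_subset_GG GG_lie_aut by blast
  have "mexp (ad L (t *\<^sub>R (a *v x))) = a ** mexp (ad L (t *\<^sub>R x)) ** matrix_inv a" for t :: real
    using mexp_conj[OF lie_aut_group_invertible[OF A], of "ad L (t *\<^sub>R x)"]
    by (simp add: ad_conj[OF A] mv.scaleR_right)
  then have "mexp (ad L (t *\<^sub>R (a *v x))) \<in> H" for t :: real
    using a x real_h_exp matrix_groupD[OF matrix_group_H] by metis
  moreover have "a *v x \<in> real_g L" using GG_real_g a x H_subset_GG real_h_subset_real_g by blast
  ultimately show ?thesis using real_h_exp by blast
qed

text \<open>Let e be the even part of a x. Invariance gives killing(a x, e) = killing(x, a^-1 e),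
  which is zero since a^-1 e lies in \<open>real_h L\<close>; hence killing(e, e) = 0, and e = 0 by
  definiteness on the compact form.\<close>

lemma H_real_m:
  assumes a: "a \<in> H" and x: "x \<in> real_m L"
  shows "a *v x \<in> real_m L"
proof -
  have A: "a \<in> lie_aut_group L" using a H_subset_GG GG_lie_aut by blast
  define y where "y = a *v x"
  have yg: "y \<in> real_g L" unfolding y_def using GG_real_g a x H_subset_GG real_m_subset_real_g by blast
  have orth: "killing L u w = 0" if "sigma L u = - u" "sigma L w = w" for u w
    using killing_lie_aut_fun[OF sigma_lie_aut, of u w] that by (simp add: killing_minus)
  define e where "e = even_part L y"
  have e: "e \<in> real_h L"
    using yg by (simp add: e_def real_h_def real_g_def sigma_even_part rho_even_part)
  have "killing L y e = killing L (a *v x) (a *v (matrix_inv a *v e))"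
    by (simp add: y_def lie_aut_group_invertible[OF A])
  also have "\<dots> = killing L x (matrix_inv a *v e)" by (rule killing_lie_aut[OF A])
  also have "\<dots> = 0"
    using x H_real_h[OF matrix_groupD(3)[OF matrix_group_H a] e]
    by (intro orth) (auto simp: real_m_def real_h_def)
  finally have "killing L (e + odd_part L y) e = 0" by (simp add: e_def even_part_add_odd_part)
  then have "killing L e e = 0" using orth[of "odd_part L y" e] e by (simp add: killing_add sigma_odd_part real_h_def)
  then have "e = 0" using compact_negative[OF real_h_compact[OF e]] by force
  then have "y = odd_part L y" using even_part_add_odd_part[of L y] by (simp add: e_def)
  then have "sigma L y = - y" using sigma_odd_part[of y] by simp
  then show ?thesis using yg by (simp add: y_def real_m_def)
qed

lemma H_sigma: "H \<subseteq> commuting_group (sigma L)"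
proof
  fix a assume a: "a \<in> H"
  have real: "sigma L (a *v x) = a *v sigma L x" if x: "x \<in> real_g L" for x
  proof -
    have "even_part L x \<in> real_h L" "odd_part L x \<in> real_m L"
      using x by (auto simp: real_h_def real_m_def real_g_def sigma_even_part sigma_odd_part rho_even_part rho_odd_part)
    then have "sigma L (a *v even_part L x) = a *v even_part L x" "sigma L (a *v odd_part L x) = - (a *v odd_part L x)"
      using H_real_h[OF a] H_real_m[OF a] by (auto simp: real_h_def real_m_def)
    moreover have "sigma L (a *v (even_part L x + odd_part L x)) = a *v sigma L (even_part L x + odd_part L x)"
      using calculation by (simp add: mv.add_right sigma_add sigma_even_part sigma_odd_part mv.minus_right mv.diff_right)
    ultimately show ?thesis by (simp add: even_part_add_odd_part)
  qed
  have "sigma L (a *v x) = a *v sigma L x" for x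
  proof -
    obtain u w where "x = u + \<i> *s w" "rho L u = u" "rho L w = w"
      using real_involution_decomposition[OF rho_real_involution] by metis
    then show ?thesis using real by (simp add: real_g_def mv.add_right sigma_add sigma_smult vector_scalar_commute)
  qed
  then show "a \<in> commuting_group (sigma L)"
    using matrix_groupD(2)[OF matrix_group_H a] by (simp add: commuting_group_def)
qed

lemma matrix_group_HC: "matrix_group (HC L H)"
  unfolding HC_def using matrix_groupD(2)[OF matrix_group_H] matrix_groupD(2)[OF matrix_group_analytic_group]
  by (intro matrix_group_generated_group) blast

lemma HC_lie_aut: "HC L H \<subseteq> lie_aut_group L"
  unfolding HC_def using H_subset_GG GG_lie_aut analytic_group_lie_aut
  by (intro generated_group_subset matrix_group_lie_aut_group) blast

lemma HC_sigma: "HC L H \<subseteq> commuting_group (sigma L)"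
proof -
  have "analytic_group L (hC L) \<subseteq> commuting_group (sigma L)"
    by (intro analytic_group_subset matrix_group_commuting_group mexp_ad_commutes linear_sigma sigma_br)
       (simp add: hC_iff)
  then show ?thesis
    unfolding HC_def using H_sigma by (intro generated_group_subset matrix_group_commuting_group) blast
qed

lemma H_subset_HC: "H \<subseteq> HC L H"
  unfolding HC_def by (auto intro: generator_in_generated_group)

lemma TC_sigma: "TC L \<subseteq> commuting_group (sigma L)"
  and TC_tau: "TC L \<subseteq> commuting_group (tau L)"
  by (intro TC_commutes sigma_lie_aut tau_lie_aut; simp add: sigma_tC tau_tC)+

lemma mC_invariant: "a \<in> commuting_group (sigma L) \<Longrightarrow> x \<in> mC L \<Longrightarrow> a *v x \<in> mC L"
  by (simp add: mC_iff commuting_groupD mv.minus_right)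

lemma g1_invariant: "a \<in> TC L \<Longrightarrow> x \<in> g1 L \<Longrightarrow> a *v x \<in> g1 L"
  using TC_tau commuting_groupD[of a "tau L" x] by (auto simp: g1_def vector_scalar_commute)

lemma parts_commute:
  assumes "a \<in> commuting_group (sigma L)"
  shows "even_part L (a *v x) = a *v even_part L x" "odd_part L (a *v x) = a *v odd_part L x"
  by (simp_all add: even_part_def odd_part_def commuting_groupD[OF assms] mv.scaleR_right mv.add_right mv.diff_right)

text \<open>The torus group preserves both \<open>real_t L\<close> and the Killing form, hence also
  the complement \<open>real_p L\<close>.\<close>

lemma component_real_t_TT:
  assumes b: "b \<in> TT L" and w: "\<omega> \<in> real_g L"
  shows "component (real_p L) (real_t L) (b *v \<omega>) = b *v component (real_p L) (real_t L) \<omega>"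
proof -
  obtain \<eta> where eta: "\<eta> \<in> real_t L" "\<omega> - \<eta> \<in> real_p L" using real_tp_decomposition[OF w] .
  have bg: "b \<in> GG L" using b TT_subset_GG by blast
  have A: "b \<in> lie_aut_group L" using bg GG_lie_aut by blast
  have "b *v (\<omega> - \<eta>) \<in> real_g L" using GG_real_g[OF bg] eta(2) by (simp add: real_p_def)
  moreover have "killing L (b *v (\<omega> - \<eta>)) y = 0" if "y \<in> real_t L" for y
  proof -
    have "matrix_inv b *v y \<in> real_t L"
      using TT_real_t[OF matrix_groupD(3)[OF matrix_group_TT b] TT_subset_GG that] .
    then have "killing L (\<omega> - \<eta>) (matrix_inv b *v y) = 0" using eta(2) by (simp add: real_p_def)
    then show ?thesis using killing_lie_aut[OF A, of "\<omega> - \<eta>" "matrix_inv b *v y"]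
      by (simp add: lie_aut_group_invertible[OF A])
  qed
  ultimately have "b *v \<omega> - b *v \<eta> \<in> real_p L" by (simp add: real_p_def mv.diff_right)
  then have "component (real_p L) (real_t L) (b *v \<omega>) = b *v \<omega> - b *v \<eta>"
    using component_real_t TT_real_t[OF b TT_subset_GG eta(1)] by blast
  then show ?thesis using component_real_t[OF eta] by (simp add: mv.diff_right)
qed

end

section \<open>Calculus of smooth functions\<close>

lemma Ck_on_SucI:
  assumes "\<And>w. w \<in> S \<Longrightarrow> (f has_derivative (\<lambda>h. Re h *\<^sub>R fx w + Im h *\<^sub>R fy w)) (at w)"
    "Ck_on k S fx" "Ck_on k S fy"
  shows "Ck_on (Suc k) S f"
  unfolding Ck_on.simps using assms by blast

lemma Ck_on_SucE:
  assumes "Ck_on (Suc k) S f"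
  obtains fx fy where
    "\<And>w. w \<in> S \<Longrightarrow> (f has_derivative (\<lambda>h. Re h *\<^sub>R fx w + Im h *\<^sub>R fy w)) (at w)"
    "Ck_on k S fx" "Ck_on k S fy"
  using assms unfolding Ck_on.simps by blast

lemma Ck_on_subset: "Ck_on k S f \<Longrightarrow> T \<subseteq> S \<Longrightarrow> Ck_on k T f"
proof (induction k arbitrary: f)
  case (Suc k)
  from Suc.prems(1) obtain fx fy where
    "\<And>w. w \<in> S \<Longrightarrow> (f has_derivative (\<lambda>h. Re h *\<^sub>R fx w + Im h *\<^sub>R fy w)) (at w)"
    "Ck_on k S fx" "Ck_on k S fy" by (rule Ck_on_SucE) blast
  then show ?case using Suc.IH Suc.prems(2) by (intro Ck_on_SucI[of _ f fx fy]) blast+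
qed (auto intro: continuous_on_subset)

lemma Ck_on_cong:
  assumes "Ck_on k S f" "open S" "\<And>w. w \<in> S \<Longrightarrow> f w = g w"
  shows "Ck_on k S g"
proof (cases k)
  case 0 then show ?thesis using assms continuous_on_cong[of S S f g] by simp
next
  case (Suc l)
  obtain fx fy where
    "\<And>w. w \<in> S \<Longrightarrow> (f has_derivative (\<lambda>h. Re h *\<^sub>R fx w + Im h *\<^sub>R fy w)) (at w)"
    "Ck_on l S fx" "Ck_on l S fy" using assms(1)[unfolded Suc] by (rule Ck_on_SucE) blast
  then show ?thesis using assms(2,3) unfolding Suc
    by (intro Ck_on_SucI[of _ g fx fy]) (blast intro: has_derivative_transform_within_open)+
qed

lemma Ck_on_Suc_imp: "Ck_on (Suc k) S f \<Longrightarrow> Ck_on k S f"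
proof (induction k arbitrary: f)
  case 0
  then show ?case
    by (elim Ck_on_SucE) (auto intro!: continuous_at_imp_continuous_on dest: has_derivative_continuous)
next
  case (Suc k)
  from Suc.prems obtain fx fy where
    "\<And>w. w \<in> S \<Longrightarrow> (f has_derivative (\<lambda>h. Re h *\<^sub>R fx w + Im h *\<^sub>R fy w)) (at w)"
    "Ck_on (Suc k) S fx" "Ck_on (Suc k) S fy" by (rule Ck_on_SucE) blast
  then show ?case using Suc.IH by (intro Ck_on_SucI[of _ f fx fy]) blast+
qed

text \<open>The partial derivatives in \<open>Ck_on\<close> are existential and could vary with the
  neighbourhood. The values of the Frechet derivative on 1 and i are a choice valid on all of
  \<open>S\<close>, with which each local choice agrees.\<close>

lemma Ck_on_local:
  assumes S: "open S" and loc: "\<And>w. w \<in> S \<Longrightarrow> \<exists>T. open T \<and> w \<in> T \<and> Ck_on k (T \<inter> S) f"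
  shows "Ck_on k S f"
  using loc
proof (induction k arbitrary: f)
  case 0
  have "continuous (at w) f" if w: "w \<in> S" for w
  proof -
    obtain T where "open T" "w \<in> T" "continuous_on (T \<inter> S) f"
      using 0[OF w] unfolding Ck_on.simps by blast
    then show ?thesis using S w by (meson IntI continuous_on_eq_continuous_at open_Int)
  qed
  then show ?case by (simp add: continuous_at_imp_continuous_on)
next
  case (Suc k)
  define fx where "fx w = frechet_derivative f (at w) 1" for w
  define fy where "fy w = frechet_derivative f (at w) \<i>" for w
  have *: "\<exists>T. open T \<and> w \<in> T \<and> (\<forall>u\<in>T \<inter> S. (f has_derivative (\<lambda>h. Re h *\<^sub>R fx u + Im h *\<^sub>R fy u)) (at u)) \<and>
      Ck_on k (T \<inter> S) fx \<and> Ck_on k (T \<inter> S) fy" if w: "w \<in> S" for w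
  proof -
    obtain T gx gy where T: "open T" "w \<in> T"
      and d: "\<And>u. u \<in> T \<inter> S \<Longrightarrow> (f has_derivative (\<lambda>h. Re h *\<^sub>R gx u + Im h *\<^sub>R gy u)) (at u)"
      and g: "Ck_on k (T \<inter> S) gx" "Ck_on k (T \<inter> S) gy"
      using Suc.prems[OF w] by (elim exE conjE Ck_on_SucE) blast
    have e: "gx u = fx u" "gy u = fy u" if "u \<in> T \<inter> S" for u
      unfolding fx_def fy_def frechet_derivative_at[OF d[OF that], symmetric] by simp_all
    have "open (T \<inter> S)" using T S by auto
    then have "Ck_on k (T \<inter> S) fx" "Ck_on k (T \<inter> S) fy"
      using Ck_on_cong[OF g(1)] Ck_on_cong[OF g(2)] e by auto
    then show ?thesis using T d e by (intro exI[of _ T]) auto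
  qed
  have "Ck_on k S fx" by (rule Suc.IH) (use * in blast)
  moreover have "Ck_on k S fy" by (rule Suc.IH) (use * in blast)
  moreover have "(f has_derivative (\<lambda>h. Re h *\<^sub>R fx w + Im h *\<^sub>R fy w)) (at w)" if "w \<in> S" for w
    using *[OF that] that by blast
  ultimately show ?case by (intro Ck_on_SucI[of _ f fx fy]) blast+
qed

lemma Ck_on_const: "Ck_on k S (\<lambda>_. c)"
proof (induction k arbitrary: c)
  case (Suc k)
  then show ?case by (auto intro!: exI[of _ "\<lambda>_. 0"] derivative_eq_intros)
qed auto

lemma Ck_on_add: "Ck_on k S f \<Longrightarrow> Ck_on k S g \<Longrightarrow> Ck_on k S (\<lambda>w. f w + g w)"
proof (induction k arbitrary: f g)
  case (Suc k)
  obtain fx fy where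
    f: "\<And>w. w \<in> S \<Longrightarrow> (f has_derivative (\<lambda>h. Re h *\<^sub>R fx w + Im h *\<^sub>R fy w)) (at w)"
      "Ck_on k S fx" "Ck_on k S fy" using Suc.prems(1) by (rule Ck_on_SucE) blast
  obtain gx gy where
    g: "\<And>w. w \<in> S \<Longrightarrow> (g has_derivative (\<lambda>h. Re h *\<^sub>R gx w + Im h *\<^sub>R gy w)) (at w)"
      "Ck_on k S gx" "Ck_on k S gy" using Suc.prems(2) by (rule Ck_on_SucE) blast
  have "((\<lambda>w. f w + g w) has_derivative (\<lambda>h. Re h *\<^sub>R (fx w + gx w) + Im h *\<^sub>R (fy w + gy w))) (at w)" if "w \<in> S" for w
    using has_derivative_add[OF f(1)[OF that] g(1)[OF that]] by (simp add: algebra_simps)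
  moreover have "Ck_on k S (\<lambda>w. fx w + gx w)" "Ck_on k S (\<lambda>w. fy w + gy w)" using Suc.IH f g by auto
  ultimately show ?case by (intro Ck_on_SucI[of _ _ "\<lambda>w. fx w + gx w" "\<lambda>w. fy w + gy w"]) blast+
qed (auto intro: continuous_on_add)

lemma Ck_on_bounded_linear:
  assumes T: "bounded_linear T"
  shows "Ck_on k S f \<Longrightarrow> Ck_on k S (\<lambda>w. T (f w))"
proof (induction k arbitrary: f)
  case 0 then show ?case using bounded_linear.continuous_on[OF T] by simp
next
  case (Suc k)
  interpret T: bounded_linear T by (rule T)
  obtain fx fy where
    f: "\<And>w. w \<in> S \<Longrightarrow> (f has_derivative (\<lambda>h. Re h *\<^sub>R fx w + Im h *\<^sub>R fy w)) (at w)"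
      "Ck_on k S fx" "Ck_on k S fy" using Suc.prems(1) by (rule Ck_on_SucE) blast
  have "((\<lambda>w. T (f w)) has_derivative (\<lambda>h. Re h *\<^sub>R T (fx w) + Im h *\<^sub>R T (fy w))) (at w)" if "w \<in> S" for w
    using T.has_derivative[OF f(1)[OF that]] by (simp add: T.add T.scaleR)
  then show ?case using Suc.IH f
    by (intro Ck_on_SucI[of _ _ "\<lambda>w. T (fx w)" "\<lambda>w. T (fy w)"]) blast+
qed

lemma Ck_on_bounded_bilinear:
  assumes B: "bounded_bilinear B"
  shows "Ck_on k S f \<Longrightarrow> Ck_on k S g \<Longrightarrow> Ck_on k S (\<lambda>w. B (f w) (g w))"
proof (induction k arbitrary: f g)
  case 0 then show ?case using bounded_bilinear.continuous_on[OF B] by simp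
next
  case (Suc k)
  interpret B: bounded_bilinear B by (rule B)
  obtain fx fy where
    f: "\<And>w. w \<in> S \<Longrightarrow> (f has_derivative (\<lambda>h. Re h *\<^sub>R fx w + Im h *\<^sub>R fy w)) (at w)"
      "Ck_on k S fx" "Ck_on k S fy" using Suc.prems(1) by (rule Ck_on_SucE) blast
  obtain gx gy where
    g: "\<And>w. w \<in> S \<Longrightarrow> (g has_derivative (\<lambda>h. Re h *\<^sub>R gx w + Im h *\<^sub>R gy w)) (at w)"
      "Ck_on k S gx" "Ck_on k S gy" using Suc.prems(2) by (rule Ck_on_SucE) blast
  let ?x = "\<lambda>w. B (f w) (gx w) + B (fx w) (g w)" and ?y = "\<lambda>w. B (f w) (gy w) + B (fy w) (g w)"
  have "((\<lambda>w. B (f w) (g w)) has_derivative (\<lambda>h. Re h *\<^sub>R ?x w + Im h *\<^sub>R ?y w)) (at w)" if "w \<in> S" for w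
    using B.FDERIV[OF f(1)[OF that] g(1)[OF that]]
    by (simp add: B.add_left B.add_right B.scaleR_left B.scaleR_right algebra_simps)
  \<comment> \<open>The product rule involves the undifferentiated factors, which are needed at one
    order less than assumed.\<close>
  moreover have "Ck_on k S f" "Ck_on k S g" using Suc.prems Ck_on_Suc_imp by blast+
  then have "Ck_on k S ?x" "Ck_on k S ?y" using f g Suc.IH by (auto intro!: Ck_on_add)
  ultimately show ?case by (intro Ck_on_SucI[of _ _ ?x ?y]) blast+
qed

lemma chart_union_lift: "(W, z) \<in> lift_atlas A p \<longleftrightarrow>
    (\<exists>z' V. z = z' \<circ> p \<and> open W \<and> inj_on p W \<and> (V, z') \<in> A \<and> p ` W \<subseteq> V)"
  unfolding lift_atlas_def by auto

locale surface =
  fixes A :: "'s::t2_space atlas"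
  assumes surface: "riemann_surface A"
begin

lemma chart_homeomorphism: "(V, z) \<in> A \<Longrightarrow> homeomorphism V (z ` V) z (inv_into V z)"
  and open_chart: "(V, z) \<in> A \<Longrightarrow> open V" and open_chart_image: "(V, z) \<in> A \<Longrightarrow> open (z ` V)"
  using surface unfolding riemann_surface_def by auto

lemma chart_inj: "(V, z) \<in> A \<Longrightarrow> inj_on z V"
  using chart_homeomorphism unfolding homeomorphism_def by (metis inj_onI)

lemma inv_chart [simp]: "(V, z) \<in> A \<Longrightarrow> x \<in> V \<Longrightarrow> inv_into V z (z x) = x"
  using chart_inj inv_into_f_f by metis

lemma open_chart_image_Int:
  assumes c: "(V, z) \<in> A" and U: "open U"
  shows "open (z ` (U \<inter> V))"
proof -
  have "openin (top_of_set (z ` V)) (z ` (U \<inter> V))"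
    using chart_homeomorphism[OF c] open_chart[OF c] U
    by (meson homeomorphism_imp_open_map inf_le2 open_Int open_subset)
  then show ?thesis using open_chart_image[OF c] openin_open_trans by blast
qed

lemma smooth_fun_Ck_on: "smooth_fun A U f \<Longrightarrow> (V, z) \<in> A \<Longrightarrow> Ck_on k (z ` (U \<inter> V)) (f \<circ> inv_into V z)"
  unfolding smooth_fun_def by auto

lemma smooth_fun_subset:
  assumes "smooth_fun A U f" "U' \<subseteq> U"
  shows "smooth_fun A U' f"
  unfolding smooth_fun_def
proof clarify
  fix V z k assume "(V, z) \<in> A"
  then show "Ck_on k (z ` (U' \<inter> V)) (f \<circ> inv_into V z)"
    using assms by (intro Ck_on_subset[OF smooth_fun_Ck_on[OF assms(1)]]) auto
qed

lemma smooth_fun_cong: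
  assumes "smooth_fun A U f" "open U" "\<And>x. x \<in> U \<Longrightarrow> f x = g x"
  shows "smooth_fun A U g"
  unfolding smooth_fun_def
proof clarify
  fix V z k assume c: "(V, z) \<in> A"
  show "Ck_on k (z ` (U \<inter> V)) (g \<circ> inv_into V z)"
    by (rule Ck_on_cong[OF smooth_fun_Ck_on[OF assms(1) c] open_chart_image_Int[OF c assms(2)]])
       (use c assms in auto)
qed

lemma smooth_fun_local:
  assumes "open U" "\<And>x. x \<in> U \<Longrightarrow> \<exists>W. open W \<and> x \<in> W \<and> smooth_fun A (W \<inter> U) f"
  shows "smooth_fun A U f"
  unfolding smooth_fun_def
proof clarify
  fix V z k assume c: "(V, z) \<in> A"
  show "Ck_on k (z ` (U \<inter> V)) (f \<circ> inv_into V z)"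
  proof (rule Ck_on_local[OF open_chart_image_Int[OF c assms(1)]])
    fix w assume "w \<in> z ` (U \<inter> V)"
    then obtain x where x: "x \<in> U" "x \<in> V" "w = z x" by auto
    obtain W where W: "open W" "x \<in> W" "smooth_fun A (W \<inter> U) f" using assms(2) x by blast
    have "z ` ((W \<inter> U) \<inter> V) = z ` ((W \<inter> U) \<inter> V) \<inter> z ` (U \<inter> V)" by auto
    then show "\<exists>T. open T \<and> w \<in> T \<and> Ck_on k (T \<inter> z ` (U \<inter> V)) (f \<circ> inv_into V z)"
      using W x smooth_fun_Ck_on[OF W(3) c] open_chart_image_Int[OF c, of "W \<inter> U"] assms(1)
      by (intro exI[of _ "z ` ((W \<inter> U) \<inter> V)"]) auto
  qed
qed

lemma smooth_fun_const: "smooth_fun A U (\<lambda>_. c)"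
  unfolding smooth_fun_def using Ck_on_const by (auto simp: o_def)

lemma smooth_fun_bounded_linear: "bounded_linear T \<Longrightarrow> smooth_fun A U f \<Longrightarrow> smooth_fun A U (\<lambda>x. T (f x))"
  unfolding smooth_fun_def using Ck_on_bounded_linear by (fastforce simp: o_def)

lemma smooth_fun_bounded_bilinear:
  "bounded_bilinear B \<Longrightarrow> smooth_fun A U f \<Longrightarrow> smooth_fun A U g \<Longrightarrow> smooth_fun A U (\<lambda>x. B (f x) (g x))"
  unfolding smooth_fun_def using Ck_on_bounded_bilinear by (fastforce simp: o_def)

section \<open>Derivatives in charts\<close>

definition chart_differentiable :: "'s chart \<Rightarrow> ('s \<Rightarrow> 'b::real_normed_vector) \<Rightarrow> 's \<Rightarrow> bool" where
  "chart_differentiable c f x \<longleftrightarrow> (f \<circ> inv_into (fst c) (snd c)) differentiable (at (snd c x))"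

lemma smooth_fun_chart_differentiable:
  assumes "smooth_fun A U f" "c \<in> A" "x \<in> U \<inter> fst c"
  shows "chart_differentiable c f x"
proof -
  obtain V z where c: "c = (V, z)" by (cases c)
  have "Ck_on 1 (z ` (U \<inter> V)) (f \<circ> inv_into V z)" using smooth_fun_Ck_on assms c by metis
  moreover have "z x \<in> z ` (U \<inter> V)" using assms(3) c by auto
  ultimately show ?thesis
    unfolding chart_differentiable_def differentiable_def c by fastforce
qed

lemma chart_differentiable_has_derivative:
  "chart_differentiable c f x \<Longrightarrow>
    ((f \<circ> inv_into (fst c) (snd c)) has_derivative dchart c f x) (at (snd c x))"
  unfolding chart_differentiable_def dchart_def[abs_def] using frechet_derivative_works by blast

lemma has_derivative_dchart:
  "((f \<circ> inv_into (fst c) (snd c)) has_derivative D) (at (snd c x)) \<Longrightarrow> dchart c f x = D"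
  unfolding dchart_def[abs_def] using frechet_derivative_at by metis

lemma has_derivative_cong_open:
  assumes "c \<in> A" "open W" "x \<in> W" "x \<in> fst c" "\<And>y. y \<in> W \<Longrightarrow> f y = g y"
  shows "((f \<circ> inv_into (fst c) (snd c)) has_derivative D) (at (snd c x)) \<longleftrightarrow>
         ((g \<circ> inv_into (fst c) (snd c)) has_derivative D) (at (snd c x))"
proof -
  obtain V z where c: "c = (V, z)" by (cases c)
  have o: "open (z ` (W \<inter> V))" "z x \<in> z ` (W \<inter> V)"
    using open_chart_image_Int assms c by auto
  have e: "(f \<circ> inv_into V z) y = (g \<circ> inv_into V z) y" if "y \<in> z ` (W \<inter> V)" for y
    using that assms c by auto
  show ?thesis using has_derivative_transform_within_open[OF _ o] e unfolding c by (metis fst_conv snd_conv)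
qed

lemma dchart_cong_open:
  assumes "c \<in> A" "open W" "x \<in> W" "x \<in> fst c" "\<And>y. y \<in> W \<Longrightarrow> f y = g y"
  shows "dchart c f x v = dchart c g x v"
proof -
  \<comment> \<open>\<open>frechet_derivative\<close> chooses among all derivatives. As the two sets
    of derivatives coincide, the chosen values agree without any differentiability
    assumption.\<close>
  have "(\<lambda>D. ((f \<circ> inv_into (fst c) (snd c)) has_derivative D) (at (snd c x))) =
        (\<lambda>D. ((g \<circ> inv_into (fst c) (snd c)) has_derivative D) (at (snd c x)))"
    by (intro ext has_derivative_cong_open[OF assms])
  then show ?thesis unfolding dchart_def frechet_derivative_def by simp
qed

lemma dchart_const: "dchart c (\<lambda>_. k) x v = 0"
proof -
  have "dchart c (\<lambda>_. k) x = (\<lambda>_. 0)" by (rule has_derivative_dchart) (simp add: o_def)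
  then show ?thesis by simp
qed

lemma dchart_bounded_linear:
  assumes "bounded_linear T" "chart_differentiable c f x"
  shows "dchart c (\<lambda>y. T (f y)) x v = T (dchart c f x v)"
proof -
  have "dchart c (\<lambda>y. T (f y)) x = (\<lambda>v. T (dchart c f x v))"
    using bounded_linear.has_derivative[OF assms(1) chart_differentiable_has_derivative[OF assms(2)]]
    by (intro has_derivative_dchart) (simp add: o_def)
  then show ?thesis by simp
qed

lemma dchart_bounded_bilinear:
  assumes "bounded_bilinear B" "chart_differentiable c f x" "chart_differentiable c g x" "c \<in> A" "x \<in> fst c"
  shows "dchart c (\<lambda>y. B (f y) (g y)) x v = B (f x) (dchart c g x v) + B (dchart c f x v) (g x)"
proof -
  have "inv_into (fst c) (snd c) (snd c x) = x" using inv_chart[of "fst c" "snd c" x] assms by simp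
  then have "dchart c (\<lambda>y. B (f y) (g y)) x = (\<lambda>v. B (f x) (dchart c g x v) + B (dchart c f x v) (g x))"
    using bounded_bilinear.FDERIV[OF assms(1) chart_differentiable_has_derivative[OF assms(2)]
        chart_differentiable_has_derivative[OF assms(3)]]
    by (intro has_derivative_dchart) (simp add: o_def)
  then show ?thesis by simp
qed

end

section \<open>Smooth functions on the universal cover\<close>

locale covered_surface = surface A for A :: "'s::t2_space atlas" +
  fixes p :: "'c::t2_space \<Rightarrow> 's"
  assumes covering: "covering_space UNIV p UNIV"
begin

definition sheet :: "'c set \<Rightarrow> bool" where "sheet W \<longleftrightarrow> open W \<and> inj_on p W"

lemma continuous_p: "continuous_on UNIV p" and surj_p: "surj p"
  using covering unfolding covering_space_def by auto

lemma open_vimage_p: "open U \<Longrightarrow> open (p -` U)"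
  using continuous_p by (simp add: open_vimage)

lemma local_homeomorphism:
  obtains W T q where "x \<in> W" "open W" "open T" "homeomorphism W T p q"
  using covering_space_local_homeomorphism[OF covering, of x] by (metis UNIV_I open_openin subtopology_UNIV)

lemma sheet_exists: obtains W where "sheet W" "x \<in> W"
proof -
  obtain W T q where "x \<in> W" "open W" "homeomorphism W T p q" using local_homeomorphism[of x] by metis
  then have "sheet W" unfolding sheet_def homeomorphism_def by (metis inj_onI)
  then show ?thesis using that \<open>x \<in> W\<close> by blast
qed

lemma sheet_subset: "sheet W \<Longrightarrow> open W' \<Longrightarrow> W' \<subseteq> W \<Longrightarrow> sheet W'"
  unfolding sheet_def using inj_on_subset by blast

lemma open_image_p:
  assumes "open W"
  shows "open (p ` W)"
proof (subst open_subopen, rule ballI)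
  fix u assume "u \<in> p ` W"
  then obtain x where x: "x \<in> W" "u = p x" by blast
  obtain Y T q where Y: "x \<in> Y" "open Y" "open T" "homeomorphism Y T p q"
    using local_homeomorphism[of x] .
  have "openin (top_of_set T) (p ` (Y \<inter> W))"
    using homeomorphism_imp_open_map[OF Y(4), of "Y \<inter> W"] assms Y(2) by (simp add: open_subset open_Int)
  then have "open (p ` (Y \<inter> W))" using Y(3) openin_open_trans by blast
  then show "\<exists>T. open T \<and> u \<in> T \<and> T \<subseteq> p ` W" using x Y(1) by (intro exI[of _ "p ` (Y \<inter> W)"]) auto
qed

lemma lift_chart: "sheet W \<Longrightarrow> (V, z) \<in> A \<Longrightarrow> p ` W \<subseteq> V \<Longrightarrow> (W, z \<circ> p) \<in> lift_atlas A p"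
  unfolding sheet_def chart_union_lift by blast

lemma inv_lift_chart:
  assumes "inj_on p W" "(V, z) \<in> A" "p ` W \<subseteq> V" "y \<in> W"
  shows "inv_into W (z \<circ> p) (z (p y)) = y"
proof -
  have "inj_on (z \<circ> p) W" using assms chart_inj[OF assms(2)] by (meson comp_inj_on inj_on_subset)
  then show ?thesis using inv_into_f_f[of "z \<circ> p" W y] assms(4) by simp
qed

text \<open>In the chart z \<circ> p upstairs and z downstairs the functions have the same
  coordinate expression on the same open set, so no derivative has to be computed.\<close>

lemma smooth_fun_descend:
  assumes F: "smooth_fun (lift_atlas A p) S F" and W: "sheet W" "W \<subseteq> S"
    and e: "\<And>y. y \<in> W \<Longrightarrow> F y = g (p y)"
  shows "smooth_fun A (p ` W) g"
  unfolding smooth_fun_def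
proof clarify
  fix V z k assume c: "(V, z) \<in> A"
  \<comment> \<open>The sheet is shrunk until its image lies in the domain of the chart, as
    \<open>lift_atlas\<close> requires.\<close>
  define W' where "W' = W \<inter> p -` V"
  have W': "sheet W'" "p ` W' \<subseteq> V"
    using sheet_subset[OF W(1)] open_vimage_p[OF open_chart[OF c]] W(1) unfolding W'_def sheet_def by auto
  have im: "(z \<circ> p) ` W' = z ` (p ` W \<inter> V)" by (auto simp: W'_def image_iff)
  have "Ck_on k ((z \<circ> p) ` (S \<inter> W')) (F \<circ> inv_into W' (z \<circ> p))"
    using F lift_chart[OF W'(1) c W'(2)] unfolding smooth_fun_def by blast
  then have "Ck_on k ((z \<circ> p) ` W') (F \<circ> inv_into W' (z \<circ> p))"
    by (rule Ck_on_subset) (use W(2) in \<open>auto simp: W'_def\<close>)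
  then show "Ck_on k (z ` (p ` W \<inter> V)) (g \<circ> inv_into V z)"
    unfolding im
  proof (rule Ck_on_cong)
    show "open (z ` (p ` W \<inter> V))"
      using open_image_p W(1) unfolding sheet_def by (intro open_chart_image_Int[OF c]) auto
    fix w assume "w \<in> z ` (p ` W \<inter> V)"
    then obtain y where y: "y \<in> W'" "w = z (p y)" unfolding im[symmetric] by auto
    then have "inv_into W' (z \<circ> p) w = y" using inv_lift_chart[OF _ c W'(2) y(1)] W'(1) by (simp add: sheet_def)
    then show "(F \<circ> inv_into W' (z \<circ> p)) w = (g \<circ> inv_into V z) w"
      using y e[of y] inv_chart[OF c, of "p y"] by (simp add: W'_def)
  qed
qed

text \<open>The function \<open>g\<close> on the base may depend on the point y: an equivariant
  frame is not itself a pull-back, and near different points over the same base point it is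
  described by functions that differ by a holonomy factor.\<close>

lemma smooth_fun_lift:
  assumes U: "open U"
    and loc: "\<And>y. p y \<in> U \<Longrightarrow> \<exists>Y O' g. open Y \<and> y \<in> Y \<and> open O' \<and> p y \<in> O' \<and> smooth_fun A O' g \<and>
         (\<forall>y'\<in>Y. p y' \<in> U \<longrightarrow> p y' \<in> O' \<longrightarrow> F y' = g (p y'))"
  shows "smooth_fun (lift_atlas A p) (p -` U) F"
  unfolding smooth_fun_def
proof clarify
  fix W zp k assume "(W, zp) \<in> lift_atlas A p"
  then obtain z V where zp: "zp = z \<circ> p" and W: "open W" "inj_on p W" and c: "(V, z) \<in> A" and WV: "p ` W \<subseteq> V"
    unfolding chart_union_lift by blast
  have opn: "open ((z \<circ> p) ` Y)" if "open Y" "Y \<subseteq> W" for Y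
  proof -
    have "(z \<circ> p) ` Y = z ` (p ` Y \<inter> V)" using that WV by fastforce
    then show ?thesis using open_chart_image_Int[OF c open_image_p[OF that(1)]] by simp
  qed
  have o0: "open (p -` U \<inter> W)" using W open_vimage_p[OF U] by auto
  show "Ck_on k (zp ` (p -` U \<inter> W)) (F \<circ> inv_into W zp)"
    unfolding zp
  proof (rule Ck_on_local)
    show "open ((z \<circ> p) ` (p -` U \<inter> W))" using opn o0 by blast
    fix w assume "w \<in> (z \<circ> p) ` (p -` U \<inter> W)"
    then obtain y where y: "p y \<in> U" "y \<in> W" "w = z (p y)" by auto
    obtain Y O' g where Y: "open Y" "y \<in> Y" "open O'" "p y \<in> O'" "smooth_fun A O' g"
      and e: "\<And>y'. y' \<in> Y \<Longrightarrow> p y' \<in> U \<Longrightarrow> p y' \<in> O' \<Longrightarrow> F y' = g (p y')"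
      using loc[OF y(1)] by blast
    define Y' where "Y' = Y \<inter> p -` O' \<inter> (p -` U \<inter> W)"
    have Y': "open Y'" "Y' \<subseteq> W" "y \<in> Y'"
      using Y y o0 open_vimage_p[OF Y(3)] unfolding Y'_def by auto
    have sub: "(z \<circ> p) ` Y' \<subseteq> z ` (O' \<inter> V)" using WV unfolding Y'_def by auto
    have "Ck_on k ((z \<circ> p) ` Y') (F \<circ> inv_into W (z \<circ> p))"
    proof (rule Ck_on_cong[OF Ck_on_subset[OF smooth_fun_Ck_on[OF Y(5) c] sub] opn[OF Y'(1,2)]])
      fix w' assume "w' \<in> (z \<circ> p) ` Y'"
      then obtain y' where y': "y' \<in> Y'" "w' = z (p y')" by auto
      then have "y' \<in> W" "p y' \<in> V" using Y'(2) WV by auto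
      then show "(g \<circ> inv_into V z) w' = (F \<circ> inv_into W (z \<circ> p)) w'"
        using inv_lift_chart[OF W(2) c WV] c y' e[of y'] by (simp add: Y'_def)
    qed
    moreover have "(z \<circ> p) ` Y' \<inter> (z \<circ> p) ` (p -` U \<inter> W) = (z \<circ> p) ` Y'" unfolding Y'_def by auto
    ultimately show "\<exists>T. open T \<and> w \<in> T \<and> Ck_on k (T \<inter> (z \<circ> p) ` (p -` U \<inter> W)) (F \<circ> inv_into W (z \<circ> p))"
      using opn[OF Y'(1,2)] Y'(3) y(3) by (intro exI[of _ "(z \<circ> p) ` Y'"]) auto
  qed
qed

end

section \<open>Maurer-Cartan forms\<close>

text \<open>Automorphisms are orthogonal for the Killing form, so on them inversion is given by the linear
  map \<open>a \<mapsto> K\<^sup>-\<^sup>1 a\<^sup>T K\<close>, \<open>K\<close> the Gram matrix; this makes inverses of smooth frames smooth.\<close>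

lemma (in killing_lie_algebra) lie_aut_inverse_linear:
  obtains I where "bounded_linear I" "\<And>a. a \<in> lie_aut_group L \<Longrightarrow> I a = matrix_inv a"
proof -
  define K where "K = (\<chi> i j. killing L (axis i 1) (axis j 1))"
  have sum_add: "f (\<Sum>i\<in>J. g i) = (\<Sum>i\<in>J. f (g i))" if "\<And>x y. f (x + y) = f x + f y" "f 0 = 0" "finite J"
    for f :: "'n cvec \<Rightarrow> complex" and g and J :: "'n set"
    using that(3) by induction (auto simp: that)
  have z: "killing L 0 y = 0" "killing L y 0 = 0" for y
    using killing_smult(1)[of 0 0 y] killing_smult(2)[of y 0 0] by auto
  have axis_left: "killing L (axis i 1) y = (K *v y) $ i" for i y
  proof -
    have "killing L (axis i 1) y = killing L (axis i 1) (\<Sum>j\<in>UNIV. y $ j *s axis j 1)" by (simp add: basis_expansion)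
    also have "\<dots> = (\<Sum>j\<in>UNIV. killing L (axis i 1) (y $ j *s axis j 1))"
      by (rule sum_add) (simp_all add: killing_add z)
    finally show ?thesis by (simp add: killing_smult K_def matrix_vector_mult_def mult.commute)
  qed
  have K: "killing L x y = (\<Sum>i\<in>UNIV. x $ i * (K *v y) $ i)" for x y
  proof -
    have "killing L x y = killing L (\<Sum>i\<in>UNIV. x $ i *s axis i 1) y" by (simp add: basis_expansion)
    also have "\<dots> = (\<Sum>i\<in>UNIV. killing L (x $ i *s axis i 1) y)"
      by (rule sum_add) (simp_all add: killing_add z)
    finally show ?thesis by (simp add: killing_smult axis_left)
  qed
  have "inj ((*v) K)"
  proof (rule injI)
    fix x y assume "K *v x = K *v y"
    then have "killing L z (x - y) = 0" for z by (simp add: K matrix_vector_mult_diff_distrib)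
    then show "x = y" using killing_nondegenerate[of "x - y"] killing_sym by (metis eq_iff_diff_eq_0)
  qed
  then have inv: "invertible K"
    by (meson inj_matrix_vector_mult invertible_left_inverse matrix_left_invertible_injective)
  define I where "I a = matrix_inv K ** (transpose a ** K)" for a
  have "bounded_linear I"
  proof -
    have "linear (\<lambda>a :: 'n cmat. transpose a)" by (intro linearI) (simp_all add: transpose_def vec_eq_iff)
    then have "bounded_linear (\<lambda>a :: 'n cmat. transpose a)" by (rule linear_conv_bounded_linear[THEN iffD1])
    then show ?thesis unfolding I_def[abs_def]
      by (intro bounded_linear_compose[OF mm.bounded_linear_right] bounded_linear_compose[OF mm.bounded_linear_left])
  qed
  moreover have "I a = matrix_inv a" if a: "a \<in> lie_aut_group L" for a
  proof -
    have tr: "(\<Sum>i\<in>UNIV. (a *v x) $ i * z $ i) = (\<Sum>i\<in>UNIV. x $ i * (transpose a *v z) $ i)" for x z :: "'n cvec"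
      unfolding matrix_vector_mult_def transpose_def
      by (simp add: sum_distrib_left sum_distrib_right, subst sum.swap) (simp add: algebra_simps)
    have "(\<Sum>i\<in>UNIV. axis j 1 $ i * (transpose a *v (K *v (a *v y))) $ i) = (\<Sum>i\<in>UNIV. axis j 1 $ i * (K *v y) $ i)"
      for j :: 'n and y
      using killing_lie_aut[OF a, of "axis j 1" y] unfolding K tr .
    then have "(transpose a *v (K *v (a *v y))) $ j = (K *v y) $ j" for j y
      by (simp add: axis_def if_distrib[of "\<lambda>u. u * _"] cong: if_cong)
    then have "transpose a *v (K *v (a *v y)) = K *v y" for y by (simp add: vec_eq_iff)
    then have "transpose a ** K ** a = K" by (intro matrix_eqI_mv) (simp add: matrix_vector_mul_assoc[symmetric])
    then have "I a ** a = mat 1"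
      by (simp add: I_def matrix_mul_assoc[symmetric]) (simp add: matrix_mul_assoc matrix_inv_mult[OF inv])
    then show ?thesis
      using matrix_inv_unique(1) matrix_left_right_inverse by metis
  qed
  ultimately show ?thesis using that by blast
qed

locale toda_surface = toda L + surface A
  for L :: "'n::finite toda_algebra" and A :: "'s::t2_space atlas"
begin

lemma smooth_fun_matrix_inv:
  assumes "smooth_fun A U F" "open U" "\<And>x. x \<in> U \<Longrightarrow> F x \<in> lie_aut_group L"
  shows "smooth_fun A U (\<lambda>x. matrix_inv (F x))"
proof -
  obtain I where I: "bounded_linear I" "\<And>a. a \<in> lie_aut_group L \<Longrightarrow> I a = matrix_inv a"
    using lie_aut_inverse_linear by blast
  show ?thesis
    by (rule smooth_fun_cong[OF smooth_fun_bounded_linear[OF I(1) assms(1)] assms(2)]) (simp add: I(2) assms(3))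
qed

lemmas smooth_fun_mm = smooth_fun_bounded_bilinear[OF bounded_bilinear_matrix_mult]
  and smooth_fun_mv = smooth_fun_bounded_bilinear[OF bounded_bilinear_matrix_vector_mult]

text \<open>A condition on the germ at one point: first-order differentiability in the chart and
  values in \<open>K\<close> nearby are all that the calculus of F^-1 dF requires.\<close>

definition frame_at :: "'n cmat set \<Rightarrow> 's chart \<Rightarrow> 's \<Rightarrow> ('s \<Rightarrow> 'n cmat) \<Rightarrow> bool" where
  "frame_at K c x F \<longleftrightarrow> c \<in> A \<and> x \<in> fst c \<and> chart_differentiable c F x \<and>
     (\<exists>W. open W \<and> x \<in> W \<and> (\<forall>y\<in>W. F y \<in> K))"

lemma frame_atI:
  assumes "smooth_fun A W F" "open W" "x \<in> W" "\<And>y. y \<in> W \<Longrightarrow> F y \<in> K" "c \<in> A" "x \<in> fst c"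
  shows "frame_at K c x F"
  unfolding frame_at_def using assms smooth_fun_chart_differentiable[of W F c x] by auto

lemma frame_at_mono: "frame_at K c x F \<Longrightarrow> K \<subseteq> K' \<Longrightarrow> frame_at K' c x F"
  unfolding frame_at_def by blast

lemma frame_at_value: "frame_at K c x F \<Longrightarrow> F x \<in> K"
  unfolding frame_at_def by blast

lemma dchart_mv:
  assumes "frame_at K c x F"
  shows "dchart c (\<lambda>y. F y *v u) x v = dchart c F x v *v u"
  using assms unfolding frame_at_def by (intro dchart_bounded_linear mv.bounded_linear_left) auto

lemma chart_differentiable_bounded_linear:
  assumes "bounded_linear T" "chart_differentiable c f x"
  shows "chart_differentiable c (\<lambda>y. T (f y)) x"
  using bounded_linear.has_derivative[OF assms(1) chart_differentiable_has_derivative[OF assms(2)]]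
  unfolding chart_differentiable_def differentiable_def by (auto simp: o_def)

lemma chart_differentiable_bounded_bilinear:
  assumes "bounded_bilinear B" "chart_differentiable c f x" "chart_differentiable c g x"
  shows "chart_differentiable c (\<lambda>y. B (f y) (g y)) x"
  using bounded_bilinear.FDERIV[OF assms(1) chart_differentiable_has_derivative[OF assms(2)]
        chart_differentiable_has_derivative[OF assms(3)]]
  unfolding chart_differentiable_def differentiable_def by (auto simp: o_def)

lemma chart_differentiable_cong:
  assumes "c \<in> A" "open W" "x \<in> W" "x \<in> fst c" "\<And>y. y \<in> W \<Longrightarrow> f y = g y" "chart_differentiable c f x"
  shows "chart_differentiable c g x"
  using assms(6) has_derivative_cong_open[of c W x f g, OF assms(1-5)]
  unfolding chart_differentiable_def differentiable_def by blast

lemma frame_at_matrix_inv: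
  assumes "frame_at K c x F" "matrix_group K" "K \<subseteq> lie_aut_group L"
  shows "frame_at K c x (\<lambda>y. matrix_inv (F y))"
proof -
  obtain I where I: "bounded_linear I" "\<And>a. a \<in> lie_aut_group L \<Longrightarrow> I a = matrix_inv a"
    using lie_aut_inverse_linear by blast
  obtain W where W: "open W" "x \<in> W" "\<forall>y\<in>W. F y \<in> K" and c: "c \<in> A" "x \<in> fst c" "chart_differentiable c F x"
    using assms unfolding frame_at_def by blast
  have "chart_differentiable c (\<lambda>y. matrix_inv (F y)) x"
    by (rule chart_differentiable_cong[OF c(1) W(1,2) c(2) _ chart_differentiable_bounded_linear[OF I(1) c(3)]])
       (use W(3) I(2) assms(3) in auto)
  then show ?thesis using W c matrix_groupD(3)[OF assms(2)] unfolding frame_at_def by blast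
qed

lemma mcform_eqI:
  assumes "ad L \<xi> = matrix_inv (F x) ** dchart c F x v"
  shows "mcform L F c x v = \<xi>"
  unfolding mcform_def assms[symmetric] by (simp add: ad_eq_iff)

text \<open>\<open>F\<^sup>-\<^sup>1 dF\<close> is a derivation, and derivations are inner.\<close>

lemma ad_mcform:
  assumes F: "frame_at (lie_aut_group L) c x F"
  shows "ad L (mcform L F c x v) = matrix_inv (F x) ** dchart c F x v"
proof -
  obtain W where W: "open W" "x \<in> W" "\<And>y. y \<in> W \<Longrightarrow> F y \<in> lie_aut_group L"
    and c: "c \<in> A" "x \<in> fst c" and d: "chart_differentiable c F x"
    using F unfolding frame_at_def by blast
  let ?D = "matrix_inv (F x) ** dchart c F x v"
  have Fx: "F x \<in> lie_aut_group L" and Gx: "matrix_inv (F x) \<in> lie_aut_group L"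
    using W matrix_groupD(3)[OF matrix_group_lie_aut_group] by auto
  note i = lie_aut_group_invertible[OF Fx]
  have dv: "chart_differentiable c (\<lambda>y. F y *v u) x" for u
    by (rule chart_differentiable_bounded_linear[OF mv.bounded_linear_left d])
  have "?D *v br L u w = br L (?D *v u) w + br L u (?D *v w)" for u w
  proof -
    have "dchart c F x v *v br L u w = dchart c (\<lambda>y. F y *v br L u w) x v" by (rule dchart_mv[OF F, symmetric])
    also have "\<dots> = dchart c (\<lambda>y. br L (F y *v u) (F y *v w)) x v"
      by (rule dchart_cong_open[OF c(1) W(1,2) c(2)]) (simp add: lie_aut_group_br W(3))
    also have "\<dots> = br L (F x *v u) (dchart c F x v *v w) + br L (dchart c F x v *v u) (F x *v w)"
      by (subst dchart_bounded_bilinear[OF bounded_bilinear_br dv dv c]) (simp add: dchart_mv[OF F])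
    finally have "?D *v br L u w = matrix_inv (F x) *v (br L (F x *v u) (dchart c F x v *v w) + br L (dchart c F x v *v u) (F x *v w))"
      by (simp add: matrix_vector_mul_assoc[symmetric])
    then show ?thesis
      by (simp add: mv.add_right lie_aut_group_br[OF Gx] matrix_inv_cancel_mv[OF i] matrix_vector_mul_assoc[symmetric] add.commute)
  qed
  then obtain \<xi> where "?D = ad L \<xi>" using derivation_inner by blast
  then show ?thesis using mcform_eqI[of \<xi> F x c v] by simp
qed

lemma mcform_cong:
  assumes "c \<in> A" "open W" "x \<in> W" "x \<in> fst c" "\<And>y. y \<in> W \<Longrightarrow> F y = G y"
  shows "mcform L F c x v = mcform L G c x v"
proof -
  have "dchart c F x v = dchart c G x v" by (rule dchart_cong_open[OF assms(1-4)]) (rule assms(5))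
  moreover have "F x = G x" by (rule assms(5)[OF assms(3)])
  ultimately show ?thesis unfolding mcform_def by simp
qed

lemma mcform_const: "mcform L (\<lambda>_. k) c x v = 0"
proof (rule mcform_eqI)
  have "ad L 0 = 0" by (rule matrix_eqI_mv) (simp add: ad_mv br.zero_left mv.zero_left)
  then show "ad L 0 = matrix_inv k ** dchart c (\<lambda>_. k) x v" by (simp add: dchart_const mm.zero_right)
qed

text \<open>The product rule, where the conjugated term G^-1 ad(\<omega>) G is \<open>ad\<close> of
  the vector G^-1 \<omega> because G takes values in automorphisms.\<close>

lemma mcform_mult:
  assumes F: "frame_at (lie_aut_group L) c x F" and G: "frame_at (lie_aut_group L) c x G"
  shows "mcform L (\<lambda>y. F y ** G y) c x v = matrix_inv (G x) *v mcform L F c x v + mcform L G c x v"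
proof (rule mcform_eqI)
  have c: "c \<in> A" "x \<in> fst c" "chart_differentiable c F x" "chart_differentiable c G x"
    using F G unfolding frame_at_def by auto
  have Fx: "F x \<in> lie_aut_group L" and Gx: "G x \<in> lie_aut_group L"
    using frame_at_value F G by auto
  note i = lie_aut_group_invertible[OF Fx] and j = lie_aut_group_invertible[OF Gx]
  have Gi: "matrix_inv (G x) \<in> lie_aut_group L" by (rule matrix_groupD(3)[OF matrix_group_lie_aut_group Gx])
  have "ad L (matrix_inv (G x) *v mcform L F c x v) = matrix_inv (G x) ** (matrix_inv (F x) ** dchart c F x v) ** G x"
    by (simp add: ad_conj[OF Gi, symmetric] ad_mcform[OF F] j)
  moreover have "dchart c (\<lambda>y. F y ** G y) x v = F x ** dchart c G x v + dchart c F x v ** G x"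
    using dchart_bounded_bilinear[OF bounded_bilinear_matrix_mult c(3,4,1,2)] .
  ultimately show "ad L (matrix_inv (G x) *v mcform L F c x v + mcform L G c x v) =
      matrix_inv (F x ** G x) ** dchart c (\<lambda>y. F y ** G y) x v"
    by (simp add: ad_add ad_mcform[OF G] matrix_inv_matrix_mult[OF i j] mm.add_right)
       (simp add: matrix_mul_assoc[symmetric], simp add: matrix_mul_assoc matrix_inv_mult[OF i] add.commute)
qed

lemma frame_at_const:
  assumes "k \<in> K" "c \<in> A" "x \<in> fst c"
  shows "frame_at K c x (\<lambda>_. k)"
  by (rule frame_atI[OF smooth_fun_const open_UNIV]) (use assms in auto)

text \<open>Left invariance of the Maurer-Cartan form. Deck transformations multiply a lifted frame
  by a constant on the left, so the form does not depend on the sheet.\<close>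

lemma mcform_const_mult:
  assumes "k \<in> lie_aut_group L" and F: "frame_at (lie_aut_group L) c x F"
  shows "mcform L (\<lambda>y. k ** F y) c x v = mcform L F c x v"
  using mcform_mult[OF frame_at_const[OF assms(1)] F] F by (simp add: mcform_const frame_at_def mv.zero_right)

lemma mcform_fixed:
  assumes F: "frame_at K c x F" and K: "K \<subseteq> lie_aut_group L" "K \<subseteq> commuting_group S"
    and S: "linear S" "surj S" "\<And>x y. S (br L x y) = br L (S x) (S y)"
  shows "S (mcform L F c x v) = mcform L F c x v"
proof -
  have FA: "frame_at (lie_aut_group L) c x F" using F K(1) frame_at_mono by blast
  obtain W where W: "open W" "x \<in> W" "\<And>y. y \<in> W \<Longrightarrow> F y \<in> K"
    and c: "c \<in> A" "x \<in> fst c" and d: "chart_differentiable c F x"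
    using F unfolding frame_at_def by blast
  have Gx: "matrix_inv (F x) \<in> commuting_group S"
    using W K(2) matrix_groupD(3)[OF matrix_group_commuting_group] by blast
  have dv: "chart_differentiable c (\<lambda>y. F y *v u) x" for u
    by (rule chart_differentiable_bounded_linear[OF mv.bounded_linear_left d])
  have "dchart c F x v *v S u = S (dchart c F x v *v u)" for u
  proof -
    have "dchart c F x v *v S u = dchart c (\<lambda>y. F y *v S u) x v" by (rule dchart_mv[OF F, symmetric])
    also have "\<dots> = dchart c (\<lambda>y. S (F y *v u)) x v"
      by (rule dchart_cong_open[OF c(1) W(1,2) c(2)]) (use W(3) K(2) commuting_groupD in fastforce)
    also have "\<dots> = S (dchart c (\<lambda>y. F y *v u) x v)"
      by (rule dchart_bounded_linear[OF linear_conv_bounded_linear[THEN iffD1, OF S(1)] dv])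
    finally show ?thesis by (simp add: dchart_mv[OF F])
  qed
  then have "br L (mcform L F c x v) (S u) = S (br L (mcform L F c x v) u)" for u
    by (simp add: ad_mv[symmetric] ad_mcform[OF FA] matrix_vector_mul_assoc[symmetric] commuting_groupD[OF Gx])
  then have "ad L (S (mcform L F c x v)) *v S u = ad L (mcform L F c x v) *v S u" for u
    by (simp add: ad_mv S(3))
  then have "ad L (S (mcform L F c x v)) = ad L (mcform L F c x v)"
    by (intro matrix_eqI_mv) (metis S(2) surjD)
  then show ?thesis by (simp add: ad_eq_iff)
qed

text \<open>Membership in V is tested against the vectors of the orthogonal complement, whose inner
  products with f vanish near x; V is its own double complement.\<close>

lemma dchart_in_subspace:
  fixes f :: "'s \<Rightarrow> 'b::euclidean_space"
  assumes V: "subspace V" and W: "c \<in> A" "open W" "x \<in> W" "x \<in> fst c" "\<And>y. y \<in> W \<Longrightarrow> f y \<in> V"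
    and d: "chart_differentiable c f x"
  shows "dchart c f x v \<in> V"
proof -
  have "dchart c f x v \<bullet> u = 0" if u: "u \<in> orthogonal_comp V" for u
  proof -
    have "dchart c f x v \<bullet> u = dchart c (\<lambda>y. f y \<bullet> u) x v"
      by (rule dchart_bounded_linear[OF bounded_linear_inner_left d, symmetric])
    also have "\<dots> = dchart c (\<lambda>y. 0) x v"
      by (rule dchart_cong_open[OF W(1-4)])
         (use W(5) u in \<open>auto simp: orthogonal_comp_def orthogonal_def inner_commute\<close>)
    finally show ?thesis by (simp add: dchart_const)
  qed
  then have "dchart c f x v \<in> orthogonal_comp (orthogonal_comp V)"
    by (simp add: orthogonal_comp_def[of "orthogonal_comp V"] orthogonal_def inner_commute)
  then show ?thesis using orthogonal_comp_self[OF V] by simp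
qed

lemma mcform_normalizes:
  assumes F: "frame_at K c x F" and K: "K \<subseteq> lie_aut_group L" "K \<subseteq> stabilizer V" and V: "subspace V" and h: "h \<in> V"
  shows "br L (mcform L F c x v) h \<in> V"
proof -
  have FA: "frame_at (lie_aut_group L) c x F" using F K(1) frame_at_mono by blast
  obtain W where W: "open W" "x \<in> W" "\<And>y. y \<in> W \<Longrightarrow> F y \<in> K"
    and c: "c \<in> A" "x \<in> fst c" and d: "chart_differentiable c F x"
    using F unfolding frame_at_def by blast
  have dv: "chart_differentiable c (\<lambda>y. F y *v u) x" for u
    by (rule chart_differentiable_bounded_linear[OF mv.bounded_linear_left d])
  have "F y *v h \<in> V" if "y \<in> W" for y
    using W(3)[OF that] K(2) h unfolding stabilizer_def by blast
  then have "dchart c F x v *v h \<in> V"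
    using dchart_in_subspace[OF V c(1) W(1,2) c(2) _ dv] by (simp add: dchart_mv[OF F, symmetric])
  moreover have "matrix_inv (F x) \<in> stabilizer V"
    using W K(2) matrix_groupD(3)[OF matrix_group_stabilizer] by blast
  ultimately have "matrix_inv (F x) *v (dchart c F x v *v h) \<in> V" unfolding stabilizer_def by blast
  then show ?thesis by (simp add: ad_mv[symmetric] ad_mcform[OF FA] matrix_vector_mul_assoc)
qed

lemma mcform_GG:
  assumes "frame_at (GG L) c x F"
  shows "mcform L F c x v \<in> real_g L"
proof -
  have "surj (rho L)" using rho_rho by (metis surjI)
  then show ?thesis using mcform_fixed[OF assms GG_lie_aut GG_rho linear_rho _ rho_br] by (simp add: real_g_def)
qed

text \<open>\<open>TT L\<close> is defined by generators and is not shown to be closed, so its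
  tangent directions have to be bounded differently. The derivative is fixed by the diagram
  automorphism and normalises \<open>tC L\<close>; being a Cartan subalgebra of the fixed algebra,
  \<open>tC L\<close> contains it. Reality comes from \<open>GG L\<close>.\<close>

lemma mcform_TT:
  assumes F: "frame_at (TT L) c x F" and G: "TT L \<subseteq> GG L"
  shows "mcform L F c x v \<in> real_t L"
proof -
  have FC: "frame_at (TC L) c x F" using frame_at_mono[OF F TT_subset_TC] .
  have "nu L (mcform L F c x v) = mcform L F c x v"
    using nu_lie_aut TC_commutes[OF nu_lie_aut nu_tC]
    by (intro mcform_fixed[OF FC TC_lie_aut _ linear_lie_aut[OF nu_lie_aut]]) (auto simp: lie_aut_def bij_is_surj)
  then have "mcform L F c x v \<in> tC L"
    by (rule tC_normalizer) (rule mcform_normalizes[OF FC TC_lie_aut TC_stabilizes_tC subspace_tC])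
  then show ?thesis using mcform_GG[OF frame_at_mono[OF F G], of v] by (simp add: real_t_iff real_g_def)
qed

text \<open>Differentiating h = a h' yields a^-1 dh = dh' + [a^-1 da, h']. The last term cancels the
  inhomogeneous part of the changed connection form, and a^-1 respects the bracket with n.\<close>

lemma covariant_derivative_gauge:
  assumes a: "frame_at (lie_aut_group L) c x a" and h: "chart_differentiable c h x"
    and W: "open W" "x \<in> W" "\<And>y. y \<in> W \<Longrightarrow> h' y = matrix_inv (a y) *v h y"
  shows "dchart c h' x v + br L (matrix_inv (a x) *v n + mcform L a c x v) (h' x) =
         matrix_inv (a x) *v (dchart c h x v + br L n (h x))"
proof -
  have c: "c \<in> A" "x \<in> fst c" "chart_differentiable c a x" using a unfolding frame_at_def by auto
  have ai: "frame_at (lie_aut_group L) c x (\<lambda>y. matrix_inv (a y))"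
    by (rule frame_at_matrix_inv[OF a matrix_group_lie_aut_group order_refl])
  have ax: "a x \<in> lie_aut_group L" "matrix_inv (a x) \<in> lie_aut_group L"
    using frame_at_value[OF a] frame_at_value[OF ai] by auto
  note i = lie_aut_group_invertible[OF ax(1)]
  obtain W' where W': "open W'" "x \<in> W'" "\<And>y. y \<in> W' \<Longrightarrow> a y \<in> lie_aut_group L"
    using a unfolding frame_at_def by blast
  have dh: "chart_differentiable c (\<lambda>y. matrix_inv (a y) *v h y) x"
    using ai h unfolding frame_at_def by (intro chart_differentiable_bounded_bilinear[OF bounded_bilinear_matrix_vector_mult]) auto
  have h': "chart_differentiable c h' x"
    by (rule chart_differentiable_cong[of c W x "\<lambda>y. matrix_inv (a y) *v h y" h', OF c(1) W(1,2) c(2) _ dh])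
       (simp add: W(3))
  have "h y = a y *v h' y" if "y \<in> W \<inter> W'" for y
    using that W(3)[of y] matrix_inv_cancel_mv[OF lie_aut_group_invertible[OF W'(3)]] by simp
  then have "dchart c h x v = dchart c (\<lambda>y. a y *v h' y) x v"
    using W(1,2) W'(1,2) by (intro dchart_cong_open[OF c(1) _ _ c(2), of "W \<inter> W'"]) auto
  also have "\<dots> = a x *v dchart c h' x v + dchart c a x v *v h' x"
    by (rule dchart_bounded_bilinear[OF bounded_bilinear_matrix_vector_mult c(3) h' c(1,2)])
  finally have "matrix_inv (a x) *v dchart c h x v = dchart c h' x v + br L (mcform L a c x v) (h' x)"
    by (simp add: mv.add_right matrix_inv_cancel_mv[OF i] ad_mv[symmetric] ad_mcform[OF a] matrix_vector_mul_assoc[symmetric])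
  then show ?thesis
    by (simp add: mv.add_right br.add_left lie_aut_group_br[OF ax(2)] W(3)[OF W(2)])
qed

end

section \<open>Principal bundles and associated bundles\<close>

text \<open>The regularity of the transition functions is replaced by a trivial predicate: the
  algebra of associated bundles is the same for the holomorphic \<open>QC\<close>, its smooth
  reduction and the bundles constructed from maps.\<close>

locale principal =
  fixes B :: "('q, 's::topological_space, 'n::finite) pbundle"
  assumes algebraic: "principal_bundle_with (\<lambda>_ _. True) B"
begin

lemma algebraic_conjuncts:
  "matrix_group (pgroup B)"
  "\<forall>q\<in>pspace B. pact B q (mat 1) = q"
  "\<forall>q\<in>pspace B. \<forall>a\<in>pgroup B. pact B q a \<in> pspace B \<and> pproj B (pact B q a) = pproj B q"
  "\<forall>q\<in>pspace B. \<forall>a\<in>pgroup B. \<forall>b\<in>pgroup B. pact B (pact B q a) b = pact B q (a ** b)"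
  "\<forall>q\<in>pspace B. \<forall>q'\<in>pspace B. pproj B q = pproj B q' \<longrightarrow> (\<exists>!a. a \<in> pgroup B \<and> q' = pact B q a)"
  "\<forall>(U, s)\<in>psecs B. local_section B U s"
  "(\<Union>(U, s)\<in>psecs B. U) = UNIV"
  using algebraic[unfolded principal_bundle_with_def] by - (elim conjE, assumption)+

lemmas matrix_group_pgroup = algebraic_conjuncts(1)
  and act_one = algebraic_conjuncts(2)[rule_format]
  and act_space = algebraic_conjuncts(3)[rule_format, THEN conjunct1]
  and act_proj = algebraic_conjuncts(3)[rule_format, THEN conjunct2]
  and act_act = algebraic_conjuncts(4)[rule_format]
  and act_ex1 = algebraic_conjuncts(5)[rule_format]

lemma section_local: "(U, s) \<in> psecs B \<Longrightarrow> local_section B U s"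
  using algebraic_conjuncts(6) by fast

lemma section_cover: "\<exists>U s. (U, s) \<in> psecs B \<and> x \<in> U"
proof -
  have "x \<in> (\<Union>(U, s)\<in>psecs B. U)" using algebraic_conjuncts(7) by simp
  then show ?thesis by auto
qed

lemmas pgroup_one = matrix_groupD(1)[OF matrix_group_pgroup]
  and pgroup_invertible = matrix_groupD(2)[OF matrix_group_pgroup]
  and pgroup_inv = matrix_groupD(3)[OF matrix_group_pgroup]
  and pgroup_mult = matrix_groupD(4)[OF matrix_group_pgroup]

lemma local_sectionD:
  assumes "local_section B U s"
  shows "open U" "x \<in> U \<Longrightarrow> s x \<in> pspace B" "x \<in> U \<Longrightarrow> pproj B (s x) = x"
  using assms unfolding local_section_def by auto

lemma pdiff_props:
  assumes "q \<in> pspace B" "q' \<in> pspace B" "pproj B q = pproj B q'"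
  shows "pdiff B q q' \<in> pgroup B" "pact B q (pdiff B q q') = q'"
  using theI'[OF act_ex1[OF assms]] unfolding pdiff_def by auto

lemma pdiff_act:
  assumes "q \<in> pspace B" "a \<in> pgroup B"
  shows "pdiff B q (pact B q a) = a"
  unfolding pdiff_def
  using the1_equality[OF act_ex1[OF assms(1) act_space[OF assms] act_proj[OF assms, symmetric]]] assms(2)
  by blast

lemma act_inject:
  assumes "q \<in> pspace B" "a \<in> pgroup B" "b \<in> pgroup B" "pact B q a = pact B q b"
  shows "a = b"
  using pdiff_act[OF assms(1,2)] pdiff_act[OF assms(1,3)] unfolding assms(4) by (rule trans[OF sym])

lemma pdiff_trans:
  assumes "q \<in> pspace B" "q' \<in> pspace B" "q'' \<in> pspace B" "pproj B q = pproj B q'" "pproj B q' = pproj B q''"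
  shows "pdiff B q q' ** pdiff B q' q'' = pdiff B q q''"
proof -
  note d = pdiff_props[OF assms(1,2,4)] and d' = pdiff_props[OF assms(2,3,5)]
  have "pact B q (pdiff B q q' ** pdiff B q' q'') = q''"
    using act_act[OF assms(1) d(1) d'(1)] d(2) d'(2) by simp
  then show ?thesis using pdiff_act[OF assms(1) pgroup_mult[OF d(1) d'(1)]] by simp
qed

lemma pdiff_refl: "q \<in> pspace B \<Longrightarrow> pdiff B q q = mat 1"
  using pdiff_act[of q "mat 1"] pgroup_one by (simp add: act_one)

lemma pdiff_inverse:
  assumes "q \<in> pspace B" "q' \<in> pspace B" "pproj B q = pproj B q'"
  shows "pdiff B q' q = matrix_inv (pdiff B q q')"
proof -
  have "pdiff B q q' ** pdiff B q' q = mat 1"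
    unfolding pdiff_trans[OF assms(1,2,1,3) assms(3)[symmetric]] by (rule pdiff_refl[OF assms(1)])
  then show ?thesis by (rule matrix_inv_unique(1)[symmetric])
qed

lemma belem_iff: "(q', w) \<in> belem B q v \<longleftrightarrow> (\<exists>a\<in>pgroup B. q' = pact B q a \<and> w = matrix_inv a *v v)"
  unfolding belem_def by auto

lemma belem_self: "q \<in> pspace B \<Longrightarrow> (q, v) \<in> belem B q v"
  unfolding belem_iff by (rule bexI[of _ "mat 1"]) (simp_all add: act_one pgroup_one)

lemma belem_act:
  assumes q: "q \<in> pspace B" and a: "a \<in> pgroup B"
  shows "belem B (pact B q a) (matrix_inv a *v v) = belem B q v"
proof -
  have i: "invertible a" by (rule pgroup_invertible[OF a])
  have "\<exists>b\<in>pgroup B. pact B (pact B q a) c = pact B q b \<and> matrix_inv c *v (matrix_inv a *v v) = matrix_inv b *v v"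
    if c: "c \<in> pgroup B" for c
    using act_act[OF q a c] pgroup_mult[OF a c] matrix_inv_matrix_mult[OF i pgroup_invertible[OF c]]
    by (auto simp: matrix_vector_mul_assoc intro!: bexI[of _ "a ** c"])
  moreover have "\<exists>c\<in>pgroup B. pact B q b = pact B (pact B q a) c \<and> matrix_inv b *v v = matrix_inv c *v (matrix_inv a *v v)"
    if b: "b \<in> pgroup B" for b
  proof (rule bexI[of _ "matrix_inv a ** b"])
    have "a ** (matrix_inv a ** b) = b" by (simp add: matrix_mul_assoc matrix_inv_mult[OF i])
    moreover have "matrix_inv (matrix_inv a ** b) = matrix_inv b ** a"
      by (simp add: matrix_inv_matrix_mult matrix_inv_inv[OF i] pgroup_invertible[OF b])
    ultimately show "pact B q b = pact B (pact B q a) (matrix_inv a ** b) \<and>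
        matrix_inv b *v v = matrix_inv (matrix_inv a ** b) *v (matrix_inv a *v v)"
      using act_act[OF q a pgroup_mult[OF pgroup_inv[OF a] b]]
      by (simp add: matrix_vector_mul_assoc[symmetric] matrix_inv_cancel_mv[OF i])
    show "matrix_inv a ** b \<in> pgroup B" using a b pgroup_inv pgroup_mult by blast
  qed
  ultimately show ?thesis unfolding belem_def by (intro equalityI subsetI) (elim CollectE exE conjE, force)+
qed

lemma belem_change:
  assumes "q \<in> pspace B" "q' \<in> pspace B" "pproj B q = pproj B q'"
  shows "belem B q v = belem B q' (matrix_inv (pdiff B q q') *v v)"
  using belem_act[OF assms(1) pdiff_props(1)[OF assms]] pdiff_props(2)[OF assms] by simp

lemma coord_belem:
  assumes q: "q \<in> pspace B"
  shows "coord q (belem B q v) = v"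
  unfolding coord_def
proof (rule the_equality)
  fix w assume "(q, w) \<in> belem B q v"
  then obtain a where a: "a \<in> pgroup B" "q = pact B q a" "w = matrix_inv a *v v" unfolding belem_iff by blast
  then have "a = mat 1" using act_inject[OF q a(1) pgroup_one] act_one[OF q] by simp
  then show "w = v" using a by simp
qed (rule belem_self[OF q])

lemma coord_change:
  assumes "q \<in> pspace B" "q' \<in> pspace B" "pproj B q = pproj B q'"
  shows "coord q' (belem B q v) = matrix_inv (pdiff B q q') *v v"
  using belem_change[OF assms] coord_belem[OF assms(2)] by simp

lemma belem_inject: "q \<in> pspace B \<Longrightarrow> belem B q v = belem B q w \<longleftrightarrow> v = w"
  using coord_belem by metis

lemma bproj_belem:
  assumes q: "q \<in> pspace B"
  shows "bproj B (belem B q v) = pproj B q"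
proof -
  have "(SOME y. y \<in> belem B q v) \<in> belem B q v" using belem_self[OF q] by (rule someI)
  then have "fst (SOME y. y \<in> belem B q v) \<in> {pact B q a | a. a \<in> pgroup B}" unfolding belem_def by auto
  then show ?thesis unfolding bproj_def using act_proj[OF q] by auto
qed

lemma assocE:
  assumes e: "e \<in> assoc B W" and q: "q \<in> pspace B" "bproj B e = pproj B q"
  obtains w where "e = belem B q w" "w = coord q e" "\<exists>a\<in>pgroup B. \<exists>v\<in>W. w = a *v v"
proof -
  obtain q' v where q': "q' \<in> pspace B" "v \<in> W" "e = belem B q' v" using e unfolding assoc_def by blast
  have p: "pproj B q' = pproj B q" using bproj_belem[OF q'(1)] q q'(3) by simp
  have "e = belem B q (matrix_inv (pdiff B q' q) *v v)" using belem_change[OF q'(1) q(1) p] q'(3) by simp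
  then show ?thesis
    using that coord_belem[OF q(1)] pgroup_inv[OF pdiff_props(1)[OF q'(1) q(1) p]] q'(2) by metis
qed

lemma belem_in_assoc: "q \<in> pspace B \<Longrightarrow> v \<in> W \<Longrightarrow> belem B q v \<in> assoc B W"
  unfolding assoc_def by blast

lemma same_fibre_in_belem:
  assumes q: "q \<in> pspace B" and v: "(q', v') \<in> belem B q v" and w: "(q', w') \<in> belem B q w"
  obtains a where "a \<in> pgroup B" "q' = pact B q a" "v' = matrix_inv a *v v" "w' = matrix_inv a *v w"
proof -
  obtain a where a: "a \<in> pgroup B" "q' = pact B q a" "v' = matrix_inv a *v v" using v unfolding belem_iff by blast
  obtain b where b: "b \<in> pgroup B" "q' = pact B q b" "w' = matrix_inv b *v w" using w unfolding belem_iff by blast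
  have "a = b" using act_inject[OF q a(1) b(1)] a b by simp
  then show ?thesis using that a b by blast
qed

lemma badd_belem:
  assumes q: "q \<in> pspace B"
  shows "badd (belem B q v) (belem B q w) = belem B q (v + w)"
proof -
  have "(q', u) \<in> badd (belem B q v) (belem B q w) \<longleftrightarrow> (q', u) \<in> belem B q (v + w)" for q' u
  proof
    assume "(q', u) \<in> badd (belem B q v) (belem B q w)"
    then obtain v' w' where *: "(q', v') \<in> belem B q v" "(q', w') \<in> belem B q w" "u = v' + w'"
      unfolding badd_def by blast
    show "(q', u) \<in> belem B q (v + w)"
      using same_fibre_in_belem[OF q *(1,2)] *(3) unfolding belem_iff by (metis mv.add_right)
  next
    assume "(q', u) \<in> belem B q (v + w)"
    then obtain a where a: "a \<in> pgroup B" "q' = pact B q a" "u = matrix_inv a *v v + matrix_inv a *v w"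
      unfolding belem_iff by (auto simp: mv.add_right)
    then have "(q', matrix_inv a *v v) \<in> belem B q v" "(q', matrix_inv a *v w) \<in> belem B q w"
      unfolding belem_iff by blast+
    then show "(q', u) \<in> badd (belem B q v) (belem B q w)"
      unfolding badd_def using a(3) by blast
  qed
  then show ?thesis by auto
qed

text \<open>Equivariance is required at the single vector v. The maps
  \<open>component (kC L) (mC L)\<close> and \<open>component (mC L) (kC L)\<close> are known to
  commute with the group only on \<open>g1 L\<close>, through \<open>component_g1\<close>.\<close>

lemma bmap_belem:
  assumes "\<And>a. a \<in> pgroup B \<Longrightarrow> f (a *v v) = a *v f v"
  shows "bmap f (belem B q v) = belem B q (f v)"
proof -
  have "f (matrix_inv a *v v) = matrix_inv a *v f v" if "a \<in> pgroup B" for a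
    using assms[OF pgroup_inv[OF that]] .
  then show ?thesis unfolding bmap_def belem_def by force
qed

lemma bscale_belem: "bscale k (belem B q v) = belem B q (k *s v)"
  unfolding bscale_def by (rule bmap_belem) (simp add: vector_scalar_commute)

lemma bbracket_belem:
  assumes q: "q \<in> pspace B" and G: "pgroup B \<subseteq> lie_aut_group L"
  shows "bbracket L (belem B q v) (belem B q w) = belem B q (br L v w)"
proof -
  have g: "matrix_inv a *v br L v w = br L (matrix_inv a *v v) (matrix_inv a *v w)" if "a \<in> pgroup B" for a
    using pgroup_inv[OF that] G unfolding lie_aut_group_def by blast
  have "(q', u) \<in> bbracket L (belem B q v) (belem B q w) \<longleftrightarrow> (q', u) \<in> belem B q (br L v w)" for q' u
  proof
    assume "(q', u) \<in> bbracket L (belem B q v) (belem B q w)"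
    then obtain v' w' where *: "(q', v') \<in> belem B q v" "(q', w') \<in> belem B q w" "u = br L v' w'"
      unfolding bbracket_def by blast
    show "(q', u) \<in> belem B q (br L v w)"
      using same_fibre_in_belem[OF q *(1,2)] *(3) g unfolding belem_iff by metis
  next
    assume "(q', u) \<in> belem B q (br L v w)"
    then show "(q', u) \<in> bbracket L (belem B q v) (belem B q w)"
      unfolding bbracket_def belem_iff using g by auto
  qed
  then show ?thesis by auto
qed

lemma part01_belem:
  assumes "q \<in> pspace B" "\<alpha> c x v = belem B q a" "\<alpha> c x (\<i> * v) = belem B q b"
  shows "part01 \<alpha> c x v = belem B q ((1/2) *s (a + \<i> *s b))"
  unfolding part01_def assms(2,3) by (simp add: bscale_belem badd_belem[OF assms(1)])

lemma part10_belem: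
  assumes "q \<in> pspace B" "\<alpha> c x v = belem B q a" "\<alpha> c x (\<i> * v) = belem B q b"
  shows "part10 \<alpha> c x v = belem B q ((1/2) *s (a + (- \<i>) *s b))"
  unfolding part10_def assms(2,3) by (simp add: bscale_belem badd_belem[OF assms(1)])

end

section \<open>Extension of the structure group\<close>

locale principal_extension = principal B for B :: "('q, 's::topological_space, 'n::finite) pbundle" +
  fixes K :: "'n cmat set"
  assumes matrix_group_K: "matrix_group K" and pgroup_subset: "pgroup B \<subseteq> K"
begin

lemma extend_elem_iff: "(q', k') \<in> extend_elem B q k \<longleftrightarrow> (\<exists>a\<in>pgroup B. q' = pact B q a \<and> k' = matrix_inv a ** k)"
  unfolding extend_elem_def by auto

lemma extend_elem_self: "q \<in> pspace B \<Longrightarrow> (q, k) \<in> extend_elem B q k"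
  unfolding extend_elem_iff by (rule bexI[of _ "mat 1"]) (simp_all add: act_one pgroup_one)

lemma extend_elem_act:
  assumes q: "q \<in> pspace B" and a: "a \<in> pgroup B"
  shows "extend_elem B (pact B q a) (matrix_inv a ** k) = extend_elem B q k"
proof -
  have i: "invertible a" by (rule pgroup_invertible[OF a])
  have "\<exists>b\<in>pgroup B. pact B (pact B q a) c = pact B q b \<and> matrix_inv c ** (matrix_inv a ** k) = matrix_inv b ** k"
    if c: "c \<in> pgroup B" for c
    using act_act[OF q a c] pgroup_mult[OF a c] matrix_inv_matrix_mult[OF i pgroup_invertible[OF c]]
    by (auto simp: matrix_mul_assoc intro!: bexI[of _ "a ** c"])
  moreover have "\<exists>c\<in>pgroup B. pact B q b = pact B (pact B q a) c \<and> matrix_inv b ** k = matrix_inv c ** (matrix_inv a ** k)"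
    if b: "b \<in> pgroup B" for b
  proof (rule bexI[of _ "matrix_inv a ** b"])
    have "a ** (matrix_inv a ** b) = b" by (simp add: matrix_mul_assoc matrix_inv_mult[OF i])
    moreover have "matrix_inv (matrix_inv a ** b) = matrix_inv b ** a"
      by (simp add: matrix_inv_matrix_mult matrix_inv_inv[OF i] pgroup_invertible[OF b])
    moreover have "matrix_inv b ** a ** (matrix_inv a ** k) = matrix_inv b ** (a ** matrix_inv a) ** k"
      by (simp only: matrix_mul_assoc)
    ultimately show "pact B q b = pact B (pact B q a) (matrix_inv a ** b) \<and>
        matrix_inv b ** k = matrix_inv (matrix_inv a ** b) ** (matrix_inv a ** k)"
      using act_act[OF q a pgroup_mult[OF pgroup_inv[OF a] b]]
      by (simp add: matrix_inv_mult[OF i])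
    show "matrix_inv a ** b \<in> pgroup B" using a b pgroup_inv pgroup_mult by blast
  qed
  ultimately show ?thesis unfolding extend_elem_def by (intro equalityI subsetI) (elim CollectE exE conjE, force)+
qed

lemma extend_elem_change:
  assumes "q \<in> pspace B" "q' \<in> pspace B" "pproj B q = pproj B q'"
  shows "extend_elem B q' k = extend_elem B q (pdiff B q q' ** k)"
proof -
  note d = pdiff_props[OF assms]
  have "extend_elem B q (pdiff B q q' ** k) = extend_elem B q' (matrix_inv (pdiff B q q') ** (pdiff B q q' ** k))"
    using extend_elem_act[OF assms(1) d(1), of "pdiff B q q' ** k"] d(2) by simp
  then show ?thesis by (simp add: matrix_mul_assoc matrix_inv_mult[OF pgroup_invertible[OF d(1)]])
qed

lemma extend_elem_inject:
  assumes q: "q \<in> pspace B" and e: "extend_elem B q k = extend_elem B q k'"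
  shows "k = k'"
proof -
  have "(q, k) \<in> extend_elem B q k'" using extend_elem_self[OF q, of k] e by simp
  then obtain a where a: "a \<in> pgroup B" "q = pact B q a" "k = matrix_inv a ** k'" unfolding extend_elem_iff by blast
  then have "a = mat 1" using act_inject[OF q a(1) pgroup_one] act_one[OF q] by simp
  then show ?thesis using a by simp
qed

abbreviation "E \<equiv> extend_bundle B K"

lemma pspace_E: "pspace E = {extend_elem B q k | q k. q \<in> pspace B \<and> k \<in> K}"
  and pgroup_E: "pgroup E = K"
  and psecs_E: "psecs E = {(U, \<lambda>x. extend_elem B (s x) (mat 1)) | U s. (U, s) \<in> psecs B}"
  by (simp_all add: extend_bundle_def)

lemma pproj_E:
  assumes q: "q \<in> pspace B"
  shows "pproj E (extend_elem B q k) = pproj B q"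
proof -
  have "(SOME y. y \<in> extend_elem B q k) \<in> extend_elem B q k" using extend_elem_self[OF q] by (rule someI)
  then have "fst (SOME y. y \<in> extend_elem B q k) \<in> {pact B q a | a. a \<in> pgroup B}" unfolding extend_elem_def by auto
  then show ?thesis unfolding extend_bundle_def using act_proj[OF q] by auto
qed

lemma pact_E: "pact E (extend_elem B q k) b = extend_elem B q (k ** b)"
  unfolding extend_bundle_def extend_elem_def by (force simp: matrix_mul_assoc)

lemma extend_elem_space: "q \<in> pspace B \<Longrightarrow> k \<in> K \<Longrightarrow> extend_elem B q k \<in> pspace E"
  unfolding pspace_E by blast

lemmas K_one = matrix_groupD(1)[OF matrix_group_K]
  and K_invertible = matrix_groupD(2)[OF matrix_group_K]
  and K_inv = matrix_groupD(3)[OF matrix_group_K]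
  and K_mult = matrix_groupD(4)[OF matrix_group_K]

lemma principal_E: "principal E"
proof
  show "principal_bundle_with (\<lambda>_ _. True) E"
    unfolding principal_bundle_with_def
  proof (intro conjI ballI impI)
    fix e e' assume "e \<in> pspace E" "e' \<in> pspace E" and p: "pproj E e = pproj E e'"
    then obtain q k q' k' where q: "q \<in> pspace B" "k \<in> K" "e = extend_elem B q k"
      and q': "q' \<in> pspace B" "k' \<in> K" "e' = extend_elem B q' k'" unfolding pspace_E by blast
    have p': "pproj B q = pproj B q'" using p pproj_E q q' by simp
    have d: "pdiff B q q' \<in> K" using pdiff_props(1)[OF q(1) q'(1) p'] pgroup_subset by blast
    have e': "e' = extend_elem B q (pdiff B q q' ** k')" using extend_elem_change[OF q(1) q'(1) p'] q' by simp
    show "\<exists>!a. a \<in> pgroup E \<and> e' = pact E e a"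
    \<comment> \<open>From [q, k] to [q', k'] one passes by k^-1 d k', where d carries q to q' in
      the original bundle.\<close>
    proof (rule ex1I[of _ "matrix_inv k ** (pdiff B q q' ** k')"])
      show "matrix_inv k ** (pdiff B q q' ** k') \<in> pgroup E \<and> e' = pact E e (matrix_inv k ** (pdiff B q q' ** k'))"
        using d q q' e' K_inv K_mult
        by (simp add: pgroup_E pact_E) (simp add: matrix_mul_assoc matrix_inv_mult[OF K_invertible[OF q(2)]])
      fix a assume a: "a \<in> pgroup E \<and> e' = pact E e a"
      then have "k ** a = pdiff B q q' ** k'"
        using extend_elem_inject[OF q(1)] e' q(3) by (simp add: pact_E)
      then have "matrix_inv k ** (k ** a) = matrix_inv k ** (pdiff B q q' ** k')" by simp
      then show "a = matrix_inv k ** (pdiff B q q' ** k')"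
        by (simp add: matrix_mul_assoc matrix_inv_mult[OF K_invertible[OF q(2)]])
    qed
  next
    show "(\<Union>(U, s)\<in>psecs E. U) = UNIV"
      using section_cover unfolding psecs_E by fastforce
  next
    fix S assume "S \<in> psecs E"
    then show "case S of (U, s) \<Rightarrow> local_section E U s"
      using section_local K_one unfolding psecs_E local_section_def
      by (auto simp: pproj_E extend_elem_space)
  next
    fix e b assume "e \<in> pspace E" and b: "b \<in> pgroup E"
    then obtain q k where q: "q \<in> pspace B" "k \<in> K" "e = extend_elem B q k" unfolding pspace_E by blast
    then show "pact E e b \<in> pspace E" "pproj E (pact E e b) = pproj E e"
      using b K_mult by (auto simp: pact_E pproj_E pgroup_E intro!: extend_elem_space)
  qed (auto simp: pgroup_E pspace_E pact_E pproj_E matrix_group_K matrix_mul_assoc)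
qed

lemma pdiff_E:
  assumes "q \<in> pspace B" "q' \<in> pspace B" "pproj B q = pproj B q'"
  shows "pdiff E (extend_elem B q (mat 1)) (extend_elem B q' (mat 1)) = pdiff B q q'"
  using principal.pdiff_act[OF principal_E extend_elem_space[OF assms(1) K_one], of "pdiff B q q'"]
    pdiff_props(1)[OF assms] pgroup_subset extend_elem_change[OF assms, of "mat 1"]
  by (auto simp: pgroup_E pact_E)

lemma extend_belem_belem:
  assumes q: "q \<in> pspace B"
  shows "extend_belem B K (belem B q v) = belem E (extend_elem B q (mat 1)) v"
  unfolding extend_belem_def
proof (rule the_equality)
  show "\<exists>q' v'. (q', v') \<in> belem B q v \<and> belem E (extend_elem B q (mat 1)) v = belem E (extend_elem B q' (mat 1)) v'"
    using belem_self[OF q] by blast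
  fix e' assume "\<exists>q' v'. (q', v') \<in> belem B q v \<and> e' = belem E (extend_elem B q' (mat 1)) v'"
  then obtain a where a: "a \<in> pgroup B" "e' = belem E (extend_elem B (pact B q a) (mat 1)) (matrix_inv a *v v)"
    unfolding belem_iff by blast
  have "extend_elem B (pact B q a) (mat 1) = pact E (extend_elem B q (mat 1)) a"
    using extend_elem_change[OF q act_space[OF q a(1)], of "mat 1"] act_proj[OF q a(1)] pdiff_act[OF q a(1)]
    by (simp add: pact_E)
  then show "e' = belem E (extend_elem B q (mat 1)) v"
    using principal.belem_act[OF principal_E extend_elem_space[OF q K_one], of a] a pgroup_subset
    by (auto simp: pgroup_E)
qed

end

section \<open>Covariant derivatives\<close>

lemma principal_bundle_with_principal: "principal_bundle_with R B \<Longrightarrow> principal B"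
  unfolding principal_def principal_bundle_with_def
  by (elim conjE, intro conjI, assumption+) (simp add: case_prod_beta)

locale lie_bundle = toda_surface L A + principal B
  for L :: "'n::finite toda_algebra" and A :: "'s::t2_space atlas" and B :: "('q, 's, 'n) pbundle" +
  assumes pgroup_lie_aut: "pgroup B \<subseteq> lie_aut_group L"
begin

lemma smooth_sectionD:
  assumes "smooth_section A B U s"
  shows "open U" "x \<in> U \<Longrightarrow> s x \<in> pspace B" "x \<in> U \<Longrightarrow> pproj B (s x) = x"
    "(U', s') \<in> psecs B \<Longrightarrow> smooth_fun A (U \<inter> U') (\<lambda>x. pdiff B (s' x) (s x))"
  using assms unfolding smooth_section_def local_section_def by auto

lemma smooth_fun_pdiff:
  assumes s: "smooth_section A B U s" and s': "smooth_section A B U' s'"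
  shows "smooth_fun A (U \<inter> U') (\<lambda>x. pdiff B (s x) (s' x))"
proof (rule smooth_fun_local)
  show "open (U \<inter> U')" using smooth_sectionD(1)[OF s] smooth_sectionD(1)[OF s'] by blast
  fix x assume "x \<in> U \<inter> U'"
  obtain U0 s0 where s0: "(U0, s0) \<in> psecs B" "x \<in> U0" using section_cover by blast
  note loc = local_sectionD[OF section_local[OF s0(1)]]
  have o: "open (U0 \<inter> (U \<inter> U'))" using loc(1) smooth_sectionD(1)[OF s] smooth_sectionD(1)[OF s'] by blast
  have a: "smooth_fun A (U0 \<inter> (U \<inter> U')) (\<lambda>x. pdiff B (s0 x) (s x))"
    by (rule smooth_fun_subset[OF smooth_sectionD(4)[OF s s0(1)]]) auto
  have b: "smooth_fun A (U0 \<inter> (U \<inter> U')) (\<lambda>x. pdiff B (s0 x) (s' x))"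
    by (rule smooth_fun_subset[OF smooth_sectionD(4)[OF s' s0(1)]]) auto
  have d: "pdiff B (s0 y) (s y) \<in> pgroup B" if "y \<in> U0 \<inter> (U \<inter> U')" for y
    using that loc smooth_sectionD[OF s] by (intro pdiff_props(1)) auto
  have "smooth_fun A (U0 \<inter> (U \<inter> U')) (\<lambda>x. matrix_inv (pdiff B (s0 x) (s x)) ** pdiff B (s0 x) (s' x))"
    using d pgroup_lie_aut by (intro smooth_fun_mm smooth_fun_matrix_inv[OF a o] b) blast
  then have "smooth_fun A (U0 \<inter> (U \<inter> U')) (\<lambda>x. pdiff B (s x) (s' x))"
  proof (rule smooth_fun_cong[OF _ o])
    fix y assume y: "y \<in> U0 \<inter> (U \<inter> U')"
    have "pdiff B (s y) (s0 y) ** pdiff B (s0 y) (s' y) = pdiff B (s y) (s' y)"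
      using y loc smooth_sectionD[OF s] smooth_sectionD[OF s'] by (intro pdiff_trans) auto
    moreover have "pdiff B (s y) (s0 y) = matrix_inv (pdiff B (s0 y) (s y))"
      using y loc smooth_sectionD[OF s] by (intro pdiff_inverse) auto
    ultimately show "matrix_inv (pdiff B (s0 y) (s y)) ** pdiff B (s0 y) (s' y) = pdiff B (s y) (s' y)" by simp
  qed
  then show "\<exists>W. open W \<and> x \<in> W \<and> smooth_fun A (W \<inter> (U \<inter> U')) (\<lambda>x. pdiff B (s x) (s' x))"
    using loc(1) s0(2) by blast
qed

lemma pdiff_section:
  assumes s: "smooth_section A B U s" and s': "smooth_section A B U' s'" and y: "y \<in> U \<inter> U'"
  shows "pdiff B (s y) (s' y) \<in> pgroup B" "pdiff B (s y) (s' y) \<in> lie_aut_group L"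
  using y smooth_sectionD[OF s] smooth_sectionD[OF s'] pdiff_props(1)[of "s y" "s' y"] pgroup_lie_aut by auto

lemma frame_at_pdiff:
  assumes s: "smooth_section A B U s" and s': "smooth_section A B U' s'" and "c \<in> A" "x \<in> U \<inter> U' \<inter> fst c"
  shows "frame_at (pgroup B) c x (\<lambda>y. pdiff B (s y) (s' y))"
  by (rule frame_atI[OF smooth_fun_pdiff[OF s s']])
     (use assms smooth_sectionD(1)[OF s] smooth_sectionD(1)[OF s'] pdiff_section[OF s s'] in auto)

lemma coord_section:
  assumes e: "e \<in> assoc B W" "bproj B e = y" and s: "local_section B U s" and y: "y \<in> U"
  shows "e = belem B (s y) (coord (s y) e)"
proof -
  obtain w where "e = belem B (s y) w" "w = coord (s y) e"
    using assocE[OF e(1) local_sectionD(2)[OF s y]] local_sectionD(3)[OF s y] e(2) by metis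
  then show ?thesis by simp
qed

lemma coord_section_change:
  assumes e: "e \<in> assoc B W" "bproj B e = y" and s: "local_section B U s" and s': "local_section B U' s'"
    and y: "y \<in> U \<inter> U'"
  shows "coord (s' y) e = matrix_inv (pdiff B (s y) (s' y)) *v coord (s y) e"
proof -
  have "e = belem B (s y) (coord (s y) e)" using coord_section[OF e s] y by blast
  moreover have "coord (s' y) (belem B (s y) v) = matrix_inv (pdiff B (s y) (s' y)) *v v" for v
    using y local_sectionD[OF s] local_sectionD[OF s'] by (intro coord_change) auto
  ultimately show ?thesis by metis
qed

text \<open>\<open>smooth_section\<close> supplies transition functions from atlas sections to the
  given section. Its two applications change coordinates in opposite directions, hence the
  disjunction; one direction relies on smoothness of inversion.\<close>

lemma smooth_fun_coord_change:
  assumes V: "open V" "\<And>y. y \<in> V \<Longrightarrow> \<xi> y \<in> assoc B W" "\<And>y. y \<in> V \<Longrightarrow> bproj B (\<xi> y) = y"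
    and s: "local_section B U s" and s': "local_section B U' s'"
    and d: "smooth_fun A (U \<inter> U') (\<lambda>y. pdiff B (s y) (s' y)) \<or> smooth_fun A (U \<inter> U') (\<lambda>y. pdiff B (s' y) (s y))"
    and sm: "smooth_fun A (V \<inter> U) (\<lambda>y. coord (s y) (\<xi> y))"
  shows "smooth_fun A (V \<inter> (U \<inter> U')) (\<lambda>y. coord (s' y) (\<xi> y))"
proof -
  have o: "open (V \<inter> (U \<inter> U'))" "open (U \<inter> U')"
    using V(1) local_sectionD(1)[OF s] local_sectionD(1)[OF s'] by blast+
  have p: "pdiff B (s y) (s' y) \<in> lie_aut_group L" "pdiff B (s' y) (s y) = matrix_inv (pdiff B (s y) (s' y))"
    "matrix_inv (pdiff B (s y) (s' y)) \<in> lie_aut_group L"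
    if "y \<in> U \<inter> U'" for y
    using that local_sectionD[OF s] local_sectionD[OF s'] pdiff_props(1)[of "s y" "s' y"] pgroup_lie_aut
      pdiff_inverse[of "s y" "s' y"] matrix_groupD(3)[OF matrix_group_lie_aut_group] by auto
  have inv: "smooth_fun A (U \<inter> U') (\<lambda>y. matrix_inv (pdiff B (s y) (s' y)))"
    using d
  proof
    assume "smooth_fun A (U \<inter> U') (\<lambda>y. pdiff B (s y) (s' y))"
    then show ?thesis by (rule smooth_fun_matrix_inv[OF _ o(2)]) (rule p)
  next
    assume "smooth_fun A (U \<inter> U') (\<lambda>y. pdiff B (s' y) (s y))"
    then show ?thesis by (rule smooth_fun_cong[OF _ o(2)]) (rule p)
  qed
  have "smooth_fun A (V \<inter> (U \<inter> U')) (\<lambda>y. matrix_inv (pdiff B (s y) (s' y)) *v coord (s y) (\<xi> y))"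
  proof (rule smooth_fun_mv)
    show "smooth_fun A (V \<inter> (U \<inter> U')) (\<lambda>y. matrix_inv (pdiff B (s y) (s' y)))"
      by (rule smooth_fun_subset[OF inv]) auto
    show "smooth_fun A (V \<inter> (U \<inter> U')) (\<lambda>y. coord (s y) (\<xi> y))" by (rule smooth_fun_subset[OF sm]) auto
  qed
  then show ?thesis
  proof (rule smooth_fun_cong[OF _ o(1)])
    fix y assume y: "y \<in> V \<inter> (U \<inter> U')"
    then show "matrix_inv (pdiff B (s y) (s' y)) *v coord (s y) (\<xi> y) = coord (s' y) (\<xi> y)"
      using coord_section_change[OF V(2)[of y] V(3)[of y] s s'] by simp
  qed
qed

text \<open>Smoothness may be tested in any smooth sections covering V. This matters for
  \<open>QC\<close>, whose atlas is holomorphic while the computations use sections with values in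
  \<open>Q\<close>.\<close>

lemma smooth_vsectionI:
  assumes V: "open V" "\<And>y. y \<in> V \<Longrightarrow> \<xi> y \<in> assoc B W" "\<And>y. y \<in> V \<Longrightarrow> bproj B (\<xi> y) = y"
    and loc: "\<And>x. x \<in> V \<Longrightarrow> \<exists>U s. smooth_section A B U s \<and> x \<in> U \<and> smooth_fun A (V \<inter> U) (\<lambda>y. coord (s y) (\<xi> y))"
  shows "smooth_vsection A B W V \<xi>"
proof -
  have "smooth_fun A (V \<inter> U') (\<lambda>y. coord (s' y) (\<xi> y))" if S: "(U', s') \<in> psecs B" for U' s'
  proof (rule smooth_fun_local)
    note loc' = section_local[OF S]
    show "open (V \<inter> U')" using V(1) local_sectionD(1)[OF loc'] by blast
    fix x assume x: "x \<in> V \<inter> U'"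
    then obtain U s where s: "smooth_section A B U s" "x \<in> U" "smooth_fun A (V \<inter> U) (\<lambda>y. coord (s y) (\<xi> y))"
      using loc by blast
    have "smooth_fun A (U \<inter> U') (\<lambda>x. pdiff B (s' x) (s x))" by (rule smooth_sectionD(4)[OF s(1) S])
    then have "smooth_fun A (V \<inter> (U \<inter> U')) (\<lambda>y. coord (s' y) (\<xi> y))"
      using s(1) unfolding smooth_section_def
      by (intro smooth_fun_coord_change[OF V _ loc' _ s(3)]) auto
    then show "\<exists>Y. open Y \<and> x \<in> Y \<and> smooth_fun A (Y \<inter> (V \<inter> U')) (\<lambda>y. coord (s' y) (\<xi> y))"
      using s(2) smooth_sectionD(1)[OF s(1)] by (intro exI[of _ U]) (simp add: Int_ac)
  qed
  then show ?thesis using V unfolding smooth_vsection_def by auto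
qed

lemma smooth_fun_coord:
  assumes x: "smooth_vsection A B W V \<xi>" and s: "smooth_section A B U s"
  shows "smooth_fun A (V \<inter> U) (\<lambda>y. coord (s y) (\<xi> y))"
proof (rule smooth_fun_local)
  have V: "open V" "\<And>y. y \<in> V \<Longrightarrow> \<xi> y \<in> assoc B W" "\<And>y. y \<in> V \<Longrightarrow> bproj B (\<xi> y) = y"
    using x unfolding smooth_vsection_def by auto
  show "open (V \<inter> U)" using V(1) smooth_sectionD(1)[OF s] by blast
  fix y assume y: "y \<in> V \<inter> U"
  obtain U0 s0 where s0: "(U0, s0) \<in> psecs B" "y \<in> U0" using section_cover by blast
  have "smooth_fun A (V \<inter> U0) (\<lambda>y. coord (s0 y) (\<xi> y))" using x s0(1) unfolding smooth_vsection_def by auto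
  moreover have "smooth_fun A (U0 \<inter> U) (\<lambda>x. pdiff B (s0 x) (s x))"
    using smooth_sectionD(4)[OF s s0(1)] by (simp add: Int_commute)
  ultimately have "smooth_fun A (V \<inter> (U0 \<inter> U)) (\<lambda>y. coord (s y) (\<xi> y))"
    using s unfolding smooth_section_def
    by (intro smooth_fun_coord_change[OF V section_local[OF s0(1)]]) auto
  then show "\<exists>Y. open Y \<and> y \<in> Y \<and> smooth_fun A (Y \<inter> (V \<inter> U)) (\<lambda>y. coord (s y) (\<xi> y))"
    using s0(2) local_sectionD(1)[OF section_local[OF s0(1)]] by (intro exI[of _ U0]) (simp add: Int_ac)
qed

text \<open>The transformation rule of a connection without its regularity. It is what makes
  \<open>covd\<close> well defined, and it can be checked for the extended connection by the cocycle
  rule alone.\<close>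

definition gauge_covariant :: "('q, 's, 'n) connection \<Rightarrow> bool" where
  "gauge_covariant N \<longleftrightarrow> (\<forall>U s U' s' c x v. smooth_section A B U s \<longrightarrow> smooth_section A B U' s' \<longrightarrow> c \<in> A \<longrightarrow>
     x \<in> U \<inter> U' \<inter> fst c \<longrightarrow>
     N s' c x v = matrix_inv (pdiff B (s x) (s' x)) *v N s c x v + mcform L (\<lambda>y. pdiff B (s y) (s' y)) c x v)"

text \<open>\<open>covd\<close> ranges over all smooth sections through x. By
  \<open>covariant_derivative_gauge\<close> another section changes the coordinate of the derivative
  by the inverse transition matrix, that is, leaves the element of the bundle unchanged.\<close>

lemma covd_belem:
  assumes N: "gauge_covariant N" and s: "smooth_section A B U s" and c: "c \<in> A" and x: "x \<in> V \<inter> U \<inter> fst c"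
    and V: "open V" "\<And>y. y \<in> V \<Longrightarrow> \<xi> y \<in> assoc B W" "\<And>y. y \<in> V \<Longrightarrow> bproj B (\<xi> y) = y"
    and sm: "smooth_fun A (V \<inter> U) (\<lambda>y. coord (s y) (\<xi> y))"
  shows "covd L A B N \<xi> c x v =
    belem B (s x) (dchart c (\<lambda>y. coord (s y) (\<xi> y)) x v + br L (N s c x v) (coord (s x) (\<xi> x)))"
  unfolding covd_def
proof (rule the_equality)
  let ?X = "\<lambda>s. dchart c (\<lambda>y. coord (s y) (\<xi> y)) x v + br L (N s c x v) (coord (s x) (\<xi> x))"
  show "\<exists>U' s'. smooth_section A B U' s' \<and> x \<in> U' \<and> belem B (s x) (?X s) = belem B (s' x) (?X s')"
    using s x by blast
  fix e assume "\<exists>U' s'. smooth_section A B U' s' \<and> x \<in> U' \<and> e = belem B (s' x) (?X s')"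
  then obtain U' s' where s': "smooth_section A B U' s'" "x \<in> U'" "e = belem B (s' x) (?X s')" by blast
  let ?a = "\<lambda>y. pdiff B (s y) (s' y)"
  have a: "frame_at (lie_aut_group L) c x ?a"
    using frame_at_mono[OF frame_at_pdiff[OF s s'(1) c] pgroup_lie_aut] x s'(2) by blast
  have ls: "local_section B U s" "local_section B U' s'" using s s'(1) unfolding smooth_section_def by auto
  have cc: "coord (s' y) (\<xi> y) = matrix_inv (?a y) *v coord (s y) (\<xi> y)" if "y \<in> V \<inter> U \<inter> U'" for y
    using coord_section_change[OF V(2)[of y] V(3)[of y] ls] that by simp
  have o: "open (V \<inter> U \<inter> U')" "x \<in> V \<inter> U \<inter> U'"
    using V(1) smooth_sectionD(1)[OF s] smooth_sectionD(1)[OF s'(1)] x s'(2) by auto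
  have "N s' c x v = matrix_inv (?a x) *v N s c x v + mcform L ?a c x v"
    using N[unfolded gauge_covariant_def, rule_format, OF s s'(1) c, of x v] x s'(2) by blast
  then have "?X s' = matrix_inv (?a x) *v ?X s"
    using covariant_derivative_gauge[OF a smooth_fun_chart_differentiable[OF sm c] o cc, of v "N s c x v"] x by simp
  moreover have "belem B (s x) w = belem B (s' x) (matrix_inv (?a x) *v w)" for w
    using x s'(2) smooth_sectionD[OF s] smooth_sectionD[OF s'(1)] by (intro belem_change) auto
  ultimately show "e = belem B (s x) (?X s)" using s'(3) by simp
qed

end

section \<open>Bundles induced by equivariant maps\<close>

lemma deckD:
  assumes "\<gamma> \<in> deck p"
  shows "bij \<gamma>" "p (\<gamma> x) = p x" "inv \<gamma> \<in> deck p" "open W \<Longrightarrow> open (\<gamma> ` W)" "\<gamma> (inv \<gamma> x) = x" "inv \<gamma> (\<gamma> x) = x"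
proof -
  have h: "homeomorphism UNIV UNIV \<gamma> (inv \<gamma>)" and p: "p \<circ> \<gamma> = p" using assms unfolding deck_def by auto
  show i: "\<gamma> (inv \<gamma> x) = x" "inv \<gamma> (\<gamma> x) = x" for x using h unfolding homeomorphism_def by auto
  show b: "bij \<gamma>" by (rule bijI') (metis i)+
  show pg: "p (\<gamma> x) = p x" for x using p by (metis comp_apply)
  have "p \<circ> inv \<gamma> = p" using pg i(1) by (metis comp_apply ext)
  then show "inv \<gamma> \<in> deck p"
    using h homeomorphism_sym[of UNIV UNIV \<gamma> "inv \<gamma>"] by (simp add: deck_def inv_inv_eq[OF b])
  show "open W \<Longrightarrow> open (\<gamma> ` W)"
    using homeomorphism_imp_open_map[OF h, of W] by simp
qed

lemma deck_id: "id \<in> deck p"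
  by (simp add: deck_def homeomorphism_def)

lemma deck_comp:
  assumes "\<gamma> \<in> deck p" "\<delta> \<in> deck p"
  shows "\<gamma> \<circ> \<delta> \<in> deck p"
proof -
  have "homeomorphism UNIV UNIV (\<gamma> \<circ> \<delta>) (inv \<delta> \<circ> inv \<gamma>)"
    using assms homeomorphism_compose[of UNIV UNIV \<delta> "inv \<delta>" UNIV \<gamma> "inv \<gamma>"] unfolding deck_def by auto
  moreover have "p \<circ> (\<gamma> \<circ> \<delta>) = p" using assms unfolding deck_def by (simp add: comp_assoc[symmetric])
  ultimately show ?thesis using o_inv_distrib[OF deckD(1)[OF assms(1)] deckD(1)[OF assms(2)]] by (simp add: deck_def)
qed

text \<open>Kept general in \<open>K\<close> because it is used twice: with \<open>TT L\<close> for
  \<psi> and with \<open>H\<close> for its projection f.\<close>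

locale equivariant_map = toda_surface L A + covered_surface A p
  for L :: "'n::finite toda_algebra" and A :: "'s::t2_space atlas" and p :: "'c::t2_space \<Rightarrow> 's" +
  fixes \<mu> :: "('c \<Rightarrow> 'c) \<Rightarrow> 'n cmat" and K :: "'n cmat set" and \<psi> :: "'c \<Rightarrow> 'n cmat set"
  assumes group_K: "matrix_group K" and K_GG: "K \<subseteq> GG L"
    and rep: "representation p (GG L) \<mu>" and equi: "equivariant p \<mu> \<psi>"
    and smooth_map: "smooth_coset_map (lift_atlas A p) (GG L) K \<psi>"
begin

lemma mu_GG: "\<gamma> \<in> deck p \<Longrightarrow> \<mu> \<gamma> \<in> GG L"
  and mu_comp: "\<gamma> \<in> deck p \<Longrightarrow> \<delta> \<in> deck p \<Longrightarrow> \<mu> (\<gamma> \<circ> \<delta>) = \<mu> \<gamma> ** \<mu> \<delta>"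
  using rep unfolding representation_def by auto

lemma GG_invertible: "a \<in> GG L \<Longrightarrow> invertible a"
  using matrix_groupD(2)[OF matrix_group_GG] .

lemma mult_left_cancel: "invertible (a :: 'n cmat) \<Longrightarrow> a ** b = a ** c \<Longrightarrow> b = (c :: 'n cmat)"
proof -
  assume i: "invertible a" and "a ** b = a ** c"
  then have "matrix_inv a ** (a ** b) = matrix_inv a ** (a ** c)" by simp
  then show "b = c" by (simp add: matrix_mul_assoc matrix_inv_mult(2)[OF i])
qed

lemma mu_id: "\<mu> id = mat 1"
proof -
  have "\<mu> id ** \<mu> id = \<mu> id ** mat 1" using mu_comp[OF deck_id deck_id] by simp
  then show ?thesis using mult_left_cancel[OF GG_invertible[OF mu_GG[OF deck_id]]] by blast
qed

lemma mu_inv: "\<gamma> \<in> deck p \<Longrightarrow> \<mu> (inv \<gamma>) ** \<mu> \<gamma> = mat 1"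
  using mu_comp[OF deckD(3), of \<gamma> \<gamma>] mu_id deckD(6)[of \<gamma> p] by (simp add: fun_eq_iff[of "inv \<gamma> \<circ> \<gamma>" id, THEN iffD2])

abbreviation "orbit \<equiv> deck_orbit p \<mu>"

lemma orbit_iff: "(y, k) \<in> orbit x g \<longleftrightarrow> (\<exists>\<gamma>\<in>deck p. y = \<gamma> x \<and> k = \<mu> \<gamma> ** g)"
  unfolding deck_orbit_def by auto

lemma orbit_self: "(x, g) \<in> orbit x g"
  unfolding orbit_iff by (rule bexI[OF _ deck_id]) (simp add: mu_id)

lemma orbit_deck:
  assumes \<gamma>: "\<gamma> \<in> deck p"
  shows "orbit (\<gamma> x) (\<mu> \<gamma> ** g) = orbit x g"
proof -
  have "(y, k) \<in> orbit (\<gamma> x) (\<mu> \<gamma> ** g) \<longleftrightarrow> (y, k) \<in> orbit x g" for y k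
  proof
    assume "(y, k) \<in> orbit (\<gamma> x) (\<mu> \<gamma> ** g)"
    then obtain \<delta> where "\<delta> \<in> deck p" "y = \<delta> (\<gamma> x)" "k = \<mu> \<delta> ** (\<mu> \<gamma> ** g)" unfolding orbit_iff by blast
    then show "(y, k) \<in> orbit x g" unfolding orbit_iff
      by (intro bexI[of _ "\<delta> \<circ> \<gamma>"] deck_comp \<gamma>) (simp_all add: mu_comp \<gamma> matrix_mul_assoc)
  next
    assume "(y, k) \<in> orbit x g"
    then obtain \<delta> where d: "\<delta> \<in> deck p" "y = \<delta> x" "k = \<mu> \<delta> ** g" unfolding orbit_iff by blast
    have "\<mu> (\<delta> \<circ> inv \<gamma>) ** (\<mu> \<gamma> ** g) = \<mu> \<delta> ** (\<mu> (inv \<gamma>) ** \<mu> \<gamma>) ** g"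
      by (simp add: mu_comp[OF d(1) deckD(3)[OF \<gamma>]] matrix_mul_assoc)
    then show "(y, k) \<in> orbit (\<gamma> x) (\<mu> \<gamma> ** g)" unfolding orbit_iff
      using d by (intro bexI[of _ "\<delta> \<circ> inv \<gamma>"] deck_comp deckD(3) \<gamma>) (simp_all add: deckD(6)[OF \<gamma>] mu_inv[OF \<gamma>])
  qed
  then show ?thesis by auto
qed

lemma orbit_eq: "(y, k) \<in> orbit x g \<Longrightarrow> orbit y k = orbit x g"
  unfolding orbit_iff using orbit_deck by blast

lemma local_coset_lift:
  obtains W F where "open W" "x \<in> W" "smooth_fun (lift_atlas A p) W F" "\<And>y. y \<in> W \<Longrightarrow> F y \<in> GG L"
    "\<And>y. y \<in> W \<Longrightarrow> \<psi> y = lcoset (F y) K"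
  using smooth_map unfolding smooth_coset_map_def by metis

lemma psi_coset:
  assumes g: "g \<in> \<psi> x"
  shows "g \<in> GG L" "g' \<in> \<psi> x \<longleftrightarrow> matrix_inv g ** g' \<in> K"
proof -
  obtain h where h: "h \<in> GG L" "\<psi> x = lcoset h K" using local_coset_lift[of x] by metis
  then obtain k where k: "k \<in> K" "g = h ** k" using g unfolding lcoset_def by auto
  show G: "g \<in> GG L" using h k K_GG matrix_groupD(4)[OF matrix_group_GG] by blast
  note ih = GG_invertible[OF h(1)] and ik = matrix_groupD(2)[OF group_K k(1)]
  show "g' \<in> \<psi> x \<longleftrightarrow> matrix_inv g ** g' \<in> K"
  proof
    assume "g' \<in> \<psi> x"
    then obtain k' where k': "k' \<in> K" "g' = h ** k'" using h unfolding lcoset_def by auto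
    have "matrix_inv g ** g' = matrix_inv k ** (matrix_inv h ** h) ** k'"
      by (simp only: k k' matrix_inv_matrix_mult[OF ih ik] matrix_mul_assoc)
    then show "matrix_inv g ** g' \<in> K"
      using k k' matrix_groupD(3,4)[OF group_K] by (simp add: matrix_inv_mult[OF ih])
  next
    assume "matrix_inv g ** g' \<in> K"
    then have "k ** (matrix_inv g ** g') \<in> K" using matrix_groupD(4)[OF group_K k(1)] by blast
    moreover have "h ** (k ** (matrix_inv g ** g')) = g'"
      by (simp add: matrix_mul_assoc k(2)[symmetric] matrix_inv_mult[OF GG_invertible[OF G]])
    ultimately show "g' \<in> \<psi> x" unfolding h(2) lcoset_def by (metis image_eqI)
  qed
qed

lemma psi_act: "g \<in> \<psi> x \<Longrightarrow> k \<in> K \<Longrightarrow> g ** k \<in> \<psi> x"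
  using psi_coset(1)[of g x] psi_coset(2)[of g x "g ** k"] GG_invertible[of g]
  by (simp add: matrix_mul_assoc matrix_inv_mult(2))

lemma psi_nonempty: "\<exists>g. g \<in> \<psi> x"
proof -
  obtain h where "\<psi> x = lcoset h K" using local_coset_lift[of x] by metis
  then have "h ** mat 1 \<in> \<psi> x" using matrix_groupD(1)[OF group_K] unfolding lcoset_def by blast
  then show ?thesis by blast
qed

lemma psi_deck: "\<gamma> \<in> deck p \<Longrightarrow> g \<in> \<psi> x \<Longrightarrow> \<mu> \<gamma> ** g \<in> \<psi> (\<gamma> x)"
  using equi unfolding equivariant_def by blast

abbreviation "P \<equiv> pull_bundle A p \<mu> K \<psi>"

lemma pspace_P: "pspace P = {orbit x g | x g. g \<in> \<psi> x}" and pgroup_P: "pgroup P = K"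
  by (simp_all add: pull_bundle_def Let_def)

lemma pproj_P: "pproj P (orbit x g) = p x"
proof -
  have "(SOME y. y \<in> orbit x g) \<in> orbit x g" using orbit_self by (rule someI)
  then obtain \<gamma> where "\<gamma> \<in> deck p" "fst (SOME y. y \<in> orbit x g) = \<gamma> x" unfolding deck_orbit_def by auto
  then show ?thesis unfolding pull_bundle_def Let_def using deckD(2)[of \<gamma> p] by simp
qed

lemma pact_P: "pact P (orbit x g) b = orbit x (g ** b)"
  unfolding pull_bundle_def Let_def deck_orbit_def by (force simp: matrix_mul_assoc)

lemma psecs_P: "(U, s) \<in> psecs P \<longleftrightarrow> local_section P U s \<and> smooth_fun (lift_atlas A p) (p -` U) (lift_frame p s)"
  unfolding pull_bundle_def Let_def local_section_def by auto

lemma orbit_space: "g \<in> \<psi> x \<Longrightarrow> orbit x g \<in> pspace P"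
  unfolding pspace_P by blast

end

text \<open>That deck transformations act transitively on fibres, and freely as far as the holonomy can see,
  is read off from the given identification with a principal bundle instead of covering theory.\<close>

lemma (in equivariant_map) deck_action_of_bundle_iso:
  assumes Q: "principal B" and iso: "bundle_iso A B P \<iota>"
  shows "p x = p y \<Longrightarrow> \<exists>\<gamma>\<in>deck p. \<gamma> x = y"
    and "\<gamma> \<in> deck p \<Longrightarrow> \<gamma> x = x \<Longrightarrow> \<mu> \<gamma> = mat 1"
proof -
  interpret B: principal B by (rule Q)
  have G: "pgroup B = K" and bij: "bij_betw \<iota> (pspace B) (pspace P)"
    and pr: "\<And>q. q \<in> pspace B \<Longrightarrow> pproj P (\<iota> q) = pproj B q"
    and act: "\<And>q a. q \<in> pspace B \<Longrightarrow> a \<in> K \<Longrightarrow> \<iota> (pact B q a) = pact P (\<iota> q) a"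
    using iso unfolding bundle_iso_def pgroup_P by auto
  have pre: "\<exists>q\<in>pspace B. \<iota> q = e" if "e \<in> pspace P" for e
    using that bij_betw_imp_surj_on[OF bij] by (metis imageE)
  {
    assume xy: "p x = p y"
    obtain g h where gh: "g \<in> \<psi> x" "h \<in> \<psi> y" using psi_nonempty by blast
    obtain q q' where q: "q \<in> pspace B" "\<iota> q = orbit x g" "q' \<in> pspace B" "\<iota> q' = orbit y h"
      using pre[OF orbit_space[OF gh(1)]] pre[OF orbit_space[OF gh(2)]] by blast
    have "pproj B q = pproj B q'" using pr[OF q(1)] pr[OF q(3)] q(2,4) xy by (simp add: pproj_P)
    \<comment> \<open>Transport to B turns the statement about two orbits over one base point into
      transitivity of the structure group; equality of the resulting orbits then exhibits a deck
      transformation.\<close>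
    then obtain a where a: "a \<in> K" "q' = pact B q a" using B.act_ex1[OF q(1,3)] G by blast
    then have "orbit y h = orbit x (g ** a)" using act[OF q(1) a(1)] q by (simp add: pact_P)
    then have "(y, h) \<in> orbit x (g ** a)" using orbit_self by metis
    then show "\<exists>\<gamma>\<in>deck p. \<gamma> x = y" unfolding orbit_iff by blast
  }
  {
    assume \<gamma>: "\<gamma> \<in> deck p" "\<gamma> x = x"
    obtain g where g: "g \<in> \<psi> x" using psi_nonempty by blast
    have "\<mu> \<gamma> ** g \<in> \<psi> x" using psi_deck[OF \<gamma>(1) g] \<gamma>(2) by simp
    \<comment> \<open>A deck transformation fixing x acts on the coset over x as right
      multiplication by this element. The orbit is unchanged, so freeness of the action on B forces
      the element to be the identity.\<close>
    then have a: "matrix_inv g ** (\<mu> \<gamma> ** g) \<in> K" (is "?a \<in> K") using psi_coset(2)[OF g] by blast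
    note ig = GG_invertible[OF psi_coset(1)[OF g]]
    have ga: "g ** ?a = \<mu> \<gamma> ** g" by (simp add: matrix_mul_assoc matrix_inv_mult[OF ig])
    obtain q where q: "q \<in> pspace B" "\<iota> q = orbit x g" using pre[OF orbit_space[OF g]] by blast
    have "\<iota> (pact B q ?a) = orbit (\<gamma> x) (\<mu> \<gamma> ** g)"
      using act[OF q(1) a] q(2) ga \<gamma>(2) by (simp add: pact_P)
    also have "\<dots> = \<iota> q" by (simp add: orbit_deck[OF \<gamma>(1)] q(2))
    finally have "pact B q ?a = q"
      using bij B.act_space[OF q(1)] a q(1) G unfolding bij_betw_def by (metis inj_onD)
    then have "?a = mat 1" using B.act_inject[OF q(1), of ?a "mat 1"] a G B.pgroup_one B.act_one[OF q(1)] by simp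
    then have "\<mu> \<gamma> ** g = g" using ga by simp
    then have "\<mu> \<gamma> ** (g ** matrix_inv g) = g ** matrix_inv g" by (simp only: matrix_mul_assoc)
    then show "\<mu> \<gamma> = mat 1" by (simp add: matrix_inv_mult[OF ig])
  }
qed

locale equivariant_bundle = equivariant_map L A p \<mu> K \<psi>
  for L :: "'n::finite toda_algebra" and A :: "'s::t2_space atlas" and p :: "'c::t2_space \<Rightarrow> 's"
    and \<mu> :: "('c \<Rightarrow> 'c) \<Rightarrow> 'n cmat" and K :: "'n cmat set" and \<psi> :: "'c \<Rightarrow> 'n cmat set" +
  assumes transitive: "\<And>x y. p x = p y \<Longrightarrow> \<exists>\<gamma>\<in>deck p. \<gamma> x = y"
    and free: "\<And>\<gamma> x. \<gamma> \<in> deck p \<Longrightarrow> \<gamma> x = x \<Longrightarrow> \<mu> \<gamma> = mat 1"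
begin

lemma orbit_unique: "(y, k) \<in> orbit x g \<Longrightarrow> (y, k') \<in> orbit x g \<Longrightarrow> k = k'"
proof -
  assume k: "(y, k) \<in> orbit x g" and k': "(y, k') \<in> orbit x g"
  have "(y, k') \<in> orbit y k" using k' unfolding orbit_eq[OF k] .
  then obtain \<gamma> where "\<gamma> \<in> deck p" "y = \<gamma> y" "k' = \<mu> \<gamma> ** k" unfolding orbit_iff by blast
  then show "k = k'" using free[of \<gamma> y] by simp
qed

lemma fibre_orbit:
  assumes e: "e \<in> pspace P" "pproj P e = p x"
  obtains g where "g \<in> \<psi> x" "e = orbit x g"
proof -
  obtain y h where h: "h \<in> \<psi> y" "e = orbit y h" using e(1) unfolding pspace_P by blast
  then have "p y = p x" using e(2) pproj_P by simp
  then obtain \<gamma> where \<gamma>: "\<gamma> \<in> deck p" "\<gamma> y = x" using transitive by blast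
  show ?thesis using that[of "\<mu> \<gamma> ** h"] psi_deck[OF \<gamma>(1) h(1)] orbit_deck[OF \<gamma>(1), of y h] \<gamma>(2) h(2) by simp
qed

lemma lift_frame_eq: "s (p x) = orbit x g \<Longrightarrow> lift_frame p s x = g"
  unfolding lift_frame_def using orbit_self orbit_unique by (metis (no_types, lifting) the_equality)

lemma local_section_P:
  assumes "local_section P U s"
  shows "open U" "p x \<in> U \<Longrightarrow> s (p x) = orbit x (lift_frame p s x)" "p x \<in> U \<Longrightarrow> lift_frame p s x \<in> \<psi> x"
    "p x \<in> U \<Longrightarrow> lift_frame p s x \<in> GG L" "p x \<in> U \<Longrightarrow> \<gamma> \<in> deck p \<Longrightarrow> lift_frame p s (\<gamma> x) = \<mu> \<gamma> ** lift_frame p s x"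
proof -
  show "open U" using assms unfolding local_section_def by blast
  have *: "s (p x) = orbit x (lift_frame p s x) \<and> lift_frame p s x \<in> \<psi> x" if x: "p x \<in> U" for x
  proof -
    obtain g where "g \<in> \<psi> x" "s (p x) = orbit x g"
      using fibre_orbit[of "s (p x)" x] assms x unfolding local_section_def by metis
    then show ?thesis using lift_frame_eq by metis
  qed
  show "p x \<in> U \<Longrightarrow> s (p x) = orbit x (lift_frame p s x)" and "p x \<in> U \<Longrightarrow> lift_frame p s x \<in> \<psi> x" using * by blast+
  then show "p x \<in> U \<Longrightarrow> lift_frame p s x \<in> GG L" using psi_coset(1) by blast
  show "lift_frame p s (\<gamma> x) = \<mu> \<gamma> ** lift_frame p s x" if "p x \<in> U" "\<gamma> \<in> deck p"
    using *[OF that(1)] that(2) by (intro lift_frame_eq) (simp add: deckD(2)[OF that(2)] orbit_deck)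
qed

text \<open>The lifted frame read on the base through the inverse of p on a sheet. Derivatives can
  then be taken in the charts of the surface itself.\<close>

definition base_frame :: "'c set \<Rightarrow> ('s \<Rightarrow> ('c \<times> 'n cmat) set) \<Rightarrow> 's \<Rightarrow> 'n cmat" where
  "base_frame W s u = lift_frame p s (inv_into W p u)"

lemma inv_sheet: "sheet W \<Longrightarrow> x \<in> W \<Longrightarrow> inv_into W p (p x) = x"
  unfolding sheet_def by (simp add: inv_into_f_f)

lemma base_frame_p: "sheet W \<Longrightarrow> x \<in> W \<Longrightarrow> base_frame W s (p x) = lift_frame p s x"
  unfolding base_frame_def by (simp add: inv_sheet)

lemma sheet_over: obtains W where "sheet W" "u \<in> p ` W"
  using sheet_exists surj_p by (metis imageI surjD)

lemma open_sheet_image: "sheet W \<Longrightarrow> open (p ` W)"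
  unfolding sheet_def using open_image_p by blast

lemma smooth_base_frame:
  assumes s: "(U, s) \<in> psecs P" and W: "sheet W"
  shows "smooth_fun A (U \<inter> p ` W) (base_frame W s)"
proof -
  have U: "open U" using s unfolding psecs_P local_section_def by blast
  have W': "sheet (W \<inter> p -` U)"
    using W open_vimage_p[OF U] by (intro sheet_subset[OF W]) (auto simp: sheet_def)
  have "smooth_fun A (p ` (W \<inter> p -` U)) (base_frame W s)"
    using s unfolding psecs_P
    by (intro smooth_fun_descend[OF _ W', of "p -` U" "lift_frame p s"]) (auto simp: base_frame_p[OF W])
  moreover have "p ` (W \<inter> p -` U) = U \<inter> p ` W" by auto
  ultimately show ?thesis by simp
qed

text \<open>One sheet above each point is enough: any other preimage is reached by a deck
  transformation \<gamma>, and the frame there is the constant \<open>\<mu> \<gamma>\<close> times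
  the known one.\<close>

lemma psecs_PI:
  assumes s: "local_section P U s"
    and loc: "\<And>u. u \<in> U \<Longrightarrow> \<exists>W. sheet W \<and> u \<in> p ` W \<and> smooth_fun A (U \<inter> p ` W) (base_frame W s)"
  shows "(U, s) \<in> psecs P"
proof -
  note sD = local_section_P[OF s]
  have "smooth_fun (lift_atlas A p) (p -` U) (lift_frame p s)"
  proof (rule smooth_fun_lift[OF sD(1)])
    fix y assume y: "p y \<in> U"
    obtain W where W: "sheet W" "p y \<in> p ` W" "smooth_fun A (U \<inter> p ` W) (base_frame W s)" using loc[OF y] by blast
    then obtain x where x: "x \<in> W" "p x = p y" by auto
    then obtain \<gamma> where \<gamma>: "\<gamma> \<in> deck p" "\<gamma> x = y" using transitive by blast
    have "open (\<gamma> ` W)" using W(1) deckD(4)[OF \<gamma>(1)] unfolding sheet_def by blast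
    moreover have "lift_frame p s y' = \<mu> \<gamma> ** base_frame W s (p y')" if y': "y' \<in> \<gamma> ` W" "p y' \<in> U" for y'
    proof -
      obtain x' where x': "x' \<in> W" "y' = \<gamma> x'" using y' by blast
      then have "p x' = p y'" using deckD(2)[OF \<gamma>(1)] by simp
      then show ?thesis using sD(5)[of x' \<gamma>] x' y' \<gamma>(1) base_frame_p[OF W(1) x'(1), of s] by simp
    qed
    moreover have "smooth_fun A (U \<inter> p ` W) (\<lambda>u. \<mu> \<gamma> ** base_frame W s u)"
      by (intro smooth_fun_mm smooth_fun_const W)
    ultimately show "\<exists>Y O' g. open Y \<and> y \<in> Y \<and> open O' \<and> p y \<in> O' \<and> smooth_fun A O' g \<and>
         (\<forall>y'\<in>Y. p y' \<in> U \<longrightarrow> p y' \<in> O' \<longrightarrow> lift_frame p s y' = g (p y'))"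
      using x \<gamma>(2) y W(2) sD(1) open_sheet_image[OF W(1)]
      by (intro exI[of _ "\<gamma> ` W"] exI[of _ "U \<inter> p ` W"] exI[of _ "\<lambda>u. \<mu> \<gamma> ** base_frame W s u"]) auto
  qed
  then show ?thesis using s unfolding psecs_P by blast
qed

text \<open>A smooth local lift of the map to \<open>GG L\<close>, restricted to a sheet, becomes a
  section of the quotient by taking orbits.\<close>

lemma local_sections_exist: "\<exists>U s. (U, s) \<in> psecs P \<and> u \<in> U"
proof -
  obtain x where x: "p x = u" using surj_p by (metis surjD)
  obtain W0 F where W0: "open W0" "x \<in> W0" "smooth_fun (lift_atlas A p) W0 F"
      "\<And>y. y \<in> W0 \<Longrightarrow> \<psi> y = lcoset (F y) K" using local_coset_lift[of x] by metis
  obtain W1 where W1: "sheet W1" "x \<in> W1" using sheet_exists .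
  define W where "W = W1 \<inter> W0"
  have W: "sheet W" "x \<in> W" "W \<subseteq> W0"
    using sheet_subset[OF W1(1), of W] W0 W1 unfolding W_def sheet_def by auto
  have F: "F y \<in> \<psi> y" if "y \<in> W" for y
    using that W(3) W0(4) matrix_groupD(1)[OF group_K] unfolding lcoset_def by force
  define s where "s u = orbit (inv_into W p u) (F (inv_into W p u))" for u
  have sp: "s (p y) = orbit y (F y)" if "y \<in> W" for y using that W(1) by (simp add: s_def inv_sheet)
  have ls: "local_section P (p ` W) s"
    unfolding local_section_def using open_sheet_image[OF W(1)] sp F by (auto simp: pproj_P intro: orbit_space)
  have "smooth_fun A (p ` W) (base_frame W s)"
    by (rule smooth_fun_descend[OF W0(3) W(1,3)]) (simp add: base_frame_p[OF W(1)] lift_frame_eq[of s, OF sp])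
  then have "(p ` W, s) \<in> psecs P" using W(1) by (intro psecs_PI[OF ls]) auto
  then show ?thesis using x W(2) by blast
qed

lemma principal_P: "principal P"
proof
  show "principal_bundle_with (\<lambda>_ _. True) P"
    unfolding principal_bundle_with_def
  proof (intro conjI ballI impI)
    fix e e' assume e: "e \<in> pspace P" "e' \<in> pspace P" "pproj P e = pproj P e'"
    obtain x where x: "p x = pproj P e" using surj_p by (metis surjD)
    obtain g where g: "g \<in> \<psi> x" "e = orbit x g" using fibre_orbit[OF e(1) x[symmetric]] .
    obtain h where h: "h \<in> \<psi> x" "e' = orbit x h" using fibre_orbit[OF e(2)] e(3) x by metis
    note ig = GG_invertible[OF psi_coset(1)[OF g(1)]]
    show "\<exists>!a. a \<in> pgroup P \<and> e' = pact P e a"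
    proof (rule ex1I[of _ "matrix_inv g ** h"])
      show "matrix_inv g ** h \<in> pgroup P \<and> e' = pact P e (matrix_inv g ** h)"
        using psi_coset(2)[OF g(1)] h g(2) by (simp add: pgroup_P pact_P matrix_mul_assoc matrix_inv_mult[OF ig])
      fix a assume "a \<in> pgroup P \<and> e' = pact P e a"
      then have "orbit x h = orbit x (g ** a)" using h g by (simp add: pact_P)
      then have "h = g ** a" using orbit_self orbit_unique by metis
      then show "a = matrix_inv g ** h" by (simp add: matrix_mul_assoc matrix_inv_mult[OF ig])
    qed
  next
    show "(\<Union>(U, s)\<in>psecs P. U) = UNIV" using local_sections_exist by fast
  next
    fix S assume "S \<in> psecs P"
    then show "case S of (U, s) \<Rightarrow> local_section P U s" using psecs_P by auto
  next
    fix e b assume "e \<in> pspace P" and b: "b \<in> pgroup P"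
    then obtain x g where "g \<in> \<psi> x" "e = orbit x g" unfolding pspace_P by blast
    then show "pact P e b \<in> pspace P" "pproj P (pact P e b) = pproj P e"
      using b psi_act by (auto simp: pact_P pproj_P pgroup_P intro!: orbit_space)
  qed (auto simp: pgroup_P pspace_P pact_P group_K matrix_mul_assoc)
qed

sublocale P: lie_bundle L A P
  by (intro lie_bundle.intro toda_surface_axioms principal_P lie_bundle_axioms.intro)
     (use K_GG GG_lie_aut pgroup_P in auto)

lemma pdiff_P:
  assumes s: "local_section P U s" and s': "local_section P U' s'" and x: "p x \<in> U \<inter> U'"
  shows "pdiff P (s (p x)) (s' (p x)) = matrix_inv (lift_frame p s x) ** lift_frame p s' x"
proof -
  note a = local_section_P(2-4)[OF s, of x] and b = local_section_P(2-4)[OF s', of x]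
  let ?d = "matrix_inv (lift_frame p s x) ** lift_frame p s' x"
  have d: "?d \<in> K" using psi_coset(2)[of "lift_frame p s x" x] a b x by blast
  have "s' (p x) = pact P (s (p x)) ?d"
    using a b x GG_invertible by (simp add: pact_P matrix_mul_assoc matrix_inv_mult)
  then show ?thesis using P.pdiff_act[of "s (p x)" ?d] s x d unfolding local_section_def pgroup_P by auto
qed

lemma lift_frame_pdiff:
  assumes s: "local_section P U s" and s': "local_section P U' s'" and x: "p x \<in> U \<inter> U'"
  shows "lift_frame p s' x = lift_frame p s x ** pdiff P (s (p x)) (s' (p x))"
  using pdiff_P[OF assms] local_section_P(4)[OF s, of x] x GG_invertible
  by (simp add: matrix_mul_assoc matrix_inv_mult)

lemma base_frame_GG:
  assumes "local_section P U s" "sheet W" "u \<in> U \<inter> p ` W"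
  shows "base_frame W s u \<in> GG L"
  using assms local_section_P(4)[OF assms(1)] base_frame_p[OF assms(2)] by auto

lemma smooth_transition_P:
  assumes s: "(U, s) \<in> psecs P" and s': "(U', s') \<in> psecs P"
  shows "smooth_fun A (U \<inter> U') (\<lambda>u. pdiff P (s u) (s' u))"
proof (rule smooth_fun_local)
  have ls: "local_section P U s" "local_section P U' s'" using s s' psecs_P by auto
  show o: "open (U \<inter> U')" using ls unfolding local_section_def by blast
  fix u assume "u \<in> U \<inter> U'"
  obtain W where W: "sheet W" "u \<in> p ` W" using sheet_over .
  have o': "open (p ` W \<inter> (U \<inter> U'))" using o open_sheet_image[OF W(1)] by blast
  have "smooth_fun A (p ` W \<inter> (U \<inter> U')) (\<lambda>u. matrix_inv (base_frame W s u) ** base_frame W s' u)"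
  proof (intro smooth_fun_mm smooth_fun_matrix_inv)
    show "smooth_fun A (p ` W \<inter> (U \<inter> U')) (base_frame W s)" "smooth_fun A (p ` W \<inter> (U \<inter> U')) (base_frame W s')"
      by (rule smooth_fun_subset[OF smooth_base_frame[OF s W(1)]] smooth_fun_subset[OF smooth_base_frame[OF s' W(1)]]; auto)+
    show "base_frame W s x \<in> lie_aut_group L" if "x \<in> p ` W \<inter> (U \<inter> U')" for x
      using base_frame_GG[OF ls(1) W(1), of x] that GG_lie_aut by auto
  qed (rule o')
  then have "smooth_fun A (p ` W \<inter> (U \<inter> U')) (\<lambda>u. pdiff P (s u) (s' u))"
  proof (rule smooth_fun_cong[OF _ o'])
    fix w assume "w \<in> p ` W \<inter> (U \<inter> U')"
    then obtain x where "x \<in> W" "w = p x" "p x \<in> U \<inter> U'" by auto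
    then show "matrix_inv (base_frame W s w) ** base_frame W s' w = pdiff P (s w) (s' w)"
      using pdiff_P[OF ls] base_frame_p[OF W(1)] by simp
  qed
  then show "\<exists>Y. open Y \<and> u \<in> Y \<and> smooth_fun A (Y \<inter> (U \<inter> U')) (\<lambda>u. pdiff P (s u) (s' u))"
    using W open_sheet_image by blast
qed

text \<open>The atlas of the pull-back bundle is already maximal, since the frame of a smooth
  section is an atlas frame times a smooth transition function. Hence a bundle isomorphism carries
  sections of \<open>Q\<close> to atlas sections.\<close>

lemma smooth_section_P_iff: "smooth_section A P U s \<longleftrightarrow> (U, s) \<in> psecs P"
proof
  assume "(U, s) \<in> psecs P"
  then show "smooth_section A P U s"
    unfolding smooth_section_def using psecs_P smooth_transition_P by (auto simp: Int_commute)
next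
  assume s: "smooth_section A P U s"
  have ls: "local_section P U s" using s unfolding smooth_section_def by blast
  show "(U, s) \<in> psecs P"
  proof (rule psecs_PI[OF ls])
    fix u assume u: "u \<in> U"
    obtain U0 s0 where s0: "(U0, s0) \<in> psecs P" "u \<in> U0" using local_sections_exist by blast
    have ls0: "local_section P U0 s0" using s0(1) psecs_P by blast
    obtain W1 where W1: "sheet W1" "u \<in> p ` W1" using sheet_over .
    define W where "W = W1 \<inter> p -` U0"
    have W: "sheet W" "u \<in> p ` W" "p ` W \<subseteq> U0"
      using sheet_subset[OF W1(1), of W] W1 s0(2) open_vimage_p ls0 unfolding W_def sheet_def local_section_def by auto
    have o: "open (U \<inter> p ` W)" using ls open_sheet_image[OF W(1)] unfolding local_section_def by blast
    have "smooth_fun A (U \<inter> p ` W) (\<lambda>w. base_frame W s0 w ** pdiff P (s0 w) (s w))"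
    proof (rule smooth_fun_mm)
      show "smooth_fun A (U \<inter> p ` W) (base_frame W s0)"
        by (rule smooth_fun_subset[OF smooth_base_frame[OF s0(1) W(1)]]) (use W(3) in auto)
      have "smooth_fun A (U \<inter> U0) (\<lambda>w. pdiff P (s0 w) (s w))" using s s0(1) unfolding smooth_section_def by auto
      then show "smooth_fun A (U \<inter> p ` W) (\<lambda>w. pdiff P (s0 w) (s w))" by (rule smooth_fun_subset) (use W(3) in auto)
    qed
    then have "smooth_fun A (U \<inter> p ` W) (base_frame W s)"
    proof (rule smooth_fun_cong[OF _ o])
      fix w assume "w \<in> U \<inter> p ` W"
      then obtain x where "x \<in> W" "w = p x" "p x \<in> U0 \<inter> U" using W(3) by auto
      then show "base_frame W s0 w ** pdiff P (s0 w) (s w) = base_frame W s w"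
        using lift_frame_pdiff[OF ls0 ls] base_frame_p[OF W(1)] by simp
    qed
    then show "\<exists>W. sheet W \<and> u \<in> p ` W \<and> smooth_fun A (U \<inter> p ` W) (base_frame W s)" using W by blast
  qed
qed

lemma frame_at_base_frame:
  assumes s: "(U, s) \<in> psecs P" and W: "sheet W" and u: "u \<in> U \<inter> p ` W \<inter> fst c" and c: "c \<in> A"
  shows "frame_at (GG L) c u (base_frame W s)"
proof (rule frame_atI[OF smooth_base_frame[OF s W]])
  have ls: "local_section P U s" using s psecs_P by blast
  then show "open (U \<inter> p ` W)" using open_sheet_image[OF W] unfolding local_section_def by blast
  show "base_frame W s y \<in> GG L" if "y \<in> U \<inter> p ` W" for y using base_frame_GG[OF ls W that] .
qed (use u c in auto)

lemma mcform_lift: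
  assumes c: "c \<in> A" and W: "sheet W" "p ` W \<subseteq> fst c" and x: "x \<in> W"
  shows "mcform L (lift_frame p s) (W, snd c \<circ> p) x v = mcform L (base_frame W s) c (p x) v"
proof -
  obtain V z where cV: "c = (V, z)" by (cases c)
  have cA: "(V, z) \<in> A" and WV: "p ` W \<subseteq> V" using c W(2) cV by auto
  have o: "open (z ` (p ` W))"
    using open_chart_image_Int[OF cA open_sheet_image[OF W(1)]] WV by (simp add: Int_absorb2)
  have e: "(lift_frame p s \<circ> inv_into W (z \<circ> p)) w = (base_frame W s \<circ> inv_into V z) w" if w: "w \<in> z ` p ` W" for w
  proof -
    obtain y where y: "y \<in> W" "w = z (p y)" using w by auto
    then have "p y \<in> V" using WV by blast
    then show ?thesis
      using y inv_lift_chart[OF _ cA WV y(1)] W(1) inv_chart[OF cA] base_frame_p[OF W(1) y(1), of s]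
      unfolding sheet_def by simp
  qed
  have "((lift_frame p s \<circ> inv_into W (z \<circ> p)) has_derivative D) (at (z (p x))) \<longleftrightarrow>
        ((base_frame W s \<circ> inv_into V z) has_derivative D) (at (z (p x)))" for D
    using has_derivative_transform_within_open[OF _ o, of _ D "z (p x)" UNIV] e x by (metis image_eqI)
  then have "dchart (W, z \<circ> p) (lift_frame p s) x v = dchart (V, z) (base_frame W s) (p x) v"
    unfolding dchart_def frechet_derivative_def by simp
  then show ?thesis unfolding mcform_def cV using base_frame_p[OF W(1) x, of s] by simp
qed

text \<open>Over a common neighbourhood the two frames differ by the constant
  \<open>\<mu> \<gamma>\<close> on the left, where \<gamma> moves one preimage of u to the
  other.\<close>

lemma mcform_sheet_change:
  assumes s: "(U, s) \<in> psecs P" and c: "c \<in> A" and W: "sheet W" "sheet W'"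
    and u: "u \<in> U \<inter> p ` W \<inter> p ` W' \<inter> fst c"
  shows "mcform L (base_frame W' s) c u v = mcform L (base_frame W s) c u v"
proof -
  have ls: "local_section P U s" using s psecs_P by blast
  obtain x x' where x: "x \<in> W" "p x = u" "x' \<in> W'" "p x' = u" using u by auto
  then obtain \<gamma> where \<gamma>: "\<gamma> \<in> deck p" "\<gamma> x = x'" using transitive by metis
  define Y where "Y = p ` (W' \<inter> \<gamma> ` W) \<inter> U"
  have "open (W' \<inter> \<gamma> ` W)" using W deckD(4)[OF \<gamma>(1), of W] unfolding sheet_def by blast
  then have Y: "open Y" unfolding Y_def using open_image_p local_section_P(1)[OF ls] by blast
  have "x' \<in> W' \<inter> \<gamma> ` W" using x \<gamma>(2) by blast
  then have uY: "u \<in> Y" unfolding Y_def using x(4) u by blast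
  have "base_frame W' s w = \<mu> \<gamma> ** base_frame W s w" if wY: "w \<in> Y" for w
  proof -
    obtain y where y: "y \<in> W" "\<gamma> y \<in> W'" "w = p (\<gamma> y)" "w \<in> U" using wY unfolding Y_def by auto
    then have wy: "w = p y" using deckD(2)[OF \<gamma>(1)] by simp
    have "base_frame W' s w = lift_frame p s (\<gamma> y)" using base_frame_p[OF W(2) y(2), of s] y(3) by simp
    also have "\<dots> = \<mu> \<gamma> ** lift_frame p s y" using local_section_P(5)[OF ls _ \<gamma>(1), of y] y(4) wy by simp
    finally show ?thesis using base_frame_p[OF W(1) y(1), of s] wy by simp
  qed
  then have "mcform L (base_frame W' s) c u v = mcform L (\<lambda>w. \<mu> \<gamma> ** base_frame W s w) c u v"
    using u by (intro mcform_cong[OF c Y uY]) auto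
  also have "\<dots> = mcform L (base_frame W s) c u v"
  proof (rule mcform_const_mult)
    show "\<mu> \<gamma> \<in> lie_aut_group L" using mu_GG[OF \<gamma>(1)] GG_lie_aut by blast
    show "frame_at (lie_aut_group L) c u (base_frame W s)"
      using frame_at_mono[OF frame_at_base_frame[OF s W(1) _ c] GG_lie_aut] u by blast
  qed
  finally show ?thesis .
qed

text \<open>Makes the descent of the form computable. For existence the sheet is shrunk into the
  domain of the chart; uniqueness is the independence of sheet and preimage.\<close>

lemma mc_component_eq:
  assumes s: "(U, s) \<in> psecs P" and c: "c \<in> A" and W: "sheet W" and u: "u \<in> U \<inter> p ` W \<inter> fst c"
  shows "mc_component L p pr s c u v = pr (mcform L (base_frame W s) c u v)"
  unfolding mc_component_def descend_def
proof (rule the_equality)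
  define W1 where "W1 = W \<inter> p -` fst c"
  have W1: "sheet W1" "p ` W1 \<subseteq> fst c"
    using sheet_subset[OF W, of W1] W open_vimage_p[of "fst c"] open_chart[of "fst c" "snd c"] c
    unfolding W1_def sheet_def by auto
  obtain x where x: "x \<in> W1" "p x = u" using u unfolding W1_def by auto
  have "mcform L (lift_frame p s) (W1, snd c \<circ> p) x v = mcform L (base_frame W s) c u v"
    using mcform_lift[OF c W1 x(1), of s v] mcform_sheet_change[OF s c W W1(1), of u v] u x by auto
  then show "\<exists>W' x. open W' \<and> inj_on p W' \<and> p ` W' \<subseteq> fst c \<and> x \<in> W' \<and> p x = u \<and>
      pr (mcform L (base_frame W s) c u v) = pr (mcform L (lift_frame p s) (W', snd c \<circ> p) x v)"
    using W1 x unfolding sheet_def by metis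
  fix \<xi> assume "\<exists>W' x. open W' \<and> inj_on p W' \<and> p ` W' \<subseteq> fst c \<and> x \<in> W' \<and> p x = u \<and>
      \<xi> = pr (mcform L (lift_frame p s) (W', snd c \<circ> p) x v)"
  then obtain W' x where W': "sheet W'" "p ` W' \<subseteq> fst c" "x \<in> W'" "p x = u"
      "\<xi> = pr (mcform L (lift_frame p s) (W', snd c \<circ> p) x v)" unfolding sheet_def by blast
  then show "\<xi> = pr (mcform L (base_frame W s) c u v)"
    using mcform_lift[OF c W'(1-3), of s v] mcform_sheet_change[OF s c W W'(1), of u v] u imageI[OF W'(3), of p] by auto
qed

lemma mcform_base_frame_change:
  assumes s: "(U, s) \<in> psecs P" and s': "(U', s') \<in> psecs P" and c: "c \<in> A" and W: "sheet W"
    and u: "u \<in> U \<inter> U' \<inter> p ` W \<inter> fst c"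
  shows "mcform L (base_frame W s') c u v =
    matrix_inv (pdiff P (s u) (s' u)) *v mcform L (base_frame W s) c u v + mcform L (\<lambda>y. pdiff P (s y) (s' y)) c u v"
proof -
  have ls: "local_section P U s" "local_section P U' s'" using s s' psecs_P by auto
  define Y where "Y = U \<inter> U' \<inter> p ` W"
  have Y: "open Y" "u \<in> Y" using ls open_sheet_image[OF W] u unfolding Y_def local_section_def by auto
  have "base_frame W s' y = base_frame W s y ** pdiff P (s y) (s' y)" if yY: "y \<in> Y" for y
  proof -
    obtain x where "x \<in> W" "y = p x" "p x \<in> U \<inter> U'" using yY unfolding Y_def by auto
    then show ?thesis using lift_frame_pdiff[OF ls] base_frame_p[OF W] by simp
  qed
  then have "mcform L (base_frame W s') c u v = mcform L (\<lambda>y. base_frame W s y ** pdiff P (s y) (s' y)) c u v"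
    using u by (intro mcform_cong[OF c Y]) auto
  also have "\<dots> = matrix_inv (pdiff P (s u) (s' u)) *v mcform L (base_frame W s) c u v + mcform L (\<lambda>y. pdiff P (s y) (s' y)) c u v"
  proof (rule mcform_mult)
    show "frame_at (lie_aut_group L) c u (base_frame W s)"
      using frame_at_mono[OF frame_at_base_frame[OF s W _ c] GG_lie_aut] u by blast
    show "frame_at (lie_aut_group L) c u (\<lambda>y. pdiff P (s y) (s' y))"
      using frame_at_mono[OF P.frame_at_pdiff[of U s U' s' c u] P.pgroup_lie_aut] s s' c u smooth_section_P_iff by blast
  qed
  finally show ?thesis .
qed

lemma mcform_base_frame_real_g:
  assumes "(U, s) \<in> psecs P" "c \<in> A" "sheet W" "u \<in> U \<inter> p ` W \<inter> fst c"
  shows "mcform L (base_frame W s) c u v \<in> real_g L"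
  using mcform_GG[OF frame_at_base_frame] assms by blast

lemma frame_at_transition:
  assumes "(U, s) \<in> psecs P" "(U', s') \<in> psecs P" "c \<in> A" "u \<in> U \<inter> U' \<inter> fst c"
  shows "frame_at K c u (\<lambda>y. pdiff P (s y) (s' y))"
  using P.frame_at_pdiff[of U s U' s' c u] assms smooth_section_P_iff pgroup_P by metis

text \<open>A change of section turns \<omega> into a \<omega> + \<eta>, where \<eta> comes from the
  transition function and lies in \<kk>, the Lie algebra of \<open>K\<close>. The projection has to
  absorb \<eta> and commute with a for the result to be tensorial.\<close>

lemma mc_pullback_belem:
  assumes s: "(U, s) \<in> psecs P" and c: "c \<in> A" and u: "u \<in> U \<inter> fst c"
    and pr: "\<And>a \<omega> \<eta>. a \<in> K \<Longrightarrow> \<omega> \<in> real_g L \<Longrightarrow> \<eta> \<in> \<kk> \<Longrightarrow> pr (a *v \<omega> + \<eta>) = a *v pr \<omega>"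
    and \<kk>: "\<And>b v. frame_at K c u b \<Longrightarrow> mcform L b c u v \<in> \<kk>"
  shows "mc_pullback L p P pr c u v = belem P (s u) (mc_component L p pr s c u v)"
  unfolding mc_pullback_def
proof (rule the_equality)
  show "\<exists>U' s'. (U', s') \<in> psecs P \<and> u \<in> U' \<and>
     belem P (s u) (mc_component L p pr s c u v) = belem P (s' u) (mc_component L p pr s' c u v)"
    using s u by blast
  fix e assume "\<exists>U' s'. (U', s') \<in> psecs P \<and> u \<in> U' \<and> e = belem P (s' u) (mc_component L p pr s' c u v)"
  then obtain U' s' where s': "(U', s') \<in> psecs P" "u \<in> U'" "e = belem P (s' u) (mc_component L p pr s' c u v)" by blast
  obtain W where W: "sheet W" "u \<in> p ` W" using sheet_over .
  let ?a = "pdiff P (s u) (s' u)" and ?\<omega> = "mcform L (base_frame W s) c u v"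
  have ls: "s u \<in> pspace P" "s' u \<in> pspace P" "pproj P (s u) = pproj P (s' u)"
    using s s'(1,2) u unfolding psecs_P local_section_def by auto
  have a: "matrix_inv ?a \<in> K" using P.pdiff_props(1)[OF ls] P.pgroup_inv by (simp add: pgroup_P)
  have "mc_component L p pr s' c u v = pr (matrix_inv ?a *v ?\<omega> + mcform L (\<lambda>y. pdiff P (s y) (s' y)) c u v)"
    using mc_component_eq[OF s'(1) c W(1), of u pr v] mcform_base_frame_change[OF s s'(1) c W(1), of u v] u s'(2) W(2) by simp
  also have "\<dots> = matrix_inv ?a *v pr ?\<omega>"
    using mcform_base_frame_real_g[OF s c W(1), of u v] frame_at_transition[OF s s'(1) c, of u] u s'(2) W(2)
    by (intro pr[OF a] \<kk>) auto
  also have "\<dots> = matrix_inv ?a *v mc_component L p pr s c u v"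
    using mc_component_eq[OF s c W(1), of u pr v] u W(2) by simp
  finally show "e = belem P (s u) (mc_component L p pr s c u v)"
    using P.belem_change[OF ls] s'(3) by simp
qed

end

section \<open>The Higgs bundle of a Toda pair\<close>

locale toda_map = toda_surface L A + toda_compact L H + covered_surface A p
  for L :: "'n::finite toda_algebra" and A :: "'s::t2_space atlas" and H :: "'n cmat set"
    and p :: "'c::t2_space \<Rightarrow> 's" +
  fixes QC :: "('q, 's, 'n) pbundle"
    and \<phi> :: "('s, ('q, 'n) belem) form"
    and Q :: "'q set"
    and N :: "('q, 's, 'n) connection"
    and \<mu> :: "('c \<Rightarrow> 'c) \<Rightarrow> 'n cmat"
    and \<psi> :: "'c \<Rightarrow> 'n cmat set"
    and \<iota> :: "'q \<Rightarrow> ('c \<times> 'n cmat) set"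
  assumes toda_pair: "toda_pair L A QC \<phi>"
    and reduction: "reduction L A QC Q"
    and chern: "chern_connection L A QC Q N"
    and representation: "representation p (GG L) \<mu>"
    and smooth_psi: "smooth_coset_map (lift_atlas A p) (GG L) (TT L) \<psi>"
    and equivariant_psi: "equivariant p \<mu> \<psi>"
    and iso: "bundle_iso A (sub_bundle A QC (TT L) Q) (pull_bundle A p \<mu> (TT L) \<psi>) \<iota>"
    and connection_eq: "\<And>U s c u v. (U, s) \<in> psecs (sub_bundle A QC (TT L) Q) \<Longrightarrow> c \<in> A \<Longrightarrow> u \<in> U \<inter> fst c \<Longrightarrow>
           N s c u v = mc_component L p (component (real_t L) (real_p L)) (\<iota> \<circ> s) c u v"
    and form_eq: "\<And>c u v. c \<in> A \<Longrightarrow> u \<in> fst c \<Longrightarrow>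
           mc_pullback L p (pull_bundle A p \<mu> (TT L) \<psi>) (component (real_p L) (real_t L)) c u v
           = {(\<iota> q, w) | q w. q \<in> Q \<and> (q, w) \<in> badd (\<phi> c u v) (brho L QC Q (\<phi> c u v))}"
begin

abbreviation "SQ \<equiv> sub_bundle A QC (TT L) Q"

definition f :: "'c \<Rightarrow> 'n cmat set" where "f = coset_proj H \<circ> \<psi>"

lemma pgroup_QC: "pgroup QC = TC L"
  and phi_assoc: "c \<in> A \<Longrightarrow> x \<in> fst c \<Longrightarrow> \<phi> c x v \<in> assoc QC (g1 L) \<and> bproj QC (\<phi> c x v) = x"
  and phi_scale: "c \<in> A \<Longrightarrow> x \<in> fst c \<Longrightarrow> \<phi> c x v = bscale v (\<phi> c x 1)"
  using toda_pair unfolding toda_pair_def by blast+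

lemma principal_QC: "principal QC"
  using toda_pair principal_bundle_with_principal unfolding toda_pair_def by blast

sublocale QC: lie_bundle L A QC
  by (intro lie_bundle.intro toda_surface_axioms principal_QC lie_bundle_axioms.intro)
     (use TC_lie_aut pgroup_QC in auto)

lemma Q_subset: "Q \<subseteq> pspace QC"
  and principal_with_SQ: "principal_bundle_with (smooth_fun A) SQ"
  using reduction unfolding reduction_def by auto

lemma SQ_simps: "pspace SQ = Q" "pproj SQ = pproj QC" "pact SQ = pact QC" "pgroup SQ = TT L"
  "(U, s) \<in> psecs SQ \<longleftrightarrow> smooth_section A QC U s \<and> s ` U \<subseteq> Q"
  by (auto simp: sub_bundle_def)

sublocale SQ: principal SQ by (rule principal_bundle_with_principal[OF principal_with_SQ])

lemma SQ_transition:
  assumes "(U, s) \<in> psecs SQ" "(U', s') \<in> psecs SQ"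
  shows "smooth_fun A (U \<inter> U') (\<lambda>x. pdiff SQ (s x) (s' x))"
proof -
  have "\<forall>(U, s)\<in>psecs SQ. \<forall>(U', s')\<in>psecs SQ. smooth_fun A (U \<inter> U') (\<lambda>x. pdiff SQ (s x) (s' x))"
    using principal_with_SQ[unfolded principal_bundle_with_def] by (elim conjE)
  then show ?thesis using assms by fast
qed

lemma smooth_section_SQ: "(U, s) \<in> psecs SQ \<Longrightarrow> smooth_section A SQ U s"
  unfolding smooth_section_def using SQ.section_local SQ_transition by (auto simp: Int_commute)

lemma equivariant_map_T: "equivariant_map L A p \<mu> (TT L) \<psi>"
  by unfold_locales (rule matrix_group_TT TT_subset_GG representation equivariant_psi smooth_psi)+

sublocale T: equivariant_bundle L A p \<mu> "TT L" \<psi>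
  by (intro equivariant_bundle.intro equivariant_map_T equivariant_bundle_axioms.intro)
     (rule equivariant_map.deck_action_of_bundle_iso[OF equivariant_map_T SQ.principal_axioms iso]; assumption)+

lemma f_lcoset:
  assumes "\<psi> x = lcoset g (TT L)"
  shows "f x = lcoset g H"
proof -
  have "(\<exists>k t. h = g ** t ** k \<and> t \<in> TT L \<and> k \<in> H) \<longleftrightarrow> (\<exists>k\<in>H. h = g ** k)" for h
  proof
    assume "\<exists>k t. h = g ** t ** k \<and> t \<in> TT L \<and> k \<in> H"
    then obtain k t where "h = g ** (t ** k)" "t \<in> TT L" "k \<in> H" by (auto simp: matrix_mul_assoc)
    then show "\<exists>k\<in>H. h = g ** k" using TT_subset_H matrix_groupD(4)[OF matrix_group_H] by blast
  next
    assume "\<exists>k\<in>H. h = g ** k"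
    then obtain k where "k \<in> H" "h = g ** mat 1 ** k" by auto
    then show "\<exists>k t. h = g ** t ** k \<and> t \<in> TT L \<and> k \<in> H" using matrix_groupD(1)[OF matrix_group_TT] by blast
  qed
  moreover have "f x = {h. \<exists>k t. h = g ** t ** k \<and> t \<in> TT L \<and> k \<in> H}"
    unfolding f_def comp_def coset_proj_def assms lcoset_def by blast
  ultimately show ?thesis unfolding lcoset_def by blast
qed

lemma psi_subset_f: "\<psi> x \<subseteq> f x"
proof -
  obtain g where "\<psi> x = lcoset g (TT L)" using T.local_coset_lift[of x] by metis
  then show ?thesis using f_lcoset TT_subset_H unfolding lcoset_def by auto
qed

lemma equivariant_map_F: "equivariant_map L A p \<mu> H f"
proof unfold_locales
  have "(\<lambda>g. a ** g) ` coset_proj H S = coset_proj H ((\<lambda>g. a ** g) ` S)" for a S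
  proof -
    have "coset_proj H S' = (\<lambda>(g, k). g ** k) ` (S' \<times> H)" for S'
      unfolding coset_proj_def by auto
    moreover have "(\<lambda>g. a ** g) ` S \<times> H = (\<lambda>(g, k). (a ** g, k)) ` (S \<times> H)" by auto
    ultimately show ?thesis by (simp only: image_image case_prod_beta matrix_mul_assoc fst_conv snd_conv)
  qed
  then show "equivariant p \<mu> f"
    using equivariant_psi unfolding equivariant_def f_def by simp
  show "smooth_coset_map (lift_atlas A p) (GG L) H f"
    using smooth_psi f_lcoset unfolding smooth_coset_map_def by meson
qed (rule matrix_group_H H_subset_GG representation)+

text \<open>Transitivity and freeness concern only the deck group and \<mu>, so what was derived
  from \<open>Q\<close> for \<psi> is available for f.\<close>

sublocale F: equivariant_bundle L A p \<mu> H f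
  by (intro equivariant_bundle.intro equivariant_map_F equivariant_bundle_axioms.intro T.transitive T.free)

lemma iota_props: "q \<in> Q \<Longrightarrow> \<iota> q \<in> pspace T.P" "q \<in> Q \<Longrightarrow> pproj T.P (\<iota> q) = pproj QC q"
    "q \<in> Q \<Longrightarrow> a \<in> TT L \<Longrightarrow> \<iota> (pact QC q a) = pact T.P (\<iota> q) a" "inj_on \<iota> Q"
  using iso unfolding bundle_iso_def bij_betw_def by (auto simp: SQ_simps)

text \<open>As \<psi> x is contained in f x, an orbit that is a point of the bundle of \<psi> is
  literally a point of the bundle of f; the reduction from \<open>H\<close> to \<open>TT L\<close>
  is an inclusion of sets.\<close>

lemma T_to_F:
  assumes "e \<in> pspace T.P"
  shows "e \<in> pspace F.P" "pproj F.P e = pproj T.P e" "pact F.P e a = pact T.P e a"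
  using assms psi_subset_f unfolding T.pspace_P
  by (auto simp: T.pproj_P F.pproj_P T.pact_P F.pact_P intro!: F.orbit_space)

lemma iota_section_T:
  assumes "(U, s) \<in> psecs SQ"
  shows "(U, \<iota> \<circ> s) \<in> psecs T.P"
  using iso SQ.section_local[OF assms] smooth_section_SQ[OF assms] T.smooth_section_P_iff
  unfolding bundle_iso_def by blast

lemma iota_section_F:
  assumes s: "(U, s) \<in> psecs SQ"
  shows "(U, \<iota> \<circ> s) \<in> psecs F.P"
  using iota_section_T[OF s] unfolding T.psecs_P F.psecs_P local_section_def
  using T_to_F by auto

sublocale X: principal_extension F.P "HC L H"
  by (intro principal_extension.intro F.principal_P principal_extension_axioms.intro matrix_group_HC)
     (simp add: F.pgroup_P H_subset_HC)

abbreviation "EE \<equiv> extend_bundle F.P (HC L H)"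

lemma PC_eq: "PC L A p \<mu> H f = EE"
  by (simp add: PC_def PP_def)

sublocale EE: lie_bundle L A EE
  by (intro lie_bundle.intro toda_surface_axioms X.principal_E lie_bundle_axioms.intro)
     (simp add: X.pgroup_E HC_lie_aut)

definition emb :: "('c \<times> 'n cmat) set \<Rightarrow> (('c \<times> 'n cmat) set \<times> 'n cmat) set" where
  "emb e = extend_elem F.P e (mat 1)"

lemma smooth_section_emb:
  assumes s: "(U, s) \<in> psecs F.P"
  shows "smooth_section A EE U (\<lambda>x. emb (s x))"
  unfolding smooth_section_def
proof (intro conjI ballI)
  have "(U, \<lambda>x. emb (s x)) \<in> psecs EE" using s unfolding X.psecs_E emb_def by blast
  then show ls: "local_section EE U (\<lambda>x. emb (s x))" by (rule EE.section_local)
  fix S assume "S \<in> psecs EE"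
  then obtain U' s' where S: "S = (U', \<lambda>x. extend_elem F.P (s' x) (mat 1))" and s': "(U', s') \<in> psecs F.P"
    unfolding X.psecs_E by blast
  have ls: "local_section F.P U s" "local_section F.P U' s'" using s s' F.psecs_P by auto
  have o: "open (U \<inter> U')" using ls unfolding local_section_def by blast
  have "smooth_fun A (U \<inter> U') (\<lambda>x. pdiff F.P (s' x) (s x))"
    using F.smooth_transition_P[OF s' s] by (simp add: Int_commute)
  then have "smooth_fun A (U \<inter> U') (\<lambda>x. pdiff EE (extend_elem F.P (s' x) (mat 1)) (emb (s x)))"
  proof (rule smooth_fun_cong[OF _ o])
    fix y assume "y \<in> U \<inter> U'"
    then show "pdiff F.P (s' y) (s y) = pdiff EE (extend_elem F.P (s' y) (mat 1)) (emb (s y))"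
      unfolding emb_def using ls by (intro X.pdiff_E[symmetric]) (auto simp: local_section_def)
  qed
  then show "case S of (U', s') \<Rightarrow> smooth_fun A (U \<inter> U') (\<lambda>x. pdiff EE (s' x) (emb (s x)))" using S by simp
qed

lemma gauge_covariant_N: "QC.gauge_covariant N"
proof -
  have "is_connection L A (tC L) QC N" using chern unfolding chern_connection_def by blast
  then show ?thesis unfolding is_connection_def QC.gauge_covariant_def Let_def by blast
qed

subsection \<open>The connection on the extended bundle\<close>

abbreviation "N0 \<equiv> mc_component L p (component (real_h L) (real_m L))"
abbreviation "DE \<equiv> extend_connection L F.P (HC L H) N0"

lemma DD_eq_DE: "DD L A p \<mu> H f = DE"
  by (simp add: DD_def PP_def)

lemma mcform_H:
  assumes "frame_at H c x b"
  shows "mcform L b c x v \<in> real_h L"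
proof -
  have "H \<subseteq> lie_aut_group L" using H_subset_GG GG_lie_aut by blast
  moreover have "surj (sigma L)" using sigma_sigma by (metis surjI)
  ultimately have "sigma L (mcform L b c x v) = mcform L b c x v"
    using mcform_fixed[OF assms _ H_sigma linear_sigma _ sigma_br] by blast
  then show ?thesis using mcform_GG[OF frame_at_mono[OF assms H_subset_GG], of v] by (simp add: real_h_def)
qed

text \<open>The term \<eta> of a change of section is even: it survives in the first component,
  which thereby transforms as a connection form, and vanishes in the second, which is
  tensorial.\<close>

lemma H_even_part:
  assumes a: "a \<in> H" and w: "\<omega> \<in> real_g L" and h: "\<eta> \<in> real_h L"
  shows "component (real_h L) (real_m L) (a *v \<omega> + \<eta>) = a *v component (real_h L) (real_m L) \<omega> + \<eta>"
    "component (real_m L) (real_h L) (a *v \<omega> + \<eta>) = a *v component (real_m L) (real_h L) \<omega>"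
proof -
  have "a *v \<omega> \<in> real_g L" using GG_real_g a w H_subset_GG by blast
  then have g: "a *v \<omega> + \<eta> \<in> real_g L" using h real_h_subset_real_g subspace_add[OF subspace_real_g] by blast
  have c: "a \<in> commuting_group (sigma L)" using a H_sigma by blast
  have "sigma L \<eta> = \<eta>" using h by (simp add: real_h_def)
  then show "component (real_h L) (real_m L) (a *v \<omega> + \<eta>) = a *v component (real_h L) (real_m L) \<omega> + \<eta>"
    "component (real_m L) (real_h L) (a *v \<omega> + \<eta>) = a *v component (real_m L) (real_h L) \<omega>"
    by (simp_all add: component_real_h[OF g] component_real_h[OF w] component_real_m[OF g] component_real_m[OF w]
        even_part_add odd_part_add parts_commute[OF c] even_part_fixed odd_part_fixed)
qed

lemma N0_change:
  assumes s: "(U, s) \<in> psecs F.P" and s': "(U', s') \<in> psecs F.P" and c: "c \<in> A" and u: "u \<in> U \<inter> U' \<inter> fst c"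
  shows "N0 s' c u v = matrix_inv (pdiff F.P (s u) (s' u)) *v N0 s c u v + mcform L (\<lambda>y. pdiff F.P (s y) (s' y)) c u v"
proof -
  obtain W where W: "sheet W" "u \<in> p ` W" using F.sheet_over .
  let ?\<omega> = "mcform L (F.base_frame W s) c u v"
  have b: "frame_at H c u (\<lambda>y. pdiff F.P (s y) (s' y))" by (rule F.frame_at_transition[OF s s' c u])
  have a: "matrix_inv (pdiff F.P (s u) (s' u)) \<in> H"
    using frame_at_value[OF b] matrix_groupD(3)[OF matrix_group_H] by blast
  have w: "?\<omega> \<in> real_g L" using F.mcform_base_frame_real_g[OF s c W(1)] u W(2) by blast
  have "N0 s' c u v = component (real_h L) (real_m L) (matrix_inv (pdiff F.P (s u) (s' u)) *v ?\<omega> + mcform L (\<lambda>y. pdiff F.P (s y) (s' y)) c u v)"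
    using F.mc_component_eq[OF s' c W(1)] F.mcform_base_frame_change[OF s s' c W(1)] u W(2) by simp
  then show ?thesis
    using H_even_part(1)[OF a w mcform_H[OF b]] F.mc_component_eq[OF s c W(1)] u W(2) by simp
qed

text \<open>\<open>extend_connection\<close> admits any atlas section as reference. Two references
  are related by the cocycle identity \<open>ab\<close>, and the product rule together with
  \<open>N0_change\<close> makes their values agree.\<close>

lemma DE_eq:
  assumes s: "smooth_section A EE U s" and s0: "(U0, s0) \<in> psecs F.P" and c: "c \<in> A" and x: "x \<in> U \<inter> U0 \<inter> fst c"
  shows "DE s c x v = matrix_inv (pdiff EE (emb (s0 x)) (s x)) *v N0 s0 c x v
           + mcform L (\<lambda>y. pdiff EE (emb (s0 y)) (s y)) c x v"
  unfolding extend_connection_def Let_def emb_def[symmetric]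
proof (rule the_equality)
  let ?a = "\<lambda>s0 y. pdiff EE (emb (s0 y)) (s y)"
  let ?X = "\<lambda>s0. matrix_inv (?a s0 x) *v N0 s0 c x v + mcform L (?a s0) c x v"
  show "\<exists>U1 s1. (U1, s1) \<in> psecs F.P \<and> x \<in> U1 \<and> ?X s0 = ?X s1" using s0 x by blast
  fix \<xi> assume "\<exists>U1 s1. (U1, s1) \<in> psecs F.P \<and> x \<in> U1 \<and> \<xi> = ?X s1"
  then obtain U1 s1 where s1: "(U1, s1) \<in> psecs F.P" "x \<in> U1" "\<xi> = ?X s1" by blast
  let ?b = "\<lambda>y. pdiff F.P (s0 y) (s1 y)"
  note e0 = smooth_section_emb[OF s0] and e1 = smooth_section_emb[OF s1(1)]
  have ls: "local_section F.P U0 s0" "local_section F.P U1 s1" using s0 s1 F.psecs_P by auto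
  define Y where "Y = U \<inter> U0 \<inter> U1"
  have Y: "open Y" "x \<in> Y"
    using ls EE.smooth_sectionD(1)[OF s] x s1(2) unfolding Y_def local_section_def by auto
  have ab: "?a s0 y = ?b y ** ?a s1 y" if "y \<in> Y" for y
  proof -
    have "pdiff EE (emb (s0 y)) (emb (s1 y)) = ?b y"
      unfolding emb_def using ls that by (intro X.pdiff_E) (auto simp: local_section_def Y_def)
    moreover have "pdiff EE (emb (s0 y)) (emb (s1 y)) ** ?a s1 y = ?a s0 y"
      using that EE.smooth_sectionD[OF s] EE.smooth_sectionD[OF e0] EE.smooth_sectionD[OF e1]
      by (intro EE.pdiff_trans) (auto simp: Y_def)
    ultimately show ?thesis by simp
  qed
  have b: "frame_at (lie_aut_group L) c x ?b"
    using F.frame_at_transition[OF s0 s1(1) c, of x] H_subset_GG GG_lie_aut x s1(2) frame_at_mono by blast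
  have a1: "frame_at (lie_aut_group L) c x (?a s1)"
    using frame_at_mono[OF EE.frame_at_pdiff[OF e1 s c] EE.pgroup_lie_aut] x s1(2) by blast
  have "mcform L (?a s0) c x v = mcform L (\<lambda>y. ?b y ** ?a s1 y) c x v"
    using x by (intro mcform_cong[OF c Y]) (auto simp: ab)
  also have "\<dots> = matrix_inv (?a s1 x) *v mcform L ?b c x v + mcform L (?a s1) c x v"
    by (rule mcform_mult[OF b a1])
  finally have m: "mcform L (?a s0) c x v = matrix_inv (?a s1 x) *v mcform L ?b c x v + mcform L (?a s1) c x v" .
  have i: "matrix_inv (?a s0 x) = matrix_inv (?a s1 x) ** matrix_inv (?b x)"
    unfolding ab[OF Y(2)] using frame_at_value[OF b] frame_at_value[OF a1] lie_aut_group_invertible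
    by (intro matrix_inv_matrix_mult(1)) auto
  have "N0 s1 c x v = matrix_inv (?b x) *v N0 s0 c x v + mcform L ?b c x v"
    using N0_change[OF s0 s1(1) c, of x v] x s1(2) by blast
  then show "\<xi> = ?X s0"
    unfolding s1(3) m i by (simp add: mv.add_right matrix_vector_mul_assoc)
qed

lemma DE_emb:
  assumes s0: "(U0, s0) \<in> psecs F.P" and c: "c \<in> A" and x: "x \<in> U0 \<inter> fst c"
  shows "DE (\<lambda>y. emb (s0 y)) c x v = N0 s0 c x v"
proof -
  note e0 = smooth_section_emb[OF s0]
  have r: "pdiff EE (emb (s0 y)) (emb (s0 y)) = mat 1" if "y \<in> U0" for y
    using EE.smooth_sectionD(2)[OF e0 that] by (rule EE.pdiff_refl)
  have "mcform L (\<lambda>y. pdiff EE (emb (s0 y)) (emb (s0 y))) c x v = mcform L (\<lambda>_. mat 1) c x v"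
    using x EE.smooth_sectionD(1)[OF e0] by (intro mcform_cong[OF c]) (auto simp: r)
  then show ?thesis using DE_eq[OF e0 s0 c, of x v] x r[of x] by (simp add: mcform_const)
qed

text \<open>Both sections are compared with one atlas section \<open>s0\<close>; the rule is then
  the product rule for the factorisation \<open>ad\<close> of the transition functions.\<close>

lemma gauge_covariant_DE: "EE.gauge_covariant DE"
  unfolding EE.gauge_covariant_def
proof (intro allI impI)
  fix U s U' s' c x v
  assume s: "smooth_section A EE U s" and s': "smooth_section A EE U' s'" and c: "c \<in> A" and x: "x \<in> U \<inter> U' \<inter> fst c"
  obtain U0 s0 where s0: "(U0, s0) \<in> psecs F.P" "x \<in> U0" using F.local_sections_exist by blast
  note e0 = smooth_section_emb[OF s0(1)]
  let ?a = "\<lambda>y. pdiff EE (emb (s0 y)) (s y)" and ?a' = "\<lambda>y. pdiff EE (emb (s0 y)) (s' y)" and ?d = "\<lambda>y. pdiff EE (s y) (s' y)"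
  define Y where "Y = U \<inter> U' \<inter> U0"
  have Y: "open Y" "x \<in> Y"
    using EE.smooth_sectionD(1)[OF s] EE.smooth_sectionD(1)[OF s'] EE.smooth_sectionD(1)[OF e0] x s0(2)
    unfolding Y_def by auto
  have ad: "?a' y = ?a y ** ?d y" if "y \<in> Y" for y
    using that EE.smooth_sectionD[OF s] EE.smooth_sectionD[OF s'] EE.smooth_sectionD[OF e0]
    by (intro EE.pdiff_trans[symmetric]) (auto simp: Y_def)
  have a: "frame_at (lie_aut_group L) c x ?a"
    using frame_at_mono[OF EE.frame_at_pdiff[OF e0 s c] EE.pgroup_lie_aut] x s0(2) by blast
  have d: "frame_at (lie_aut_group L) c x ?d"
    using frame_at_mono[OF EE.frame_at_pdiff[OF s s' c] EE.pgroup_lie_aut] x by blast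
  have "mcform L ?a' c x v = mcform L (\<lambda>y. ?a y ** ?d y) c x v"
    using x by (intro mcform_cong[OF c Y]) (auto simp: ad)
  also have "\<dots> = matrix_inv (?d x) *v mcform L ?a c x v + mcform L ?d c x v"
    by (rule mcform_mult[OF a d])
  finally have m: "mcform L ?a' c x v = matrix_inv (?d x) *v mcform L ?a c x v + mcform L ?d c x v" .
  have i: "matrix_inv (?a' x) = matrix_inv (?d x) ** matrix_inv (?a x)"
    unfolding ad[OF Y(2)] using frame_at_value[OF a] frame_at_value[OF d] lie_aut_group_invertible
    by (intro matrix_inv_matrix_mult(1)) auto
  have x0: "x \<in> U \<inter> U0 \<inter> fst c" "x \<in> U' \<inter> U0 \<inter> fst c" using x s0(2) by auto
  show "DE s' c x v = matrix_inv (?d x) *v DE s c x v + mcform L ?d c x v"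
    unfolding DE_eq[OF s s0(1) c x0(1)] DE_eq[OF s' s0(1) c x0(2)] m i
    by (simp add: mv.add_right matrix_vector_mul_assoc)
qed

end

context toda_map begin

subsection \<open>The isomorphism of vector bundles\<close>

text \<open>Each point of \<open>Q\<close> is a frame of both bundles, through \<iota> and
  \<open>emb\<close> on the Higgs side. Two such frames in one fibre differ by \<open>TT L\<close>,
  which lies in both structure groups; \<theta> matches the coordinates in them.\<close>

definition \<theta> :: "((('c \<times> 'n cmat) set \<times> 'n cmat) set, 'n) belem \<Rightarrow> ('q, 'n) belem" where
  "\<theta> e = (THE e'. \<exists>q v. q \<in> Q \<and> e = belem EE (emb (\<iota> q)) v \<and> e' = belem QC q v)"

lemma iota_F: "q \<in> Q \<Longrightarrow> \<iota> q \<in> pspace F.P" and pproj_iota: "q \<in> Q \<Longrightarrow> pproj F.P (\<iota> q) = pproj QC q"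
  using iota_props(1,2) T_to_F by auto

lemma emb_space: "q \<in> Q \<Longrightarrow> emb (\<iota> q) \<in> pspace EE"
  unfolding emb_def by (rule X.extend_elem_space[OF iota_F matrix_groupD(1)[OF matrix_group_HC]])

lemma pproj_emb: "q \<in> Q \<Longrightarrow> pproj EE (emb (\<iota> q)) = pproj QC q"
  unfolding emb_def by (simp add: X.pproj_E[OF iota_F] pproj_iota)

lemma TT_subset_HC: "TT L \<subseteq> HC L H" using TT_subset_H H_subset_HC by blast

lemma emb_act:
  assumes q: "q \<in> Q" and b: "b \<in> TT L"
  shows "emb (\<iota> (pact QC q b)) = pact EE (emb (\<iota> q)) b"
proof -
  have bH: "b \<in> pgroup F.P" using b TT_subset_H by (auto simp: F.pgroup_P)
  have "\<iota> (pact QC q b) = pact F.P (\<iota> q) b"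
    using iota_props(1)[OF q] iota_props(3)[OF q b] T_to_F(3)[of "\<iota> q" b] by simp
  then have "emb (\<iota> (pact QC q b)) = extend_elem F.P (pact F.P (\<iota> q) b) (matrix_inv b ** b)"
    using F.P.pgroup_invertible[OF bH] by (simp add: emb_def matrix_inv_mult)
  also have "\<dots> = extend_elem F.P (\<iota> q) b" by (rule X.extend_elem_act[OF iota_F[OF q] bH])
  finally show ?thesis by (simp add: emb_def X.pact_E)
qed

lemma Q_fibre: "\<exists>q\<in>Q. pproj QC q = u"
proof -
  obtain U s where "(U, s) \<in> psecs SQ" "u \<in> U" using SQ.section_cover by blast
  then show ?thesis using SQ.section_local[of U s] by (auto simp: local_section_def SQ_simps(1,2))
qed

lemma theta_belem:
  assumes q: "q \<in> Q"
  shows "\<theta> (belem EE (emb (\<iota> q)) v) = belem QC q v"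
  unfolding \<theta>_def
proof (rule the_equality)
  show "\<exists>q' v'. q' \<in> Q \<and> belem EE (emb (\<iota> q)) v = belem EE (emb (\<iota> q')) v' \<and> belem QC q v = belem QC q' v'"
    using q by blast
  fix e' assume "\<exists>q' v'. q' \<in> Q \<and> belem EE (emb (\<iota> q)) v = belem EE (emb (\<iota> q')) v' \<and> e' = belem QC q' v'"
  then obtain q' v' where q': "q' \<in> Q" and e: "belem EE (emb (\<iota> q)) v = belem EE (emb (\<iota> q')) v'"
    and e': "e' = belem QC q' v'" by blast
  have "pproj QC q = pproj QC q'"
    using EE.bproj_belem[OF emb_space[OF q], of v] EE.bproj_belem[OF emb_space[OF q'], of v'] e pproj_emb q q' by simp
  then obtain b where b: "b \<in> TT L" "q' = pact QC q b" using SQ.act_ex1[of q q'] q q' by (auto simp: SQ_simps)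
  have bC: "b \<in> pgroup EE" "b \<in> pgroup QC" using b(1) TT_subset_HC TT_subset_TC by (auto simp: X.pgroup_E pgroup_QC)
  have "belem EE (emb (\<iota> q')) (matrix_inv b *v v) = belem EE (emb (\<iota> q)) v"
    unfolding b(2) emb_act[OF q b(1)] by (rule EE.belem_act[OF emb_space[OF q] bC(1)])
  then have "v' = matrix_inv b *v v" using e EE.belem_inject[OF emb_space[OF q']] by simp
  then show "e' = belem QC q v"
    unfolding e' b(2) using QC.belem_act[of q b v] q Q_subset bC(2) by auto
qed

lemma assoc_EE_belem:
  assumes e: "e \<in> assoc EE (mC L)" and q: "q \<in> Q" "pproj QC q = bproj EE e"
  obtains w where "w \<in> mC L" "e = belem EE (emb (\<iota> q)) w" "\<theta> e = belem QC q w"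
proof -
  obtain w a v where w: "e = belem EE (emb (\<iota> q)) w" "a \<in> pgroup EE" "v \<in> mC L" "w = a *v v"
    using EE.assocE[OF e emb_space[OF q(1)]] q(2) pproj_emb[OF q(1)] by metis
  then have "w \<in> mC L" using mC_invariant HC_sigma by (auto simp: X.pgroup_E)
  then show ?thesis using that w(1) theta_belem[OF q(1)] by blast
qed

lemma assoc_QC_belem:
  assumes e: "e \<in> assoc QC (mC L)" and q: "q \<in> Q" "pproj QC q = bproj QC e"
  obtains w where "w \<in> mC L" "e = belem QC q w"
proof -
  have qs: "q \<in> pspace QC" using q(1) Q_subset by blast
  obtain w a v where w: "e = belem QC q w" "a \<in> pgroup QC" "v \<in> mC L" "w = a *v v"
    using QC.assocE[OF e qs] q(2) by metis
  then have "w \<in> mC L" using mC_invariant TC_sigma by (auto simp: pgroup_QC)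
  then show ?thesis using that w(1) by blast
qed

lemma bij_theta: "bij_betw \<theta> (assoc EE (mC L)) (assoc QC (mC L))"
  unfolding bij_betw_def
proof
  show "inj_on \<theta> (assoc EE (mC L))"
  proof (rule inj_onI)
    fix e e' assume e: "e \<in> assoc EE (mC L)" and e': "e' \<in> assoc EE (mC L)" and t: "\<theta> e = \<theta> e'"
    obtain q where q: "q \<in> Q" "pproj QC q = bproj EE e" using Q_fibre by blast
    obtain q' where q': "q' \<in> Q" "pproj QC q' = bproj EE e'" using Q_fibre by blast
    obtain w where w: "w \<in> mC L" "e = belem EE (emb (\<iota> q)) w" "\<theta> e = belem QC q w" using assoc_EE_belem[OF e q] .
    obtain w' where w': "\<theta> e' = belem QC q' w'" using assoc_EE_belem[OF e' q'] .
    have "pproj QC q = pproj QC q'"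
      using QC.bproj_belem[OF subsetD[OF Q_subset q(1)], of w] QC.bproj_belem[OF subsetD[OF Q_subset q'(1)], of w']
        t w(3) w' by simp
    then obtain w2 where w2: "e' = belem EE (emb (\<iota> q)) w2" "\<theta> e' = belem QC q w2"
      using assoc_EE_belem[OF e' q(1)] q'(2) by metis
    have "w = w2" using t w(3) w2(2) QC.belem_inject[of q w w2] q(1) Q_subset by auto
    then show "e = e'" using w(2) w2(1) by simp
  qed
  show "\<theta> ` assoc EE (mC L) = assoc QC (mC L)"
  proof
    show "\<theta> ` assoc EE (mC L) \<subseteq> assoc QC (mC L)"
    proof clarify
      fix e assume e: "e \<in> assoc EE (mC L)"
      obtain q where q: "q \<in> Q" "pproj QC q = bproj EE e" using Q_fibre by blast
      obtain w where "w \<in> mC L" "\<theta> e = belem QC q w" using assoc_EE_belem[OF e q] .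
      then show "\<theta> e \<in> assoc QC (mC L)" using q(1) Q_subset QC.belem_in_assoc by auto
    qed
    show "assoc QC (mC L) \<subseteq> \<theta> ` assoc EE (mC L)"
    proof
      fix e assume e: "e \<in> assoc QC (mC L)"
      obtain q where q: "q \<in> Q" "pproj QC q = bproj QC e" using Q_fibre by blast
      obtain w where w: "w \<in> mC L" "e = belem QC q w" using assoc_QC_belem[OF e q] .
      then have "e = \<theta> (belem EE (emb (\<iota> q)) w)" by (simp add: theta_belem[OF q(1)])
      then show "e \<in> \<theta> ` assoc EE (mC L)" using EE.belem_in_assoc[OF emb_space[OF q(1)] w(1)] by blast
    qed
  qed
qed

lemma SQ_sectionD:
  assumes "(U, s) \<in> psecs SQ"
  shows "smooth_section A QC U s" "x \<in> U \<Longrightarrow> s x \<in> Q" "x \<in> U \<Longrightarrow> pproj QC (s x) = x" "open U"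
    "smooth_section A EE U (\<lambda>x. emb (\<iota> (s x)))"
  using assms QC.smooth_sectionD[of U s] smooth_section_emb[OF iota_section_F[OF assms]]
  by (auto simp: SQ_simps(5) image_subset_iff)

lemma coord_theta:
  assumes e: "e \<in> assoc EE (mC L)" and q: "q \<in> Q" "pproj QC q = bproj EE e"
  shows "coord q (\<theta> e) = coord (emb (\<iota> q)) e"
proof -
  obtain w where "e = belem EE (emb (\<iota> q)) w" "\<theta> e = belem QC q w" using assoc_EE_belem[OF e q] .
  then show ?thesis using EE.coord_belem[OF emb_space[OF q(1)]] QC.coord_belem[of q w] q(1) Q_subset by auto
qed

lemma bproj_theta:
  assumes e: "e \<in> assoc EE (mC L)"
  shows "bproj QC (\<theta> e) = bproj EE e"
proof -
  obtain q where q: "q \<in> Q" "pproj QC q = bproj EE e" using Q_fibre by blast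
  obtain w where "\<theta> e = belem QC q w" using assoc_EE_belem[OF e q] .
  then show ?thesis using QC.bproj_belem[of q w] q Q_subset by auto
qed

lemma theta_in_assoc: "e \<in> assoc EE (mC L) \<Longrightarrow> \<theta> e \<in> assoc QC (mC L)"
  using bij_theta unfolding bij_betw_def by blast

lemma smooth_coord_theta:
  assumes V: "open V" "\<And>y. y \<in> V \<Longrightarrow> \<xi> y \<in> assoc EE (mC L)" "\<And>y. y \<in> V \<Longrightarrow> bproj EE (\<xi> y) = y"
    and s: "(U, s) \<in> psecs SQ"
  shows "smooth_fun A (V \<inter> U) (\<lambda>y. coord (emb (\<iota> (s y))) (\<xi> y)) \<longleftrightarrow>
         smooth_fun A (V \<inter> U) (\<lambda>y. coord (s y) ((\<theta> \<circ> \<xi>) y))"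
proof -
  have o: "open (V \<inter> U)" using V(1) SQ_sectionD(4)[OF s] by blast
  have e: "coord (s y) ((\<theta> \<circ> \<xi>) y) = coord (emb (\<iota> (s y))) (\<xi> y)" if "y \<in> V \<inter> U" for y
    using coord_theta[of "\<xi> y" "s y"] V(2,3) SQ_sectionD(2,3)[OF s] that by simp
  show ?thesis
    using smooth_fun_cong[OF _ o, of _ "\<lambda>y. coord (emb (\<iota> (s y))) (\<xi> y)"]
      smooth_fun_cong[OF _ o, of _ "\<lambda>y. coord (s y) ((\<theta> \<circ> \<xi>) y)"] e by force
qed

lemma vbundle_iso_theta: "vbundle_iso A (mC L) EE QC \<theta>"
  unfolding vbundle_iso_def
proof (intro conjI ballI allI impI bij_theta bproj_theta)
  fix e k assume e: "e \<in> assoc EE (mC L)"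
  obtain q where q: "q \<in> Q" "pproj QC q = bproj EE e" using Q_fibre by blast
  obtain w where w: "e = belem EE (emb (\<iota> q)) w" "\<theta> e = belem QC q w" using assoc_EE_belem[OF e q] .
  show "\<theta> (bscale k e) = bscale k (\<theta> e)"
    unfolding w(2) unfolding w(1) EE.bscale_belem QC.bscale_belem by (rule theta_belem[OF q(1)])
next
  fix e e' assume e: "e \<in> assoc EE (mC L)" and e': "e' \<in> assoc EE (mC L)" and p: "bproj EE e = bproj EE e'"
  obtain q where q: "q \<in> Q" "pproj QC q = bproj EE e" using Q_fibre by blast
  obtain w where w: "e = belem EE (emb (\<iota> q)) w" "\<theta> e = belem QC q w" using assoc_EE_belem[OF e q] .
  obtain w' where w': "e' = belem EE (emb (\<iota> q)) w'" "\<theta> e' = belem QC q w'"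
    using assoc_EE_belem[OF e' q(1)] q(2) p by metis
  have qs: "q \<in> pspace QC" using q(1) Q_subset by blast
  show "\<theta> (badd e e') = badd (\<theta> e) (\<theta> e')"
    unfolding w(2) w'(2) unfolding w(1) w'(1) EE.badd_belem[OF emb_space[OF q(1)]] QC.badd_belem[OF qs]
    by (rule theta_belem[OF q(1)])
next
  fix V \<xi> assume "open V \<and> (\<forall>x\<in>V. \<xi> x \<in> assoc EE (mC L) \<and> bproj EE (\<xi> x) = x)"
  then have V: "open V" "\<And>y. y \<in> V \<Longrightarrow> \<xi> y \<in> assoc EE (mC L)" "\<And>y. y \<in> V \<Longrightarrow> bproj EE (\<xi> y) = y" by auto
  have V': "(\<theta> \<circ> \<xi>) y \<in> assoc QC (mC L)" "bproj QC ((\<theta> \<circ> \<xi>) y) = y" if "y \<in> V" for y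
    using theta_in_assoc bproj_theta V(2,3) that by auto
  show "smooth_vsection A EE (mC L) V \<xi> \<longleftrightarrow> smooth_vsection A QC (mC L) V (\<theta> \<circ> \<xi>)"
  proof
    assume x: "smooth_vsection A EE (mC L) V \<xi>"
    show "smooth_vsection A QC (mC L) V (\<theta> \<circ> \<xi>)"
    proof (rule QC.smooth_vsectionI[OF V(1) V'])
      fix x assume "x \<in> V"
      obtain U s where s: "(U, s) \<in> psecs SQ" "x \<in> U" using SQ.section_cover by blast
      show "\<exists>U s. smooth_section A QC U s \<and> x \<in> U \<and> smooth_fun A (V \<inter> U) (\<lambda>y. coord (s y) ((\<theta> \<circ> \<xi>) y))"
        using SQ_sectionD(1)[OF s(1)] s(2) smooth_coord_theta[OF V s(1)]
          EE.smooth_fun_coord[OF x SQ_sectionD(5)[OF s(1)]] by blast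
    qed
  next
    assume x: "smooth_vsection A QC (mC L) V (\<theta> \<circ> \<xi>)"
    show "smooth_vsection A EE (mC L) V \<xi>"
    proof (rule EE.smooth_vsectionI[OF V])
      fix x assume "x \<in> V"
      obtain U s where s: "(U, s) \<in> psecs SQ" "x \<in> U" using SQ.section_cover by blast
      show "\<exists>U s. smooth_section A EE U s \<and> x \<in> U \<and> smooth_fun A (V \<inter> U) (\<lambda>y. coord (s y) (\<xi> y))"
        using SQ_sectionD(5)[OF s(1)] s(2) smooth_coord_theta[OF V s(1)]
          QC.smooth_fun_coord[OF x SQ_sectionD(1)[OF s(1)]] by blast
    qed
  qed
qed

subsection \<open>Comparison of the connections and of the Higgs fields\<close>

text \<open>Another point of \<open>Q\<close> in the same fibre differs by an element that, by
  freeness of the action on \<open>QC\<close>, lies in \<open>TT L\<close> and so commutes with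
  \<rho>. For general elements of \<open>TC L\<close> this would fail, whence the role of
  \<open>Q\<close> in \<open>brho\<close>.\<close>

lemma brho_belem:
  assumes q: "q \<in> Q"
  shows "brho L QC Q (belem QC q v) = belem QC q (rho L v)"
proof -
  have qs: "q \<in> pspace QC" using q Q_subset by blast
  have "(q', w) \<in> brho L QC Q (belem QC q v) \<longleftrightarrow> (q', w) \<in> belem QC q (rho L v)" for q' w
  proof
    assume "(q', w) \<in> brho L QC Q (belem QC q v)"
    then obtain q1 v1 a where *: "(q1, v1) \<in> belem QC q v" "q1 \<in> Q" "a \<in> pgroup QC"
        "q' = pact QC q1 a" "w = matrix_inv a *v rho L v1" unfolding brho_def by blast
    obtain b where b: "b \<in> pgroup QC" "q1 = pact QC q b" "v1 = matrix_inv b *v v"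
      using *(1) unfolding QC.belem_iff by blast
    obtain t where t: "t \<in> TT L" "q1 = pact QC q t"
      using SQ.act_ex1[of q q1] q *(2) QC.act_proj[OF qs b(1)] b(2) by (auto simp: SQ_simps)
    have "t = b" using QC.act_inject[OF qs, of t b] t b TT_subset_TC by (auto simp: pgroup_QC)
    have "matrix_inv t \<in> commuting_group (rho L)"
      using matrix_groupD(3)[OF matrix_group_TT t(1)] TT_subset_GG GG_rho by blast
    then have r: "rho L v1 = matrix_inv b *v rho L v" unfolding b(3) \<open>t = b\<close> by (rule commuting_groupD)
    have "belem QC q1 (rho L v1) = belem QC q (rho L v)" unfolding r b(2) by (rule QC.belem_act[OF qs b(1)])
    moreover have "(q', w) \<in> belem QC q1 (rho L v1)" unfolding QC.belem_iff using * by blast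
    ultimately show "(q', w) \<in> belem QC q (rho L v)" by simp
  next
    assume "(q', w) \<in> belem QC q (rho L v)"
    then show "(q', w) \<in> brho L QC Q (belem QC q v)"
      unfolding brho_def QC.belem_iff[of _ _ q "rho L v"] using QC.belem_self[OF qs, of v] q by blast
  qed
  then show ?thesis by auto
qed

lemma phi_belem:
  assumes s: "(U, s) \<in> psecs SQ" and c: "c \<in> A" and u: "u \<in> U \<inter> fst c"
  shows "\<exists>x. \<forall>v. \<phi> c u v = belem QC (s u) (v *s x) \<and> v *s x \<in> g1 L"
proof -
  have q: "s u \<in> pspace QC" "pproj QC (s u) = u" using QC.smooth_sectionD[OF SQ_sectionD(1)[OF s]] u by auto
  have "\<phi> c u 1 \<in> assoc QC (g1 L)" "bproj QC (\<phi> c u 1) = pproj QC (s u)" using phi_assoc[OF c, of u 1] u q(2) by auto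
  then obtain x a y where x: "\<phi> c u 1 = belem QC (s u) x" "a \<in> pgroup QC" "y \<in> g1 L" "x = a *v y"
    using QC.assocE[OF _ q(1)] by metis
  have xg: "x \<in> g1 L" using x g1_invariant pgroup_QC by auto
  have "\<phi> c u v = belem QC (s u) (v *s x)" for v
    using phi_scale[OF c, of u v] u x(1) QC.bscale_belem by simp
  moreover have "v *s x \<in> g1 L" for v
  proof -
    have "tau L (v *s x) = v *s tau L x" using tau_lie_aut unfolding lie_aut_def linear_vec_iff by blast
    then show ?thesis using xg by (simp add: g1_def vector_smult_assoc mult.commute)
  qed
  ultimately show ?thesis by blast
qed

lemma TT_component_p:
  assumes a: "a \<in> TT L" and w: "\<omega> \<in> real_g L" and h: "\<eta> \<in> real_t L"
  shows "component (real_p L) (real_t L) (a *v \<omega> + \<eta>) = a *v component (real_p L) (real_t L) \<omega>"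
proof -
  obtain \<zeta> where z: "\<zeta> \<in> real_t L" "a *v \<omega> - \<zeta> \<in> real_p L"
    using real_tp_decomposition[OF GG_real_g[of a \<omega>]] a w TT_subset_GG by blast
  have "component (real_p L) (real_t L) (a *v \<omega> + \<eta>) = (a *v \<omega> + \<eta>) - (\<zeta> + \<eta>)"
    using z h subspace_add[OF subspace_real_t] by (intro component_real_t(2)) auto
  also have "\<dots> = component (real_p L) (real_t L) (a *v \<omega>)" using component_real_t(2)[OF z] by simp
  finally show ?thesis using component_real_t_TT[OF a w] by simp
qed

text \<open>In a frame of \<open>Q\<close> the Maurer-Cartan form of the lift of \<open>\<psi>\<close> is the flat connection
  \<open>\<nabla> + \<phi> + \<rho>\<phi>\<close>.\<close>

lemma flat_connection:
  assumes s: "(U, s) \<in> psecs SQ" and c: "c \<in> A" and u: "u \<in> U \<inter> fst c" and W: "sheet W" "u \<in> p ` W"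
    and x: "\<phi> c u v = belem QC (s u) x"
  shows "mcform L (T.base_frame W (\<iota> \<circ> s)) c u v = N s c u v + x + rho L x" "N s c u v \<in> real_t L"
proof -
  let ?\<omega> = "mcform L (T.base_frame W (\<iota> \<circ> s)) c u v"
  note sT = iota_section_T[OF s]
  have q: "s u \<in> Q" "s u \<in> pspace QC" using SQ_sectionD(2)[OF s] u Q_subset by auto
  have uW: "u \<in> U \<inter> p ` W \<inter> fst c" using u W(2) by blast
  have w: "?\<omega> \<in> real_g L" by (rule T.mcform_base_frame_real_g[OF sT c W(1) uW])
  have n: "N s c u v = component (real_t L) (real_p L) ?\<omega>"
    using connection_eq[OF s c u] T.mc_component_eq[OF sT c W(1) uW] by simp
  have "mc_pullback L p T.P (component (real_p L) (real_t L)) c u v =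
      belem T.P ((\<iota> \<circ> s) u) (mc_component L p (component (real_p L) (real_t L)) (\<iota> \<circ> s) c u v)"
    by (rule T.mc_pullback_belem[OF sT c u TT_component_p mcform_TT[OF _ TT_subset_GG]])
  then have "mc_pullback L p T.P (component (real_p L) (real_t L)) c u v =
      belem T.P (\<iota> (s u)) (component (real_p L) (real_t L) ?\<omega>)"
    by (simp add: T.mc_component_eq[OF sT c W(1) uW])
  then have "(\<iota> (s u), component (real_p L) (real_t L) ?\<omega>) \<in>
      mc_pullback L p T.P (component (real_p L) (real_t L)) c u v"
    using T.P.belem_self[OF iota_props(1)[OF q(1)]] by simp
  then have "(\<iota> (s u), component (real_p L) (real_t L) ?\<omega>) \<in>
      {(\<iota> q, w) | q w. q \<in> Q \<and> (q, w) \<in> badd (\<phi> c u v) (brho L QC Q (\<phi> c u v))}"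
    using form_eq[OF c, of u v] u by blast
  then obtain q' where q': "q' \<in> Q" "\<iota> q' = \<iota> (s u)"
      "(q', component (real_p L) (real_t L) ?\<omega>) \<in> badd (\<phi> c u v) (brho L QC Q (\<phi> c u v))" by auto
  have "q' = s u" using inj_onD[OF iota_props(4) q'(2,1) q(1)] .
  moreover have "badd (\<phi> c u v) (brho L QC Q (\<phi> c u v)) = belem QC (s u) (x + rho L x)"
    unfolding x brho_belem[OF q(1)] by (rule QC.badd_belem[OF q(2)])
  ultimately have "(s u, component (real_p L) (real_t L) ?\<omega>) \<in> belem QC (s u) (x + rho L x)" using q'(3) by simp
  then have pr: "component (real_p L) (real_t L) ?\<omega> = x + rho L x"
    using QC.same_fibre_in_belem[OF q(2) _ QC.belem_self[OF q(2)]] QC.coord_belem[OF q(2)]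
    by (metis QC.act_inject QC.act_one QC.belem_iff QC.pgroup_one matrix_inv_mat_1 matrix_vector_mul_lid q(2))
  obtain \<eta> where e: "\<eta> \<in> real_t L" "?\<omega> - \<eta> \<in> real_p L" using real_tp_decomposition[OF w] .
  then show "N s c u v \<in> real_t L" "?\<omega> = N s c u v + x + rho L x"
    using n pr component_real_t[OF e] by (auto simp: algebra_simps)
qed

lemma connection_components:
  assumes s: "(U, s) \<in> psecs SQ" and c: "c \<in> A" and u: "u \<in> U \<inter> fst c"
    and x: "\<phi> c u v = belem QC (s u) x"
  shows "DE (\<lambda>y. emb (\<iota> (s y))) c u v = N s c u v + even_part L x + rho L (even_part L x)"
    "mc_pullback L p F.P (component (real_m L) (real_h L)) c u v =
       belem F.P (\<iota> (s u)) (odd_part L x + rho L (odd_part L x))"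
proof -
  obtain W where W: "sheet W" "u \<in> p ` W" using F.sheet_over .
  have uW: "u \<in> U \<inter> p ` W \<inter> fst c" using u W(2) by blast
  note sF = iota_section_F[OF s] and flat = flat_connection[OF s c u W x]
  have w: "mcform L (F.base_frame W (\<iota> \<circ> s)) c u v \<in> real_g L" by (rule F.mcform_base_frame_real_g[OF sF c W(1) uW])
  have n: "sigma L (N s c u v) = N s c u v" using flat(2) by (simp add: real_t_iff sigma_tC)
  have "DE (\<lambda>y. emb (\<iota> (s y))) c u v = component (real_h L) (real_m L) (mcform L (F.base_frame W (\<iota> \<circ> s)) c u v)"
    using DE_emb[OF sF c u, of v] F.mc_component_eq[OF sF c W(1) uW, of "component (real_h L) (real_m L)" v] by simp
  then show "DE (\<lambda>y. emb (\<iota> (s y))) c u v = N s c u v + even_part L x + rho L (even_part L x)"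
    by (simp add: component_real_h[OF w[unfolded flat(1)]] flat(1) even_part_add even_part_fixed[OF n] rho_even_part)
  have "mc_pullback L p F.P (component (real_m L) (real_h L)) c u v =
      belem F.P ((\<iota> \<circ> s) u) (mc_component L p (component (real_m L) (real_h L)) (\<iota> \<circ> s) c u v)"
    by (rule F.mc_pullback_belem[OF sF c u H_even_part(2) mcform_H])
  then show "mc_pullback L p F.P (component (real_m L) (real_h L)) c u v =
       belem F.P (\<iota> (s u)) (odd_part L x + rho L (odd_part L x))"
    by (simp add: F.mc_component_eq[OF sF c W(1) uW] component_real_m[OF w[unfolded flat(1)]] flat(1) odd_part_add odd_part_fixed[OF n] rho_odd_part)
qed

text \<open>Here e and i e are the values of a complex linear form on v and i v. As \<rho>(i e) = -i
  \<rho> e, averaging with factor i cancels e and retains \<rho> e.\<close>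

lemma antilinear_part01: "(1/2) *s ((a + (e + rho L e)) + \<i> *s (b + (\<i> *s e + rho L (\<i> *s e)))) =
    (1/2) *s (a + \<i> *s b) + rho L e"
  by (simp add: rho_smult vec_eq_iff algebra_simps)

text \<open>The same cancellation with factor -i, which retains e and removes \<rho> e.\<close>

lemma linear_part10: "(1/2) *s ((e + rho L e) + (- \<i>) *s (\<i> *s e + rho L (\<i> *s e))) = e"
  by (simp add: rho_smult vec_eq_iff algebra_simps)

lemma phi_k_belem:
  assumes s: "(U, s) \<in> psecs SQ" and c: "c \<in> A" and u: "u \<in> U \<inter> fst c" and x: "x \<in> g1 L" "\<phi> c u v = belem QC (s u) x"
  shows "phi_k L \<phi> c u v = belem QC (s u) (even_part L x)" "phi_m L \<phi> c u v = belem QC (s u) (odd_part L x)"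
proof -
  have "a *v x \<in> g1 L" "a \<in> commuting_group (sigma L)" if "a \<in> pgroup QC" for a
    using that g1_invariant[OF _ x(1)] TC_sigma by (auto simp: pgroup_QC)
  then show "phi_k L \<phi> c u v = belem QC (s u) (even_part L x)" "phi_m L \<phi> c u v = belem QC (s u) (odd_part L x)"
    unfolding phi_k_def phi_m_def x(2) component_g1[OF x(1), symmetric]
    by (intro QC.bmap_belem; simp add: component_g1 x(1) parts_commute)+
qed

lemma holomorphic_structure:
  assumes \<xi>: "smooth_vsection A EE (mC L) V \<xi>" and c: "c \<in> A" and x: "x \<in> V \<inter> fst c"
  shows "\<theta> (part01 (covd L A EE DE \<xi>) c x v) =
    badd (part01 (covd L A QC N (\<theta> \<circ> \<xi>)) c x v) (bbracket L (brho L QC Q (phi_k L \<phi> c x v)) (\<theta> (\<xi> x)))"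
proof -
  obtain U s where s: "(U, s) \<in> psecs SQ" "x \<in> U" using SQ.section_cover by blast
  have u: "x \<in> U \<inter> fst c" using s(2) x by blast
  have V: "open V" "\<And>y. y \<in> V \<Longrightarrow> \<xi> y \<in> assoc EE (mC L)" "\<And>y. y \<in> V \<Longrightarrow> bproj EE (\<xi> y) = y"
    using \<xi> unfolding smooth_vsection_def by auto
  have V': "(\<theta> \<circ> \<xi>) y \<in> assoc QC (mC L)" "bproj QC ((\<theta> \<circ> \<xi>) y) = y" if "y \<in> V" for y
    using theta_in_assoc bproj_theta V(2,3) that by auto
  have q: "s x \<in> Q" "s x \<in> pspace QC" using SQ_sectionD(2)[OF s(1,2)] Q_subset by auto
  obtain y where "\<forall>v. \<phi> c x v = belem QC (s x) (v *s y) \<and> v *s y \<in> g1 L"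
    using phi_belem[OF s(1) c u] by blast
  then have y: "\<phi> c x v = belem QC (s x) (v *s y)" "v *s y \<in> g1 L" for v by simp_all
  define h where "h z = coord (s z) ((\<theta> \<circ> \<xi>) z)" for z
  \<comment> \<open>The coordinate of the \<nabla>-derivative, which is common to both operators; D
    on the Higgs side only adds the bracket with the even part of \<phi> + \<rho>\<phi>.\<close>
  define D where "D v = dchart c h x v + br L (N s c x v) (h x)" for v
  define e where "e v = even_part L (v *s y)" for v
  have he: "h z = coord (emb (\<iota> (s z))) (\<xi> z)" if "z \<in> V \<inter> U" for z
    unfolding h_def using coord_theta[of "\<xi> z" "s z"] V(2,3) SQ_sectionD(2,3)[OF s(1)] that by simp
  have smE: "smooth_fun A (V \<inter> U) (\<lambda>z. coord (emb (\<iota> (s z))) (\<xi> z))"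
    by (rule EE.smooth_fun_coord[OF \<xi> SQ_sectionD(5)[OF s(1)]])
  have smQ: "smooth_fun A (V \<inter> U) (\<lambda>z. coord (s z) ((\<theta> \<circ> \<xi>) z))" using smooth_coord_theta[OF V s(1)] smE by blast
  have xVU: "x \<in> V \<inter> U \<inter> fst c" using x s(2) by blast
  have oVU: "open (V \<inter> U)" using V(1) SQ_sectionD(4)[OF s(1)] by blast
  have E: "covd L A EE DE \<xi> c x v = belem EE (emb (\<iota> (s x))) (D v + br L (e v + rho L (e v)) (h x))" for v
  proof -
    have "dchart c (\<lambda>z. coord (emb (\<iota> (s z))) (\<xi> z)) x v = dchart c h x v"
      using xVU by (intro dchart_cong_open[OF c oVU]) (auto simp: he)
    then show ?thesis
      using EE.covd_belem[OF gauge_covariant_DE SQ_sectionD(5)[OF s(1)] c xVU V smE, of v]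
        connection_components(1)[OF s(1) c u y(1), of v] he[of x] xVU
      by (simp add: D_def e_def br.add_left add.assoc)
  qed
  have QD: "covd L A QC N (\<theta> \<circ> \<xi>) c x v = belem QC (s x) (D v)" for v
    using QC.covd_belem[where \<xi> = "\<theta> \<circ> \<xi>", OF gauge_covariant_N SQ_sectionD(1)[OF s(1)] c xVU V(1) V' smQ, of v]
    by (simp add: D_def h_def[abs_def])
  have ei: "e (\<i> * v) = \<i> *s e v"
    by (simp only: e_def vector_smult_assoc[symmetric] even_part_smult)
  have "part01 (covd L A EE DE \<xi>) c x v = belem EE (emb (\<iota> (s x)))
     ((1/2) *s ((D v + br L (e v + rho L (e v)) (h x)) + \<i> *s (D (\<i> * v) + br L (e (\<i> * v) + rho L (e (\<i> * v))) (h x))))"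
    by (rule EE.part01_belem[where \<alpha> = "covd L A EE DE \<xi>", OF emb_space[OF q(1)] E E])
  \<comment> \<open>The zeros bring the bracketed argument into the form of
    \<open>antilinear_part01\<close> with a = b = 0. The derivative terms stay outside, as D is
    neither linear nor antilinear in v over the complex numbers.\<close>
  also have "(1/2) *s ((D v + br L (e v + rho L (e v)) (h x)) + \<i> *s (D (\<i> * v) + br L (e (\<i> * v) + rho L (e (\<i> * v))) (h x)))
     = (1/2) *s (D v + \<i> *s D (\<i> * v)) + br L ((1/2) *s ((0 + (e v + rho L (e v))) + \<i> *s (0 + (\<i> *s e v + rho L (\<i> *s e v))))) (h x)"
    unfolding ei by (simp add: br_add br_smult vec_eq_iff algebra_simps)
  also have "\<dots> = (1/2) *s (D v + \<i> *s D (\<i> * v)) + br L (rho L (e v)) (h x)"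
    unfolding antilinear_part01 by simp
  finally have "\<theta> (part01 (covd L A EE DE \<xi>) c x v) = belem QC (s x) ((1/2) *s (D v + \<i> *s D (\<i> * v)) + br L (rho L (e v)) (h x))"
    by (simp add: theta_belem[OF q(1)])
  moreover have "part01 (covd L A QC N (\<theta> \<circ> \<xi>)) c x v = belem QC (s x) ((1/2) *s (D v + \<i> *s D (\<i> * v)))"
    by (rule QC.part01_belem[where \<alpha> = "covd L A QC N (\<theta> \<circ> \<xi>)", OF q(2) QD QD])
  moreover have "brho L QC Q (phi_k L \<phi> c x v) = belem QC (s x) (rho L (e v))"
    unfolding e_def phi_k_belem(1)[OF s(1) c u y(2) y(1), of v] by (rule brho_belem[OF q(1)])
  moreover have "\<theta> (\<xi> x) = belem QC (s x) (h x)"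
  proof -
    have "\<theta> (\<xi> x) = belem QC (s x) (coord (s x) (\<theta> (\<xi> x)))"
      using QC.coord_section[OF V'(1,2), of x U s] SQ_sectionD(1)[OF s(1)] xVU unfolding smooth_section_def by auto
    then show ?thesis by (simp add: h_def)
  qed
  ultimately show ?thesis
    by (simp add: QC.bbracket_belem[OF q(2) QC.pgroup_lie_aut] QC.badd_belem[OF q(2)])
qed

lemma higgs_field_theta:
  assumes c: "c \<in> A" and x: "x \<in> fst c"
  shows "\<theta> (higgs_field L A p \<mu> H f c x v) = phi_m L \<phi> c x v"
proof -
  obtain U s where s: "(U, s) \<in> psecs SQ" "x \<in> U" using SQ.section_cover by blast
  have u: "x \<in> U \<inter> fst c" using s(2) x by blast
  have q: "s x \<in> Q" using SQ_sectionD(2)[OF s(1,2)] .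
  obtain y where "\<forall>v. \<phi> c x v = belem QC (s x) (v *s y) \<and> v *s y \<in> g1 L"
    using phi_belem[OF s(1) c u] by blast
  then have y: "\<phi> c x v = belem QC (s x) (v *s y)" "v *s y \<in> g1 L" for v by simp_all
  define e where "e v = odd_part L (v *s y)" for v
  define \<alpha> where "\<alpha> = (\<lambda>c u v. extend_belem F.P (HC L H) (mc_pullback L p F.P (component (real_m L) (real_h L)) c u v))"
  have a: "\<alpha> c x v = belem EE (emb (\<iota> (s x))) (e v + rho L (e v))" for v
    unfolding \<alpha>_def connection_components(2)[OF s(1) c u y(1), of v] e_def emb_def
    by (rule X.extend_belem_belem[OF iota_F[OF q]])
  have ei: "e (\<i> * v) = \<i> *s e v"
    by (simp only: e_def vector_smult_assoc[symmetric] odd_part_smult)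
  have "higgs_field L A p \<mu> H f c x v = part10 \<alpha> c x v"
    unfolding higgs_field_def \<alpha>_def PP_def ..
  also have "\<dots> = belem EE (emb (\<iota> (s x))) ((1/2) *s ((e v + rho L (e v)) + (- \<i>) *s (e (\<i> * v) + rho L (e (\<i> * v)))))"
    by (rule EE.part10_belem[where \<alpha> = \<alpha>, OF emb_space[OF q] a a])
  also have "\<dots> = belem EE (emb (\<iota> (s x))) (e v)"
    unfolding ei linear_part10 ..
  finally show ?thesis
    by (simp add: theta_belem[OF q] phi_k_belem(2)[OF s(1) c u y(2) y(1), of v] e_def)
qed

end

theorem proposition6p1:
  fixes L :: "('n::finite) toda_algebra"
    and H :: "'n cmat set"
    and A :: "('s::t2_space) atlas"
    and p :: "('c::t2_space) \<Rightarrow> 's"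
    and QC :: "('q, 's, 'n) pbundle"
    and \<phi> :: "('s, ('q, 'n) belem) form"
    and Q :: "'q set"
    and N :: "('q, 's, 'n) connection"
    and \<mu> :: "('c \<Rightarrow> 'c) \<Rightarrow> 'n cmat"
    and \<psi> f :: "'c \<Rightarrow> 'n cmat set"
  assumes "toda_data L"
    and "maximal_compact L H"
    and "riemann_surface A" and "compact (UNIV :: 's set)"
    and "universal_cover p"
    and "toda_pair L A QC \<phi>"
    and "provides_primitive_map L A p QC \<phi> Q N \<mu> \<psi>"
    and "f = coset_proj H \<circ> \<psi>"
  shows "\<exists>\<theta>. vbundle_iso A (mC L) (PC L A p \<mu> H f) QC \<theta> \<and>
    (\<forall>U \<xi>. smooth_vsection A (PC L A p \<mu> H f) (mC L) U \<xi> \<longrightarrow>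
      (\<forall>c\<in>A. \<forall>x\<in>U \<inter> fst c. \<forall>v.
        \<theta> (higgs_dbar L A p \<mu> H f \<xi> c x v) =
          badd (part01 (covd L A QC N (\<theta> \<circ> \<xi>)) c x v)
               (bbracket L (brho L QC Q (phi_k L \<phi> c x v)) (\<theta> (\<xi> x))))) \<and>
    (\<forall>c\<in>A. \<forall>x\<in>fst c. \<forall>v. \<theta> (higgs_field L A p \<mu> H f c x v) = phi_m L \<phi> c x v)"
proof -
  note prov = assms(7)[unfolded provides_primitive_map_def]
  obtain \<iota> where \<iota>: "bundle_iso A (sub_bundle A QC (TT L) Q) (pull_bundle A p \<mu> (TT L) \<psi>) \<iota>"
      "\<forall>(U, s)\<in>psecs (sub_bundle A QC (TT L) Q). \<forall>c\<in>A. \<forall>u\<in>U \<inter> fst c. \<forall>v.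
           N s c u v = mc_component L p (component (real_t L) (real_p L)) (\<iota> \<circ> s) c u v"
      "\<forall>c\<in>A. \<forall>u\<in>fst c. \<forall>v.
           mc_pullback L p (pull_bundle A p \<mu> (TT L) \<psi>) (component (real_p L) (real_t L)) c u v
           = {(\<iota> q, w) | q w. q \<in> Q \<and> (q, w) \<in> badd (\<phi> c u v) (brho L QC Q (\<phi> c u v))}"
    using prov by (elim conjE exE) (rule that)
  have data: "reduction L A QC Q" "chern_connection L A QC Q N" "equivariant p \<mu> \<psi>"
      "smooth_coset_map (lift_atlas A p) (GG L) (TT L) \<psi>"
    using prov by blast+
  interpret M: toda_map L A H p QC \<phi> Q N \<mu> \<psi> \<iota>
  proof unfold_locales
    show "covering_space UNIV p UNIV" using assms(5) unfolding universal_cover_def by blast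
    show "representation p (GG L) \<mu>" using prov unfolding is_holonomy_def by blast
    show "N s c u v = mc_component L p (component (real_t L) (real_p L)) (\<iota> \<circ> s) c u v"
      if "(U, s) \<in> psecs (sub_bundle A QC (TT L) Q)" "c \<in> A" "u \<in> U \<inter> fst c" for U s c u v
      using \<iota>(2) that by fast
    show "mc_pullback L p (pull_bundle A p \<mu> (TT L) \<psi>) (component (real_p L) (real_t L)) c u v
           = {(\<iota> q, w) | q w. q \<in> Q \<and> (q, w) \<in> badd (\<phi> c u v) (brho L QC Q (\<phi> c u v))}"
      if "c \<in> A" "u \<in> fst c" for c u v
      using \<iota>(3) that by blast
  qed (rule assms(1) assms(2) assms(3) assms(6) data \<iota>(1))+
  have f: "f = M.f" unfolding assms(8) M.f_def ..
  show ?thesis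
    unfolding f higgs_dbar_def M.PC_eq M.DD_eq_DE
    using M.vbundle_iso_theta M.holomorphic_structure M.higgs_field_theta by blast
qed

end
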